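(* Let $\{U_n\}_{n\ge 0}$ and $\{V_m\}_{m\ge 0}$ be linear recurrence sequences defined over the integers, with dominant roots $\alpha$ and $\beta$ respectively, and suppose that $\alpha$ and $\beta$ are multiplicatively independent. Suppose moreover that there are constants $N_0, M_0$ such that $|U_{n+1}|>|U_n|>0$ for all $n\ge N_0$ and $|V_{m+1}|>|V_m|>0$ for all $m\ge M_0$. Then there exists a finite set $\mathcal C\subset\mathbb Z$ such that an integer $c$ has at least two distinct representations of the form $c=U_n-V_m$ with $n\ge N_0$ and $m\ge M_0$ (i.e. there are two distinct pairs $(n,m)\neq(n_1,m_1)$ with $n,n_1\ge N_0$, $m,m_1\ge M_0$ and $U_n-V_m=U_{n_1}-V_{m_1}=c$) if and only if $c\in\mathcal C$. Moreover, the set $\mathcal C$ is effectively computable.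
   Context: A linear recurrence sequence defined over the integers is a sequence $\{U_n\}_{n\ge0}$ of integers satisfying $U_{n+k}=c_1U_{n+k-1}+\cdots+c_kU_n$ for all $n\ge 0$, for some $k\ge1$ and integers $c_1,\dots,c_k$ with $c_k\neq0$ (and integer initial values $U_0,\dots,U_{k-1}$). Writing the characteristic polynomial as $X^k-c_1X^{k-1}-\cdots-c_k=\prod_{i=1}^t(X-\alpha_i)^{\sigma_i}$ with distinct $\alpha_i$, one has $U_n=\sum_{i=1}^t a_i(n)\alpha_i^n$ with nonzero polynomials $a_i$ of degree at most $\sigma_i-1$. The root $\alpha=\alpha_1$ is called a dominant root if $|\alpha_1|>|\alpha_2|\ge\cdots\ge|\alpha_t|$ (the roots $\alpha_i$ being those with $a_i\neq 0$). Two nonzero algebraic numbers $\alpha,\beta$ are multiplicatively independent if $\alpha^x\beta^y=1$ with integers $x,y$ implies $x=y=0$. *)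

theory Defs
  imports Complex_Main "HOL-Library.Nat_Bijection" "HOL-Computational_Algebra.Polynomial"
begin

section \<open>Linear recurrence sequences\<close>

text \<open>The list \<open>cs\<close> contains the coefficients \<open>c\<^sub>1, \<dots>, c\<^sub>k\<close> in this order, so that
  \<open>cs ! i\<close> is \<open>c\<close> with index \<open>i + 1\<close>.\<close>

definition linear_recurrence :: "int list \<Rightarrow> (nat \<Rightarrow> int) \<Rightarrow> bool" where
  "linear_recurrence cs U \<longleftrightarrow>
     cs \<noteq> [] \<and> last cs \<noteq> 0 \<and>
     (\<forall>n. U (n + length cs) = (\<Sum>i<length cs. cs ! i * U (n + (length cs - 1 - i))))"

definition characteristic_poly :: "int list \<Rightarrow> complex poly" where
  "characteristic_poly cs =
     monom 1 (length cs) - (\<Sum>i<length cs. monom (of_int (cs ! i)) (length cs - 1 - i))"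

text \<open>The polynomial \<open>a r\<close> attached to a characteristic root \<open>r\<close> may vanish here; a root with
  \<open>a r = 0\<close> does not count as a root of the sequence.\<close>

definition root_expansion :: "int list \<Rightarrow> (nat \<Rightarrow> int) \<Rightarrow> (complex \<Rightarrow> complex poly) \<Rightarrow> bool" where
  "root_expansion cs U a \<longleftrightarrow>
     (\<forall>r. poly (characteristic_poly cs) r = 0 \<longrightarrow>
          degree (a r) \<le> order r (characteristic_poly cs) - 1) \<and>
     (\<forall>n. of_int (U n) =
          (\<Sum>r | poly (characteristic_poly cs) r = 0. poly (a r) (of_nat n) * r ^ n))"

definition dominant_root :: "int list \<Rightarrow> (nat \<Rightarrow> int) \<Rightarrow> complex \<Rightarrow> bool" where
  "dominant_root cs U \<alpha> \<longleftrightarrow>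
     (\<exists>a. root_expansion cs U a \<and>
          poly (characteristic_poly cs) \<alpha> = 0 \<and> a \<alpha> \<noteq> 0 \<and>
          (\<forall>r. poly (characteristic_poly cs) r = 0 \<and> a r \<noteq> 0 \<and> r \<noteq> \<alpha> \<longrightarrow> norm r < norm \<alpha>))"

definition multiplicatively_independent :: "complex \<Rightarrow> complex \<Rightarrow> bool" where
  "multiplicatively_independent \<alpha> \<beta> \<longleftrightarrow>
     \<alpha> \<noteq> 0 \<and> \<beta> \<noteq> 0 \<and>
     (\<forall>x y :: int. \<alpha> powi x * \<beta> powi y = 1 \<longrightarrow> x = 0 \<and> y = 0)"

definition two_representations ::
  "(nat \<Rightarrow> int) \<Rightarrow> (nat \<Rightarrow> int) \<Rightarrow> nat \<Rightarrow> nat \<Rightarrow> int \<Rightarrow> bool" where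
  "two_representations U V N\<^sub>0 M\<^sub>0 c \<longleftrightarrow>
     (\<exists>n m n\<^sub>1 m\<^sub>1. (n, m) \<noteq> (n\<^sub>1, m\<^sub>1) \<and>
        n \<ge> N\<^sub>0 \<and> n\<^sub>1 \<ge> N\<^sub>0 \<and> m \<ge> M\<^sub>0 \<and> m\<^sub>1 \<ge> M\<^sub>0 \<and>
        U n - V m = c \<and> U n\<^sub>1 - V m\<^sub>1 = c)"


section \<open>Effective computability\<close>

text \<open>Algorithms are descriptions of partial recursive (Kleene's mu-recursive) functions;
  \<open>computes p xs y\<close> says that \<open>p\<close> terminates on the arguments \<open>xs\<close> with result \<open>y\<close>.\<close>

datatype recf =
    Zero
  | Succ
  | Proj nat
  | Comp recf "recf list"
  | PrimRec recf recf
  | Mu recf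

inductive computes :: "recf \<Rightarrow> nat list \<Rightarrow> nat \<Rightarrow> bool" where
  zero: "computes Zero xs 0"
| succ: "computes Succ [x] (Suc x)"
| proj: "i < length xs \<Longrightarrow> computes (Proj i) xs (xs ! i)"
| comp: "list_all2 (\<lambda>g y. computes g xs y) gs ys \<Longrightarrow> computes f ys z \<Longrightarrow>
    computes (Comp f gs) xs z"
| prim_0: "computes f xs y \<Longrightarrow> computes (PrimRec f g) (0 # xs) y"
| prim_Suc: "computes (PrimRec f g) (n # xs) r \<Longrightarrow> computes g (n # r # xs) y \<Longrightarrow>
    computes (PrimRec f g) (Suc n # xs) y"
| mu: "computes f (n # xs) 0 \<Longrightarrow> \<forall>i<n. \<exists>y>0. computes f (i # xs) y \<Longrightarrow>
    computes (Mu f) xs n"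

inductive_cases computes_ZeroE: "computes Zero xs z"
inductive_cases computes_SuccE: "computes Succ xs z"
inductive_cases computes_ProjE: "computes (Proj i) xs z"
inductive_cases computes_CompE: "computes (Comp f gs) xs z"
inductive_cases computes_PrimRec_0E: "computes (PrimRec f g) (0 # xs) z"
inductive_cases computes_PrimRec_SucE: "computes (PrimRec f g) (Suc n # xs) z"
inductive_cases computes_MuE: "computes (Mu f) xs z"

lemma computes_deterministic:
  "computes p xs y \<Longrightarrow> computes p xs z \<Longrightarrow> y = z"
proof (induction p xs y arbitrary: z rule: computes.induct)
  case (zero xs)
  then show ?case by (rule computes_ZeroE) simp
next
  case (succ x)
  then show ?case by (rule computes_SuccE) simp
next
  case (proj i xs)
  from proj.prems show ?case by (rule computes_ProjE) simp
next
  case (comp xs gs ys f y)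
  from comp.prems obtain ys' where ys': "list_all2 (\<lambda>g. computes g xs) gs ys'" "computes f ys' z"
    by (rule computes_CompE)
  have "ys = ys'"
    using comp.IH(1) ys'(1) by (auto simp: list_all2_conv_all_nth intro: nth_equalityI)
  then show ?case using comp.IH(2) ys'(2) by simp
next
  case (prim_0 f xs y g)
  from prim_0.prems have "computes f xs z" by (rule computes_PrimRec_0E)
  then show ?case by (rule prim_0.IH)
next
  case (prim_Suc f g n xs r y)
  from prim_Suc.prems obtain r' where r': "computes (PrimRec f g) (n # xs) r'"
      "computes g (n # r' # xs) z"
    by (rule computes_PrimRec_SucE)
  from prim_Suc.IH(1)[OF r'(1)] r'(2) have "computes g (n # r # xs) z" by simp
  then show ?case by (rule prim_Suc.IH(2))
next
  case (mu f n xs)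
  from mu.prems have z: "computes f (z # xs) 0" "\<forall>i<z. \<exists>y>0. computes f (i # xs) y"
    by (auto elim: computes_MuE)
  have "\<not> z < n"
  proof
    assume "z < n"
    then obtain y where "y > 0" "\<forall>w. computes f (z # xs) w \<longrightarrow> y = w"
      using mu.IH(2) by blast
    then show False using z(1) by blast
  qed
  moreover have "\<not> n < z"
  proof
    assume "n < z"
    then obtain y where "y > 0" "computes f (n # xs) y" using z(2) by blast
    then show False using mu.IH(1) by blast
  qed
  ultimately show ?case by simp
qed

definition encode_ints :: "int list \<Rightarrow> nat" where
  "encode_ints xs = list_encode (map int_encode xs)"

text \<open>A recurrence sequence is presented to an algorithm by its coefficients and its
  initial values.\<close>

definition recurrence_data :: "int list \<Rightarrow> (nat \<Rightarrow> int) \<Rightarrow> nat list" where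
  "recurrence_data cs U = [encode_ints cs, encode_ints (map U [0..<length cs])]"

text \<open>The output of the algorithm is a complete list of the elements of the finite set \<open>C\<close>,
  not merely a decision procedure for \<open>C\<close> (which trivially exists for every finite set).\<close>

definition computes_int_set :: "recf \<Rightarrow> nat list \<Rightarrow> int set \<Rightarrow> bool" where
  "computes_int_set p xs C \<longleftrightarrow> (\<exists>ys. set ys = C \<and> computes p xs (encode_ints ys))"

end

theory Submission
  imports Defs "Jordan_Normal_Form.Char_Poly"
begin

text \<open>
  Let \<open>n > n\<^sub>1\<close> and \<open>m > m\<^sub>1\<close> with \<open>U n - U n\<^sub>1 = \<plusminus>(V m - V m\<^sub>1)\<close>. Isolating the dominant roots turns this
  into an approximation \<open>u \<alpha>\<^sup>N \<approx> w \<beta>\<^sup>M\<close> with relative error \<open>exp (- \<kappa> n)\<close>, where \<open>u\<close> and \<open>w\<close> have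
  logarithmic height at most \<open>\<epsilon> n\<close>; comparing the gaps \<open>n - n\<^sub>1\<close> and \<open>m - m\<^sub>1\<close> with a sequence of scales,
  \<open>\<epsilon>\<close> can be made as small as needed in terms of \<open>\<kappa>\<close>. Such an approximation is impossible for
  large \<open>n\<close>: by Dirichlet's theorem some \<open>a = \<alpha>\<^sup>k \<beta>\<^sup>-\<^sup>l\<close> with bounded \<open>k\<close> and \<open>l\<close> is very close to 1, and dividing
  the exponents by \<open>k\<close> and \<open>l\<close> shows that \<open>a\<^sup>q\<close> is extremely close to an algebraic number of height
  much smaller than \<open>q\<close>, which is a linear form in only two logarithms. This is excluded by Gelfond's
  method: the pigeonhole principle gives an auxiliary polynomial in \<open>x\<close> and \<open>a\<^sup>x\<close> that is tiny at
  many integers (its Newton expansion replaces complex analysis), Liouville's inequality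
  makes it vanish there, and a zero estimate gives a contradiction.

  Number fields are avoided: the height of \<open>z\<close> is the row norm of an integer matrix that has a fixed
  vector as eigenvector with eigenvalue \<open>z\<close>.

  Every constant is an explicit elementary function of the data, so that a finite search
  up to a computable bound produces the set.
\<close>

section \<open>Heights of algebraic integers given by integer matrices\<close>

text \<open>The gaps \<open>n - n1\<close> and \<open>m - m1\<close> are not bounded in advance, so
  \<open>u\<close> and \<open>w\<close> may have heights that grow with \<open>n\<close>. A lower
  bound for fixed coefficients would not cover them: heights up to a small multiple of
  \<open>n\<close> have to be harmless. Dirichlet's theorem serves the Newton expansion, which takes
  the place of a Schwarz lemma: only for bases \<open>a^l\<close> very close to 1 do the Newton
  coefficients of \<open>x \<mapsto> (x choose k) * a^(l*x)\<close> become negligible after the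
  first few. The evaluation points are \<open>s + t*q\<close>, where \<open>a^(l*(s+t*q))\<close> is
  replaced by \<open>(a^s * A^t)^l\<close>. As \<open>A\<close>, the number close to
  \<open>a^q\<close>, has height far below \<open>q\<close>, these points are many and spread widely
  while the values keep low height. A single use of Liouville's inequality then yields enough zeros,
  without extrapolation in stages. Since only integral combinations have a height here, every
  quotient is carried as a numerator and a denominator, and denominators are cleared before
  Liouville's inequality is used. Large exponents such as 80 and 1280 merely separate orders of
  magnitude.\<close>

definition hgt :: "nat \<Rightarrow> (nat \<Rightarrow> complex) \<Rightarrow> real \<Rightarrow> complex \<Rightarrow> bool" where
  "hgt d v B z \<longleftrightarrow> (\<exists>Z :: nat \<Rightarrow> nat \<Rightarrow> int. \<forall>i<d.
     (\<Sum>j<d. of_int (Z i j) * v j) = z * v i \<and> (\<Sum>j<d. \<bar>real_of_int (Z i j)\<bar>) \<le> B)"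

lemma hgt_mono: "hgt d v B z \<Longrightarrow> B \<le> C \<Longrightarrow> hgt d v C z"
  unfolding hgt_def by (meson order_trans)

lemma hgt_of_int: "\<bar>real_of_int c\<bar> \<le> B \<Longrightarrow> hgt d v B (of_int c)"
  unfolding hgt_def
proof (intro exI allI impI)
  fix i assume i: "i < d" and B: "\<bar>real_of_int c\<bar> \<le> B"
  let ?Z = "\<lambda>i j. if j = i then c else 0"
  have "(\<Sum>j<d. of_int (?Z i j) * v j) = (\<Sum>j<d. if j = i then of_int c * v j else 0)"
    by (rule sum.cong) auto
  moreover have "(\<Sum>j<d. \<bar>real_of_int (?Z i j)\<bar>) = (\<Sum>j<d. if j = i then \<bar>real_of_int c\<bar> else 0)"
    by (rule sum.cong) auto
  ultimately show "(\<Sum>j<d. of_int (?Z i j) * v j) = of_int c * v i \<and>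
      (\<Sum>j<d. \<bar>real_of_int (?Z i j)\<bar>) \<le> B"
    using i B by simp
qed

lemma hgt_0: "0 \<le> B \<Longrightarrow> hgt d v B 0"
  using hgt_of_int[of 0] by simp

lemma hgt_1: "1 \<le> B \<Longrightarrow> hgt d v B 1"
  using hgt_of_int[of 1] by simp

lemma hgt_add:
  assumes "hgt d v B z" "hgt d v C w"
  shows "hgt d v (B + C) (z + w)"
proof -
  obtain Z where Z: "\<And>i. i < d \<Longrightarrow> (\<Sum>j<d. of_int (Z i j) * v j) = z * v i"
      "\<And>i. i < d \<Longrightarrow> (\<Sum>j<d. \<bar>real_of_int (Z i j)\<bar>) \<le> B"
    using assms(1) unfolding hgt_def by blast
  obtain W where W: "\<And>i. i < d \<Longrightarrow> (\<Sum>j<d. of_int (W i j) * v j) = w * v i"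
      "\<And>i. i < d \<Longrightarrow> (\<Sum>j<d. \<bar>real_of_int (W i j)\<bar>) \<le> C"
    using assms(2) unfolding hgt_def by blast
  show ?thesis unfolding hgt_def
  proof (intro exI[of _ "\<lambda>i j. Z i j + W i j"] allI impI conjI)
    fix i assume i: "i < d"
    show "(\<Sum>j<d. of_int (Z i j + W i j) * v j) = (z + w) * v i"
      using Z(1)[OF i] W(1)[OF i] by (simp add: algebra_simps sum.distrib)
    have "(\<Sum>j<d. \<bar>real_of_int (Z i j + W i j)\<bar>)
        \<le> (\<Sum>j<d. \<bar>real_of_int (Z i j)\<bar> + \<bar>real_of_int (W i j)\<bar>)"
      by (rule sum_mono) simp
    then show "(\<Sum>j<d. \<bar>real_of_int (Z i j + W i j)\<bar>) \<le> B + C"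
      using Z(2)[OF i] W(2)[OF i] by (simp add: sum.distrib)
  qed
qed

lemma hgt_uminus: "hgt d v B z \<Longrightarrow> hgt d v B (- z)"
proof -
  assume "hgt d v B z"
  then obtain Z where Z: "\<And>i. i < d \<Longrightarrow> (\<Sum>j<d. of_int (Z i j) * v j) = z * v i"
      "\<And>i. i < d \<Longrightarrow> (\<Sum>j<d. \<bar>real_of_int (Z i j)\<bar>) \<le> B"
    unfolding hgt_def by blast
  show ?thesis unfolding hgt_def
    by (rule exI[of _ "\<lambda>i j. - Z i j"]) (simp add: Z sum_negf)
qed

lemma hgt_diff: "hgt d v B z \<Longrightarrow> hgt d v C w \<Longrightarrow> hgt d v (B + C) (z - w)"
  using hgt_add[of d v B z C "- w"] hgt_uminus by simp

text \<open>Integer matrices with the common eigenvector \<open>v\<close> are closed under sum and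
  product, and the maximal row sum is submultiplicative. Keeping \<open>v\<close> fixed makes these
  numbers behave like elements of one ring of algebraic integers.\<close>

lemma hgt_mult:
  assumes "hgt d v B z" "hgt d v C w"
  shows "hgt d v (B * C) (z * w)"
proof -
  obtain Z where Z: "\<And>i. i < d \<Longrightarrow> (\<Sum>j<d. of_int (Z i j) * v j) = z * v i"
      "\<And>i. i < d \<Longrightarrow> (\<Sum>j<d. \<bar>real_of_int (Z i j)\<bar>) \<le> B"
    using assms(1) unfolding hgt_def by blast
  obtain W where W: "\<And>i. i < d \<Longrightarrow> (\<Sum>j<d. of_int (W i j) * v j) = w * v i"
      "\<And>i. i < d \<Longrightarrow> (\<Sum>j<d. \<bar>real_of_int (W i j)\<bar>) \<le> C"
    using assms(2) unfolding hgt_def by blast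
  show ?thesis unfolding hgt_def
  proof (intro exI[of _ "\<lambda>i j. \<Sum>k<d. Z i k * W k j"] allI impI conjI)
    fix i assume i: "i < d"
    have "0 \<le> (\<Sum>j<d. \<bar>real_of_int (W i j)\<bar>)" by (rule sum_nonneg) simp
    also have "\<dots> \<le> C" by (rule W(2)[OF i])
    finally have C: "0 \<le> C" .
    have "(\<Sum>j<d. of_int (\<Sum>k<d. Z i k * W k j) * v j)
        = (\<Sum>j<d. \<Sum>k<d. of_int (Z i k) * (of_int (W k j) * v j))"
      by (simp add: sum_distrib_right mult.assoc)
    also have "\<dots> = (\<Sum>k<d. of_int (Z i k) * (\<Sum>j<d. of_int (W k j) * v j))"
      by (subst sum.swap) (simp add: sum_distrib_left)
    also have "\<dots> = (\<Sum>k<d. of_int (Z i k) * (w * v k))"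
      by (rule sum.cong) (simp_all add: W)
    also have "\<dots> = w * (\<Sum>k<d. of_int (Z i k) * v k)"
      by (simp add: sum_distrib_left algebra_simps)
    finally show "(\<Sum>j<d. of_int (\<Sum>k<d. Z i k * W k j) * v j) = (z * w) * v i"
      using Z(1)[OF i] by simp
    have "(\<Sum>j<d. \<bar>real_of_int (\<Sum>k<d. Z i k * W k j)\<bar>)
        \<le> (\<Sum>j<d. \<Sum>k<d. \<bar>real_of_int (Z i k)\<bar> * \<bar>real_of_int (W k j)\<bar>)"
    proof (rule sum_mono)
      fix j
      have "\<bar>real_of_int (\<Sum>k<d. Z i k * W k j)\<bar> = \<bar>\<Sum>k<d. real_of_int (Z i k) * real_of_int (W k j)\<bar>"
        by simp
      also have "\<dots> \<le> (\<Sum>k<d. \<bar>real_of_int (Z i k) * real_of_int (W k j)\<bar>)" by (rule sum_abs)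
      finally show "\<bar>real_of_int (\<Sum>k<d. Z i k * W k j)\<bar>
          \<le> (\<Sum>k<d. \<bar>real_of_int (Z i k)\<bar> * \<bar>real_of_int (W k j)\<bar>)"
        by (simp add: abs_mult)
    qed
    also have "\<dots> = (\<Sum>k<d. \<bar>real_of_int (Z i k)\<bar> * (\<Sum>j<d. \<bar>real_of_int (W k j)\<bar>))"
      by (subst sum.swap) (simp add: sum_distrib_left)
    also have "\<dots> \<le> (\<Sum>k<d. \<bar>real_of_int (Z i k)\<bar> * C)"
      by (rule sum_mono, rule mult_left_mono) (auto simp: W)
    also have "\<dots> = (\<Sum>k<d. \<bar>real_of_int (Z i k)\<bar>) * C" by (simp add: sum_distrib_right)
    also have "\<dots> \<le> B * C" by (rule mult_right_mono) (auto simp: Z i C)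
    finally show "(\<Sum>j<d. \<bar>real_of_int (\<Sum>k<d. Z i k * W k j)\<bar>) \<le> B * C" .
  qed
qed

lemma hgt_power: "hgt d v B z \<Longrightarrow> hgt d v (B ^ n) (z ^ n)"
  by (induction n) (simp_all add: hgt_1 hgt_mult)

lemma hgt_sum:
  "finite I \<Longrightarrow> (\<And>i. i \<in> I \<Longrightarrow> hgt d v (B i) (z i)) \<Longrightarrow> hgt d v (\<Sum>i\<in>I. B i) (\<Sum>i\<in>I. z i)"
  by (induction I rule: finite_induct) (simp_all add: hgt_0 hgt_add)

text \<open>Read the eigenvalue equation in the row where \<open>v\<close> has its largest
  entry.\<close>

lemma hgt_norm_le:
  assumes "hgt d v B z" "i < d" "v i \<noteq> 0"
  shows "norm z \<le> B"
proof -
  obtain Z where Z: "\<And>i. i < d \<Longrightarrow> (\<Sum>j<d. of_int (Z i j) * v j) = z * v i"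
      "\<And>i. i < d \<Longrightarrow> (\<Sum>j<d. \<bar>real_of_int (Z i j)\<bar>) \<le> B"
    using assms(1) unfolding hgt_def by blast
  define m where "m = Max ((\<lambda>j. norm (v j)) ` {..<d})"
  have ne: "{..<d} \<noteq> {}" using assms(2) by auto
  have "m \<in> (\<lambda>j. norm (v j)) ` {..<d}"
    unfolding m_def by (rule Max_in) (use ne in auto)
  then obtain k where k: "k < d" "norm (v k) = m" by auto
  have le: "norm (v j) \<le> m" if "j < d" for j
    unfolding m_def using that by (intro Max_ge) auto
  have "0 < norm (v i)" using assms(3) by simp
  also have "\<dots> \<le> m" by (rule le[OF assms(2)])
  finally have m: "0 < m" .
  have "norm z * m = norm (\<Sum>j<d. of_int (Z k j) * v j)"
    using Z(1)[OF k(1)] k(2) by (simp add: norm_mult)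
  also have "\<dots> \<le> (\<Sum>j<d. \<bar>real_of_int (Z k j)\<bar> * m)"
    by (rule sum_norm_le) (auto simp: norm_mult le intro!: mult_left_mono)
  also have "\<dots> = (\<Sum>j<d. \<bar>real_of_int (Z k j)\<bar>) * m" by (simp add: sum_distrib_right)
  also have "\<dots> \<le> B * m" by (rule mult_right_mono) (use Z(2)[OF k(1)] m in auto)
  finally show ?thesis using m by simp
qed

text \<open>Dropping the roots equal to 0 lets Liouville's inequality work for singular matrices,
  about which the determinant says nothing.\<close>

lemma prod_list_linear_lowest_coeff:
  fixes as :: "complex list"
  shows "\<exists>e. \<forall>p. p = (\<Prod>a\<leftarrow>as. [:- a, 1:]) \<longrightarrow> coeff p e = (\<Prod>a\<leftarrow>filter (\<lambda>a. a \<noteq> 0) as. - a)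
     \<and> (\<forall>i<e. coeff p i = 0)"
proof (induction as)
  case Nil
  then show ?case by (intro exI[of _ 0]) simp
next
  case (Cons a as)
  then obtain e where e: "coeff (\<Prod>a\<leftarrow>as. [:- a, 1:]) e = (\<Prod>a\<leftarrow>filter (\<lambda>a. a \<noteq> 0) as. - a)"
    "\<forall>i<e. coeff (\<Prod>a\<leftarrow>as. [:- a, 1:]) i = 0" by auto
  show ?case
  proof (cases "a = 0")
    case True
    show ?thesis using e True
      by (intro exI[of _ "Suc e"]) (auto simp: coeff_pCons split: nat.splits)
  next
    case False
    show ?thesis using e False
      by (intro exI[of _ e]) (auto simp: coeff_pCons split: nat.splits)
  qed
qed

text \<open>The lowest nonzero coefficient of the characteristic polynomial is a nonzero integer
  and, up to sign, the product of the nonzero eigenvalues. One of them is \<open>z\<close>; the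
  others, at most \<open>d - 1\<close>, are bounded by the row norm.\<close>

lemma hgt_liouville:
  assumes h: "hgt d v B z" and i: "i < d" "v i \<noteq> 0" and B: "1 \<le> B" and z: "z \<noteq> 0"
  shows "1 \<le> norm z * B ^ (d - 1)"
proof -
  obtain Z where Z: "\<And>i. i < d \<Longrightarrow> (\<Sum>j<d. of_int (Z i j) * v j) = z * v i"
      "\<And>i. i < d \<Longrightarrow> (\<Sum>j<d. \<bar>real_of_int (Z i j)\<bar>) \<le> B"
    using h unfolding hgt_def by blast
  define M where "M = mat d d (\<lambda>(i, j). Z i j)"
  define A :: "complex mat" where "A = map_mat of_int M"
  have M: "M \<in> carrier_mat d d" by (simp add: M_def)
  have A: "A \<in> carrier_mat d d" using M by (simp add: A_def)
  have Aij: "A $$ (i, j) = of_int (Z i j)" if "i < d" "j < d" for i j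
    using that by (simp add: A_def M_def)
  have mulA: "(A *\<^sub>v w) $ i = (\<Sum>j<d. of_int (Z i j) * w $ j)" if "i < d" "w \<in> carrier_vec d" for w i
  proof -
    have "(A *\<^sub>v w) $ i = (\<Sum>j = 0..<d. A $$ (i, j) * w $ j)"
      using that A by (simp add: scalar_prod_def)
    also have "\<dots> = (\<Sum>j<d. of_int (Z i j) * w $ j)"
      by (rule sum.cong) (use that Aij in auto)
    finally show ?thesis .
  qed
  obtain as where as: "char_poly A = (\<Prod>a\<leftarrow>as. [:- a, 1:])" "length as = d"
    using char_poly_factorized[OF A] by auto
  have cp: "char_poly A = map_poly of_int (char_poly M)"
    unfolding A_def by (rule of_int_hom.char_poly_hom[OF M])
  have "eigenvalue A z"
    unfolding eigenvalue_def eigenvector_def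
  proof (intro exI[of _ "vec d v"] conjI)
    show "vec d v \<in> carrier_vec (dim_row A)" using A by simp
    show "vec d v \<noteq> 0\<^sub>v (dim_row A)"
    proof
      assume "vec d v = 0\<^sub>v (dim_row A)"
      then have "vec d v $ i = 0\<^sub>v (dim_row A) $ i" by simp
      then show False using A i by simp
    qed
    show "A *\<^sub>v vec d v = z \<cdot>\<^sub>v vec d v"
    proof (rule eq_vecI)
      show "dim_vec (A *\<^sub>v vec d v) = dim_vec (z \<cdot>\<^sub>v vec d v)" using A by simp
      fix k assume "k < dim_vec (z \<cdot>\<^sub>v vec d v)"
      then have k: "k < d" by simp
      have "(\<Sum>j<d. of_int (Z k j) * vec d v $ j) = (\<Sum>j<d. of_int (Z k j) * v j)"
        by (rule sum.cong) auto
      then show "(A *\<^sub>v vec d v) $ k = (z \<cdot>\<^sub>v vec d v) $ k"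
        using k Z(1)[OF k] by (subst mulA) auto
    qed
  qed
  then have "poly (char_poly A) z = 0" using eigenvalue_root_char_poly[OF A] by blast
  then have zas: "z \<in> set as" unfolding as(1) by (auto simp: poly_prod_list prod_list_zero_iff)
  \<comment> \<open>Any eigenvalue \<open>a\<close> has an eigenvector \<open>w\<close> of its own,
    and the same integer matrix witnesses \<open>hgt d w B a\<close>.\<close>
  have bound: "norm a \<le> B" if a: "a \<in> set as" for a
  proof -
    have "poly (char_poly A) a = 0" unfolding as(1) using linear_poly_root[OF a] by simp
    then have "eigenvalue A a" using eigenvalue_root_char_poly[OF A] by blast
    then obtain w where w: "w \<in> carrier_vec d" "w \<noteq> 0\<^sub>v d" "A *\<^sub>v w = a \<cdot>\<^sub>v w"
      unfolding eigenvalue_def eigenvector_def using A by auto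
    have "hgt d (\<lambda>i. w $ i) B a"
      unfolding hgt_def
    proof (intro exI[of _ Z] allI impI conjI)
      fix k assume k: "k < d"
      show "(\<Sum>j<d. of_int (Z k j) * w $ j) = a * w $ k"
        using mulA[OF k w(1)] w k by simp
    qed (rule Z(2))
    moreover obtain k where "k < d" "w $ k \<noteq> 0"
      using w(1,2) by (metis eq_vecI carrier_vecD index_zero_vec(1) index_zero_vec(2))
    ultimately show ?thesis using hgt_norm_le by blast
  qed
  obtain e where e: "coeff (char_poly A) e = (\<Prod>a\<leftarrow>filter (\<lambda>a. a \<noteq> 0) as. - a)"
    using prod_list_linear_lowest_coeff as(1) by metis
  have "coeff (char_poly A) e = of_int (coeff (char_poly M) e)"
    unfolding cp by (simp add: coeff_map_poly)
  moreover have "coeff (char_poly A) e \<noteq> 0" unfolding e by (auto simp: prod_list_zero_iff)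
  ultimately have "1 \<le> norm (coeff (char_poly A) e)" by simp
  also have "norm (coeff (char_poly A) e) = (\<Prod>a\<leftarrow>filter (\<lambda>a. a \<noteq> 0) as. norm a)"
    unfolding e by (induction as) (auto simp: norm_mult)
  also have "\<dots> \<le> norm z * B ^ (d - 1)"
  proof -
    have P: "(\<Prod>a\<leftarrow>xs. norm a) \<le> B ^ length xs" if "\<And>a. a \<in> set xs \<Longrightarrow> norm a \<le> B" for xs :: "complex list"
      using that by (induction xs) (use B in \<open>auto intro!: mult_mono prod_list_nonneg\<close>)
    obtain ys zs where s: "filter (\<lambda>a. a \<noteq> 0) as = ys @ z # zs"
      using zas z split_list[of z "filter (\<lambda>a. a \<noteq> 0) as"] by auto
    have sub: "set (ys @ zs) \<subseteq> set as"
    proof -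
      have "set (ys @ z # zs) \<subseteq> set as" unfolding s[symmetric] by auto
      then show ?thesis by auto
    qed
    have len: "length (ys @ zs) \<le> d - 1"
      using as(2) length_filter_le[of "\<lambda>a. a \<noteq> 0" as] s by simp
    have "(\<Prod>a\<leftarrow>filter (\<lambda>a. a \<noteq> 0) as. norm a) = norm z * (\<Prod>a\<leftarrow>ys @ zs. norm a)"
      unfolding s by simp
    also have "\<dots> \<le> norm z * B ^ length (ys @ zs)"
      by (intro mult_left_mono P) (use bound sub in auto)
    also have "\<dots> \<le> norm z * B ^ (d - 1)"
      by (intro mult_left_mono power_increasing len B) simp
    finally show ?thesis .
  qed
  finally show ?thesis .
qed

section \<open>Tensor products of eigenvectors and companion matrices\<close>

lemma sum_div_mod:
  fixes f :: "nat \<Rightarrow> nat \<Rightarrow> 'a::comm_monoid_add"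
  shows "(\<Sum>j<d * e. f (j div e) (j mod e)) = (\<Sum>j<d. \<Sum>k<e. f j k)"
proof (cases "e = 0")
  case False
  have "(\<Sum>j<d * e. f (j div e) (j mod e)) = (\<Sum>j<d. \<Sum>i\<in>{j * e..<j * e + e}. f (i div e) (i mod e))"
    by (rule sum.nat_group[symmetric])
  also have "\<dots> = (\<Sum>j<d. \<Sum>k<e. f j k)"
  proof (rule sum.cong[OF refl])
    fix j
    show "(\<Sum>i\<in>{j * e..<j * e + e}. f (i div e) (i mod e)) = (\<Sum>k<e. f j k)"
      using sum.shift_bounds_nat_ivl[of "\<lambda>i. f (i div e) (i mod e)" 0 "j * e" e] False
      by (simp add: lessThan_atLeast0 add.commute)
  qed
  finally show ?thesis .
qed simp

text \<open>The matrix is the Kronecker product of \<open>Z\<close> with the identity, an index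
  below \<open>d * e\<close> standing for a pair via \<open>div\<close> and \<open>mod\<close>. With
  \<open>hgt_tensor2\<close> this places numbers with different eigenvectors into one ring, in place
  of a compositum of fields.\<close>

lemma hgt_tensor1:
  assumes "hgt d v B z"
  shows "hgt (d * e) (\<lambda>i. v (i div e) * w (i mod e)) B z"
proof (cases "e = 0")
  case True
  then show ?thesis by (simp add: hgt_def)
next
  case False
  obtain Z where Z: "\<And>i. i < d \<Longrightarrow> (\<Sum>j<d. of_int (Z i j) * v j) = z * v i"
      "\<And>i. i < d \<Longrightarrow> (\<Sum>j<d. \<bar>real_of_int (Z i j)\<bar>) \<le> B"
    using assms(1) unfolding hgt_def by blast
  show ?thesis unfolding hgt_def
  proof (intro exI[of _ "\<lambda>i j. if j mod e = i mod e then Z (i div e) (j div e) else 0"] allI impI conjI)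
    fix i assume i: "i < d * e"
    have id: "i div e < d" using i by (simp add: less_mult_imp_div_less)
    have ie: "i mod e < e" using False by simp
    have "(\<Sum>j<d * e. of_int (if j mod e = i mod e then Z (i div e) (j div e) else 0) * (v (j div e) * w (j mod e)))
       = (\<Sum>j<d. \<Sum>k<e. of_int (if k = i mod e then Z (i div e) j else 0) * (v j * w k))"
      by (rule sum_div_mod)
    also have "\<dots> = (\<Sum>j<d. \<Sum>k<e. if k = i mod e then of_int (Z (i div e) j) * (v j * w k) else 0)"
      by (intro sum.cong) auto
    also have "\<dots> = (\<Sum>j<d. of_int (Z (i div e) j) * v j) * w (i mod e)"
      using ie by (simp add: sum_distrib_right mult.assoc)
    finally show "(\<Sum>j<d * e. of_int (if j mod e = i mod e then Z (i div e) (j div e) else 0) * (v (j div e) * w (j mod e)))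
       = z * (v (i div e) * w (i mod e))"
      using Z(1)[OF id] by simp
    have "(\<Sum>j<d * e. \<bar>real_of_int (if j mod e = i mod e then Z (i div e) (j div e) else 0)\<bar>)
       = (\<Sum>j<d. \<Sum>k<e. \<bar>real_of_int (if k = i mod e then Z (i div e) j else 0)\<bar>)"
      by (rule sum_div_mod)
    also have "\<dots> = (\<Sum>j<d. \<Sum>k<e. if k = i mod e then \<bar>real_of_int (Z (i div e) j)\<bar> else 0)"
      by (intro sum.cong) auto
    also have "\<dots> = (\<Sum>j<d. \<bar>real_of_int (Z (i div e) j)\<bar>)"
      using ie by simp
    finally show "(\<Sum>j<d * e. \<bar>real_of_int (if j mod e = i mod e then Z (i div e) (j div e) else 0)\<bar>) \<le> B"
      using Z(2)[OF id] by simp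
  qed
qed

lemma hgt_tensor2:
  assumes "hgt e w B z"
  shows "hgt (d * e) (\<lambda>i. v (i div e) * w (i mod e)) B z"
proof (cases "e = 0")
  case True
  then show ?thesis by (simp add: hgt_def)
next
  case False
  obtain Z where Z: "\<And>i. i < e \<Longrightarrow> (\<Sum>j<e. of_int (Z i j) * w j) = z * w i"
      "\<And>i. i < e \<Longrightarrow> (\<Sum>j<e. \<bar>real_of_int (Z i j)\<bar>) \<le> B"
    using assms(1) unfolding hgt_def by blast
  show ?thesis unfolding hgt_def
  proof (intro exI[of _ "\<lambda>i j. if j div e = i div e then Z (i mod e) (j mod e) else 0"] allI impI conjI)
    fix i assume i: "i < d * e"
    have id: "i div e < d" using i by (simp add: less_mult_imp_div_less)
    have ie: "i mod e < e" using False by simp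
    have "(\<Sum>j<d * e. of_int (if j div e = i div e then Z (i mod e) (j mod e) else 0) * (v (j div e) * w (j mod e)))
       = (\<Sum>j<d. \<Sum>k<e. of_int (if j = i div e then Z (i mod e) k else 0) * (v j * w k))"
      by (rule sum_div_mod)
    also have "\<dots> = (\<Sum>j<d. if j = i div e then \<Sum>k<e. of_int (Z (i mod e) k) * (v j * w k) else 0)"
      by (intro sum.cong) auto
    also have "\<dots> = v (i div e) * (\<Sum>k<e. of_int (Z (i mod e) k) * w k)"
      using id by (simp add: sum_distrib_left mult_ac)
    finally show "(\<Sum>j<d * e. of_int (if j div e = i div e then Z (i mod e) (j mod e) else 0) * (v (j div e) * w (j mod e)))
       = z * (v (i div e) * w (i mod e))"
      using Z(1)[OF ie] by (simp add: mult_ac)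
    have "(\<Sum>j<d * e. \<bar>real_of_int (if j div e = i div e then Z (i mod e) (j mod e) else 0)\<bar>)
       = (\<Sum>j<d. \<Sum>k<e. \<bar>real_of_int (if j = i div e then Z (i mod e) k else 0)\<bar>)"
      by (rule sum_div_mod)
    also have "\<dots> = (\<Sum>j<d. if j = i div e then \<Sum>k<e. \<bar>real_of_int (Z (i mod e) k)\<bar> else 0)"
      by (intro sum.cong) auto
    also have "\<dots> = (\<Sum>k<e. \<bar>real_of_int (Z (i mod e) k)\<bar>)"
      using id by simp
    finally show "(\<Sum>j<d * e. \<bar>real_of_int (if j div e = i div e then Z (i mod e) (j mod e) else 0)\<bar>) \<le> B"
      using Z(2)[OF ie] by simp
  qed
qed

text \<open>The companion matrix of the relation: a shift in all rows but the last.\<close>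

lemma hgt_companion:
  assumes k: "0 < k" and r: "r ^ k = (\<Sum>i<k. of_int (c i) * r ^ i)"
    and B: "1 \<le> B" "(\<Sum>i<k. \<bar>real_of_int (c i)\<bar>) \<le> B"
  shows "hgt k (\<lambda>i. r ^ i) B r"
  unfolding hgt_def
proof (intro exI[of _ "\<lambda>i j. if Suc i = k then c j else if j = Suc i then 1 else 0"] allI impI conjI)
  fix i assume i: "i < k"
  let ?Z = "\<lambda>i j. if Suc i = k then c j else if j = Suc i then 1 else (0::int)"
  show "(\<Sum>j<k. of_int (?Z i j) * r ^ j) = r * r ^ i"
  proof (cases "Suc i = k")
    case True
    then show ?thesis using r by (simp flip: power_Suc)
  next
    case False
    have "(\<Sum>j<k. of_int (?Z i j) * r ^ j) = (\<Sum>j<k. if j = Suc i then r ^ j else 0)"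
      by (rule sum.cong) (use False in auto)
    then show ?thesis using i False by simp
  qed
  show "(\<Sum>j<k. \<bar>real_of_int (?Z i j)\<bar>) \<le> B"
  proof (cases "Suc i = k")
    case True
    then show ?thesis using B by simp
  next
    case False
    have "(\<Sum>j<k. \<bar>real_of_int (?Z i j)\<bar>) = (\<Sum>j<k. if j = Suc i then 1 else 0)"
      by (rule sum.cong) (use False in auto)
    then show ?thesis using i False B by simp
  qed
qed

section \<open>Zero estimate\<close>

text \<open>Stated for upper bounds of the degrees, so that a vanishing top coefficient needs no
  separate case.\<close>

lemma coeff_mult_degree_le:
  assumes "degree p \<le> m" "degree q \<le> n"
  shows "coeff (p * q) (m + n) = coeff p m * coeff q n"
proof -
  have "coeff (p * q) (m + n) = (\<Sum>i\<le>m + n. coeff p i * coeff q (m + n - i))"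
    by (rule coeff_mult)
  also have "\<dots> = (\<Sum>i\<le>m + n. if i = m then coeff p m * coeff q n else 0)"
  proof (rule sum.cong[OF refl])
    fix i assume "i \<in> {..m + n}"
    show "coeff p i * coeff q (m + n - i) = (if i = m then coeff p m * coeff q n else 0)"
    proof (cases i m rule: linorder_cases)
      case less
      then have "degree q < m + n - i" using assms(2) by simp
      then show ?thesis using less by (simp add: coeff_eq_0)
    next
      case greater
      then have "degree p < i" using assms(1) by simp
      then show ?thesis using greater by (simp add: coeff_eq_0)
    qed simp
  qed
  finally show ?thesis by simp
qed

lemma coeff_prod_degree_le:
  assumes "finite I" "\<And>i. i \<in> I \<Longrightarrow> degree (f i) \<le> m i"
  shows "degree (\<Prod>i\<in>I. f i) \<le> (\<Sum>i\<in>I. m i) \<and>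
    coeff (\<Prod>i\<in>I. f i) (\<Sum>i\<in>I. m i) = (\<Prod>i\<in>I. coeff (f i) (m i) :: 'a :: comm_semiring_1)"
  using assms
proof (induction I rule: finite_induct)
  case (insert x I)
  have x: "degree (f x) \<le> m x" and IH: "degree (\<Prod>i\<in>I. f i) \<le> (\<Sum>i\<in>I. m i)"
    "coeff (\<Prod>i\<in>I. f i) (\<Sum>i\<in>I. m i) = (\<Prod>i\<in>I. coeff (f i) (m i))"
    using insert by auto
  have "degree (f x * (\<Prod>i\<in>I. f i)) \<le> degree (f x) + degree (\<Prod>i\<in>I. f i)"
    by (rule degree_mult_le)
  then show ?case using insert(1,2) x IH coeff_mult_degree_le[OF x IH(1)] by simp
qed simp

definition binom_poly :: "nat \<Rightarrow> complex poly" where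
  "binom_poly k = Polynomial.smult (1 / fact k) (\<Prod>j<k. [:- of_nat j, 1:])"

lemma poly_binom_poly: "poly (binom_poly k) (of_nat x) = of_nat (x choose k)"
proof -
  have "poly (binom_poly k) (of_nat x) = (\<Prod>j<k. of_nat x - of_nat j) / fact k"
    by (simp add: binom_poly_def poly_prod)
  also have "\<dots> = of_nat x gchoose k"
    by (simp add: gbinomial_prod_rev atLeast0LessThan)
  finally show ?thesis by (simp add: binomial_gbinomial)
qed

lemma degree_binom_poly: "degree (binom_poly k) \<le> k"
proof -
  have "degree (\<Prod>j<k. [:- of_nat j, 1::complex:]) \<le> (\<Sum>j<k. 1)"
    using coeff_prod_degree_le[of "{..<k}" "\<lambda>j. [:- of_nat j, 1::complex:]" "\<lambda>_. 1"] by simp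
  then show ?thesis unfolding binom_poly_def by (metis degree_smult_le order_trans card_lessThan sum_constant mult.right_neutral of_nat_id)
qed

text \<open>At 0, 1, 2, ... the values of the binomial polynomials form a triangular matrix with
  ones on the diagonal.\<close>

lemma binom_combination_eq_0:
  assumes "(\<Sum>k<K. Polynomial.smult (c k) (binom_poly k)) = 0" "k < K"
  shows "c k = 0"
  using assms(2)
proof (induction k rule: less_induct)
  case (less k)
  have "0 = poly (\<Sum>k<K. Polynomial.smult (c k) (binom_poly k)) (of_nat k)" using assms(1) by simp
  also have "\<dots> = (\<Sum>j<K. c j * of_nat (k choose j))"
    by (simp add: poly_sum poly_binom_poly)
  also have "\<dots> = (\<Sum>j<K. if j = k then c k else 0)"
  proof (rule sum.cong[OF refl])
    fix j assume "j \<in> {..<K}"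
    then show "c j * of_nat (k choose j) = (if j = k then c k else 0)"
      using less by (cases j k rule: linorder_cases) auto
  qed
  finally show ?case using less.prems by simp
qed

text \<open>A vector killed by the transpose is the coefficient vector of a polynomial of degree
  below \<open>n\<close> with \<open>n\<close> distinct zeros.\<close>

lemma vandermonde_det_nonzero:
  fixes x :: "nat \<Rightarrow> complex"
  assumes "inj_on x {..<n}"
  shows "det (mat n n (\<lambda>(i, j). x j ^ i)) \<noteq> 0"
proof
  let ?A = "mat n n (\<lambda>(i, j). x j ^ i)"
  assume "det ?A = 0"
  then have "det (transpose_mat ?A) = 0" using det_transpose[of ?A n] by simp
  then obtain c where c: "c \<in> carrier_vec n" "c \<noteq> 0\<^sub>v n" "transpose_mat ?A *\<^sub>v c = 0\<^sub>v n"
    using det_0_iff_vec_prod_zero_field[of "transpose_mat ?A" n] by auto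
  define p where "p = (\<Sum>i<n. monom (c $ i) i)"
  have root: "poly p (x j) = 0" if j: "j < n" for j
  proof -
    have "(transpose_mat ?A *\<^sub>v c) $ j = (\<Sum>i = 0..<n. x j ^ i * c $ i)"
      using c(1) j by (simp add: scalar_prod_def)
    then show ?thesis using c(3) j
      by (simp add: p_def poly_sum poly_monom atLeast0LessThan mult.commute)
  qed
  have coeff: "coeff p i = c $ i" if "i < n" for i
    using that by (simp add: p_def coeff_sum)
  obtain i where i: "i < n" "c $ i \<noteq> 0"
    using c(1,2) by (metis eq_vecI carrier_vecD index_zero_vec(1) index_zero_vec(2))
  then have p0: "p \<noteq> 0" using coeff by force
  have "degree p < n"
    using i(1) unfolding p_def by (intro degree_lessI) (auto simp: coeff_sum)
  moreover have "card (x ` {..<n}) \<le> card {y. poly p y = 0}"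
    by (rule card_mono) (use p0 root in \<open>auto intro: poly_roots_finite\<close>)
  moreover have "card {y. poly p y = 0} \<le> degree p" by (rule card_poly_roots_bound[OF p0])
  ultimately show False using card_image[OF assms] by simp
qed

text \<open>The translates of the polynomial by \<open>(i, a ^ i)\<close> form a square linear system for the powers of \<open>y\<close>.
  Its determinant is a polynomial in \<open>x\<close> with too many zeros, although its leading coefficient is
  a Vandermonde determinant.\<close>

lemma zero_estimate:
  fixes a A :: complex and p :: "nat \<Rightarrow> nat \<Rightarrow> complex"
  assumes inj: "inj_on (\<lambda>l. a ^ l) {..<L}" and nz: "a \<noteq> 0" "A \<noteq> 0"
    and zero: "\<And>s t. s < S \<Longrightarrow> t < T \<Longrightarrow>
      (\<Sum>k<K. \<Sum>l<L. p k l * of_nat ((s + t * q) choose k) * (a ^ s * A ^ t) ^ l) = 0"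
    and S: "S2 + L \<le> S" "S2 \<le> q" "K * L < S2 * T"
    and kl: "k < K" "l < L"
  shows "p k l = 0"
proof (rule ccontr)
  assume neq: "p k l \<noteq> 0"
  \<comment> \<open>\<open>P l\<close> is the coefficient of the \<open>l\<close>-th power of
    \<open>y\<close>, as a polynomial in \<open>x\<close>. Only the indices with nonzero
    \<open>P l\<close> enter the system; a zero column would make the determinant vanish
    identically.\<close>
  define P where "P l = (\<Sum>k<K. Polynomial.smult (p k l) (binom_poly k))" for l
  define ls where "ls = sorted_list_of_set {l. l < L \<and> P l \<noteq> 0}"
  define n where "n = length ls"
  have ls: "set ls = {l. l < L \<and> P l \<noteq> 0}" "distinct ls"
    unfolding ls_def by auto
  have n_le: "n \<le> L"
    using distinct_card[OF ls(2)] card_mono[of "{..<L}" "set ls"] ls(1) by (auto simp: n_def)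
  have n_pos: "0 < n"
  proof -
    have "P l \<noteq> 0" using binom_combination_eq_0[of "\<lambda>k. p k l" K] neq kl unfolding P_def by blast
    then have "l \<in> set ls" using ls(1) kl by simp
    then show ?thesis unfolding n_def by (auto dest: length_pos_if_in_set)
  qed
  have lsn: "ls ! j < L" "P (ls ! j) \<noteq> 0" if "j < n" for j
    using nth_mem[of j ls] that ls(1) unfolding n_def by auto
  have Pdeg: "degree (P l) \<le> K" for l
    unfolding P_def
    by (rule degree_sum_le) (auto intro: order_trans[OF degree_smult_le] order_trans[OF degree_binom_poly])
  have Peval: "poly (P l) (of_nat x) = (\<Sum>k<K. p k l * of_nat (x choose k))" for l x
    by (simp add: P_def poly_sum poly_binom_poly)
  define D where "D j = degree (P (ls ! j))" for j
  \<comment> \<open>Row \<open>i\<close> is the translate by \<open>(i, a ^ i)\<close>, column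
    \<open>j\<close> the coefficient of \<open>y ^ (ls ! j)\<close>.\<close>
  define M where "M = mat n n (\<lambda>(i, j). Polynomial.smult (a ^ (i * ls ! j)) (pcompose (P (ls ! j)) [:of_nat i, 1:]))"
  have M: "M \<in> carrier_mat n n" by (simp add: M_def)
  have Mij: "M $$ (i, j) = Polynomial.smult (a ^ (i * ls ! j)) (pcompose (P (ls ! j)) [:of_nat i, 1:])"
    if "i < n" "j < n" for i j using that by (simp add: M_def)
  have comp_deg: "degree (pcompose (P (ls ! j)) [:of_nat i, 1:]) = D j" for i j
    by (simp add: D_def)
  have comp_lead: "coeff (pcompose (P (ls ! j)) [:of_nat i, 1:]) (D j) = lead_coeff (P (ls ! j))" for i j
    using lead_coeff_comp[of "[:of_nat i, 1:]" "P (ls ! j)"] by (simp add: D_def)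
  \<comment> \<open>Every product in the Leibniz expansion has degree at most
    \<open>\<Sigma>\<close>. A translation in \<open>x\<close> preserves leading coefficients, so
    the coefficient at \<open>\<Sigma>\<close> is a Vandermonde determinant in the
    \<open>a ^ (ls ! j)\<close> times those leading coefficients.\<close>
  define \<Sigma> where "\<Sigma> = (\<Sum>j = 0..<n. D j)"
  have perm_sum: "(\<Sum>i = 0..<n. D (\<pi> i)) = \<Sigma>" if "\<pi> permutes {0..<n}" for \<pi>
    unfolding \<Sigma>_def using sum.permute[OF that, of D] by (simp add: comp_def)
  have perm_lt: "\<pi> i < n" if "\<pi> permutes {0..<n}" "i < n" for \<pi> i
    using permutes_in_image[OF that(1), of i] that(2) by simp
  have prod_deg: "degree (\<Prod>i = 0..<n. M $$ (i, \<pi> i)) \<le> \<Sigma>"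
    "coeff (\<Prod>i = 0..<n. M $$ (i, \<pi> i)) \<Sigma> = (\<Prod>i = 0..<n. a ^ (i * ls ! \<pi> i) * lead_coeff (P (ls ! \<pi> i)))"
    if \<pi>: "\<pi> permutes {0..<n}" for \<pi>
  proof -
    have "degree (M $$ (i, \<pi> i)) \<le> D (\<pi> i)" if "i \<in> {0..<n}" for i
      using that perm_lt[OF \<pi>] comp_deg degree_smult_le by (simp add: Mij)
    from coeff_prod_degree_le[of "{0..<n}", OF _ this]
    have *: "degree (\<Prod>i = 0..<n. M $$ (i, \<pi> i)) \<le> \<Sigma>"
      "coeff (\<Prod>i = 0..<n. M $$ (i, \<pi> i)) \<Sigma> = (\<Prod>i = 0..<n. coeff (M $$ (i, \<pi> i)) (D (\<pi> i)))"
      using perm_sum[OF \<pi>] by auto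
    show "degree (\<Prod>i = 0..<n. M $$ (i, \<pi> i)) \<le> \<Sigma>" by (rule *(1))
    show "coeff (\<Prod>i = 0..<n. M $$ (i, \<pi> i)) \<Sigma> = (\<Prod>i = 0..<n. a ^ (i * ls ! \<pi> i) * lead_coeff (P (ls ! \<pi> i)))"
      unfolding *(2) by (rule prod.cong) (use perm_lt[OF \<pi>] comp_lead in \<open>auto simp: Mij\<close>)
  qed
  define W where "W = mat n n (\<lambda>(i, j). (a ^ (ls ! j)) ^ i)"
  have sgn: "signof \<pi> = (of_int (sign \<pi>) :: complex poly)" "signof \<pi> = (of_int (sign \<pi>) :: complex)" for \<pi> :: "nat \<Rightarrow> nat"
    by (auto simp: sign_def)
  have term_coeff: "coeff (signof \<pi> * q) m = signof \<pi> * coeff q m" for \<pi> :: "nat \<Rightarrow> nat" and q :: "complex poly" and m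
    by (simp add: sign_def)
  have "coeff (det M) \<Sigma> = (\<Sum>\<pi> | \<pi> permutes {0..<n}. signof \<pi> * (\<Prod>i = 0..<n. a ^ (i * ls ! \<pi> i) * lead_coeff (P (ls ! \<pi> i))))"
    unfolding det_def'[OF M] by (simp add: coeff_sum term_coeff prod_deg)
  also have "\<dots> = (\<Sum>\<pi> | \<pi> permutes {0..<n}. signof \<pi> * (\<Prod>i = 0..<n. W $$ (i, \<pi> i)) * (\<Prod>j = 0..<n. lead_coeff (P (ls ! j))))"
  proof (rule sum.cong[OF refl])
    fix \<pi> assume "\<pi> \<in> {\<pi>. \<pi> permutes {0..<n}}"
    then have \<pi>: "\<pi> permutes {0..<n}" by simp
    have "(\<Prod>i = 0..<n. a ^ (i * ls ! \<pi> i)) = (\<Prod>i = 0..<n. W $$ (i, \<pi> i))"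
      by (rule prod.cong) (use perm_lt[OF \<pi>] in \<open>auto simp: W_def mult.commute simp flip: power_mult\<close>)
    moreover have "(\<Prod>i = 0..<n. lead_coeff (P (ls ! \<pi> i))) = (\<Prod>j = 0..<n. lead_coeff (P (ls ! j)))"
      using prod.permute[OF \<pi>, of "\<lambda>j. lead_coeff (P (ls ! j))"] by (simp add: comp_def)
    ultimately show "signof \<pi> * (\<Prod>i = 0..<n. a ^ (i * ls ! \<pi> i) * lead_coeff (P (ls ! \<pi> i)))
      = signof \<pi> * (\<Prod>i = 0..<n. W $$ (i, \<pi> i)) * (\<Prod>j = 0..<n. lead_coeff (P (ls ! j)))"
      by (simp add: prod.distrib mult.assoc)
  qed
  also have "\<dots> = det W * (\<Prod>j = 0..<n. lead_coeff (P (ls ! j)))"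
    by (subst det_def'[of W n]) (auto simp: W_def sum_distrib_right)
  finally have lead: "coeff (det M) \<Sigma> = det W * (\<Prod>j = 0..<n. lead_coeff (P (ls ! j)))" .
  have "inj_on (\<lambda>j. a ^ (ls ! j)) {..<n}"
    using inj ls(2) lsn unfolding inj_on_def n_def by (metis lessThan_iff nth_eq_iff_index_eq)
  then have "det W \<noteq> 0" unfolding W_def by (rule vandermonde_det_nonzero)
  then have "coeff (det M) \<Sigma> \<noteq> 0" unfolding lead using lsn by simp
  then have detM: "det M \<noteq> 0" by auto
  have "degree (det M) \<le> \<Sigma>"
    unfolding det_def'[OF M]
  proof (rule degree_sum_le)
    show "finite {\<pi>. \<pi> permutes {0..<n}}" by (simp add: finite_permutations)
    fix \<pi> assume "\<pi> \<in> {\<pi>. \<pi> permutes {0..<n}}"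
    then show "degree (signof \<pi> * (\<Prod>i = 0..<n. M $$ (i, \<pi> i))) \<le> \<Sigma>"
      using prod_deg(1)[of \<pi>] by (simp add: sign_def)
  qed
  also have "\<Sigma> \<le> (\<Sum>j = 0..<n. K)" unfolding \<Sigma>_def D_def by (rule sum_mono) (rule Pdeg)
  also have "\<dots> \<le> K * L" using n_le by simp
  finally have degM: "degree (det M) \<le> K * L" .
  have root: "poly (det M) (of_nat (s + t * q)) = 0" if s: "s < S2" and t: "t < T" for s t
  proof -
    let ?x = "of_nat (s + t * q) :: complex"
    define N where "N = map_mat (\<lambda>p. poly p ?x) M"
    have N: "N \<in> carrier_mat n n" using M by (simp add: N_def)
    have "poly (det M) ?x = det N"
      unfolding det_def'[OF M] det_def'[OF N] poly_sum
    proof (rule sum.cong[OF refl])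
      fix \<pi> assume "\<pi> \<in> {\<pi>. \<pi> permutes {0..<n}}"
      then have \<pi>: "\<pi> permutes {0..<n}" by simp
      have "(\<Prod>i = 0..<n. poly (M $$ (i, \<pi> i)) ?x) = (\<Prod>i = 0..<n. N $$ (i, \<pi> i))"
        by (rule prod.cong) (use perm_lt[OF \<pi>] M in \<open>auto simp: N_def\<close>)
      then show "poly (signof \<pi> * (\<Prod>i = 0..<n. M $$ (i, \<pi> i))) ?x = signof \<pi> * (\<Prod>i = 0..<n. N $$ (i, \<pi> i))"
        by (simp add: sign_def poly_prod)
    qed
    also have "det N = 0"
    proof -
      \<comment> \<open>At \<open>x = s + t * q\<close> and this \<open>y\<close>, row
        \<open>i\<close> is the assumption \<open>zero\<close> at \<open>(s + i, t)\<close>, so the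
        vector of powers of \<open>y\<close> lies in the kernel. The index \<open>s + i\<close>
        stays below \<open>S\<close> because \<open>i < n\<close> and
        \<open>n \<le> L\<close>.\<close>
      define y where "y = a ^ s * A ^ t"
      define w where "w = vec n (\<lambda>j. y ^ (ls ! j))"
      have "N *\<^sub>v w = 0\<^sub>v n"
      proof (rule eq_vecI)
        show "dim_vec (N *\<^sub>v w) = dim_vec (0\<^sub>v n)" using N by simp
        fix i assume "i < dim_vec (0\<^sub>v n)"
        then have i: "i < n" by simp
        have x: "?x + of_nat i = of_nat ((s + i) + t * q)" by simp
        have "(N *\<^sub>v w) $ i = (\<Sum>j = 0..<n. N $$ (i, j) * w $ j)"
          using N i by (simp add: scalar_prod_def w_def)
        also have "\<dots> = (\<Sum>j = 0..<n. poly (P (ls ! j)) (of_nat ((s + i) + t * q)) * (a ^ (s + i) * A ^ t) ^ (ls ! j))"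
          by (rule sum.cong) (use i M x in \<open>auto simp: N_def Mij w_def y_def poly_pcompose add_ac
             power_add power_mult_distrib mult_ac simp flip: power_mult\<close>)
        also have "\<dots> = (\<Sum>l\<in>set ls. poly (P l) (of_nat ((s + i) + t * q)) * (a ^ (s + i) * A ^ t) ^ l)"
          using ls(2) by (subst sum_list_distinct_conv_sum_set[symmetric]) (auto simp: sum_list_sum_nth n_def)
        also have "\<dots> = (\<Sum>l<L. poly (P l) (of_nat ((s + i) + t * q)) * (a ^ (s + i) * A ^ t) ^ l)"
          by (rule sum.mono_neutral_left) (auto simp: ls(1))
        also have "\<dots> = (\<Sum>l<L. \<Sum>k<K. p k l * of_nat (((s + i) + t * q) choose k) * (a ^ (s + i) * A ^ t) ^ l)"
          unfolding Peval by (simp add: sum_distrib_right)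
        also have "\<dots> = (\<Sum>k<K. \<Sum>l<L. p k l * of_nat (((s + i) + t * q) choose k) * (a ^ (s + i) * A ^ t) ^ l)"
          by (rule sum.swap)
        also have "\<dots> = 0" by (rule zero) (use s t i n_le S in auto)
        finally show "(N *\<^sub>v w) $ i = 0\<^sub>v n $ i" using i by simp
      qed
      moreover have "w \<noteq> 0\<^sub>v n"
      proof
        assume "w = 0\<^sub>v n"
        then have "w $ 0 = 0\<^sub>v n $ 0" by simp
        then show False using n_pos nz by (simp add: w_def y_def)
      qed
      moreover have "w \<in> carrier_vec n" by (simp add: w_def)
      ultimately show ?thesis using det_0_iff_vec_prod_zero_field[OF N] by blast
    qed
    finally show ?thesis .
  qed
  \<comment> \<open>The points are distinct: as \<open>s < S2 \<le> q\<close>, the pair is recovered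
    by division with remainder by \<open>q\<close>.\<close>
  define X where "X = (\<lambda>(s, t). of_nat (s + t * q) :: complex) ` ({..<S2} \<times> {..<T})"
  have "inj_on (\<lambda>(s, t). of_nat (s + t * q) :: complex) ({..<S2} \<times> {..<T})"
  proof (rule inj_onI)
    fix u v assume u: "u \<in> {..<S2} \<times> {..<T}" and v: "v \<in> {..<S2} \<times> {..<T}"
      and eq: "(\<lambda>(s, t). of_nat (s + t * q) :: complex) u = (\<lambda>(s, t). of_nat (s + t * q)) v"
    obtain s t s' t' where uv: "u = (s, t)" "v = (s', t')" by fastforce
    have "(of_nat (s + t * q) :: complex) = of_nat (s' + t' * q)" using eq unfolding uv by simp
    then have e: "s + t * q = s' + t' * q" by (rule of_nat_eq_iff[THEN iffD1])
    have q: "s < q" "s' < q" using u v S(2) unfolding uv by auto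
    have "s = (s + t * q) mod q" using q by simp
    also have "\<dots> = s'" using q unfolding e by simp
    finally show "u = v" using e q unfolding uv by auto
  qed
  then have "card X = S2 * T" unfolding X_def by (subst card_image) auto
  moreover have "card X \<le> card {x. poly (det M) x = 0}"
    by (rule card_mono) (use detM root in \<open>auto simp: X_def intro: poly_roots_finite simp del: of_nat_add of_nat_mult\<close>)
  moreover have "\<dots> \<le> degree (det M)" by (rule card_poly_roots_bound[OF detM])
  ultimately show False using degM S(3) by simp
qed

section \<open>Linear forms in two logarithms\<close>

text \<open>Siegel's lemma in real form. The vectors with entries in \<open>0..H\<close> outnumber
  the boxes for the values of the \<open>J\<close> forms; the difference of two vectors in one box
  is the solution.\<close>

lemma pigeonhole_linear_forms:
  fixes \<phi> :: "nat \<Rightarrow> 'j \<Rightarrow> real"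
  assumes fin: "finite I" and bound: "\<And>i j. i < J \<Longrightarrow> j \<in> I \<Longrightarrow> \<bar>\<phi> i j\<bar> \<le> B"
    and B: "0 < B" and H: "0 < H" and Q: "0 < Q" and big: "(Q + 1) ^ J < (H + 1) ^ card I"
  shows "\<exists>p :: 'j \<Rightarrow> int. (\<exists>j\<in>I. p j \<noteq> 0) \<and> (\<forall>j\<in>I. \<bar>p j\<bar> \<le> int H) \<and>
    (\<forall>i<J. \<bar>\<Sum>j\<in>I. \<phi> i j * of_int (p j)\<bar> \<le> 2 * real (card I) * B * real H / real Q)"
proof -
  define W where "W = real (card I) * B * real H"
  have I: "card I \<noteq> 0"
  proof
    assume "card I = 0"
    then have "(Q + 1) ^ J < 1" using big by simp
    then show False by simp
  qed
  then have W: "0 < W" using B H by (simp add: W_def)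
  define f where "f x i = (\<Sum>j\<in>I. \<phi> i j * real (x j))" for x :: "'j \<Rightarrow> nat" and i
  define X where "X = PiE I (\<lambda>_. {..H})"
  have fb: "\<bar>f x i\<bar> \<le> W" if "x \<in> X" "i < J" for x i
  proof -
    have "\<bar>f x i\<bar> \<le> (\<Sum>j\<in>I. \<bar>\<phi> i j * real (x j)\<bar>)" unfolding f_def by (rule sum_abs)
    also have "\<dots> \<le> (\<Sum>j\<in>I. B * real H)"
    proof (rule sum_mono)
      fix j assume j: "j \<in> I"
      then have "x j \<le> H" using that unfolding X_def by auto
      then show "\<bar>\<phi> i j * real (x j)\<bar> \<le> B * real H"
        using bound[OF that(2) j] B by (auto simp: abs_mult intro!: mult_mono)
    qed
    finally show ?thesis by (simp add: W_def)
  qed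
  \<comment> \<open>A form has \<open>Q + 1\<close> boxes and not \<open>Q\<close>, because the
    extreme value \<open>W\<close> falls into box number \<open>Q\<close>.\<close>
  define g where "g x = restrict (\<lambda>i. nat \<lfloor>(f x i + W) * real Q / (2 * W)\<rfloor>) {..<J}" for x
  have gb: "g x \<in> PiE {..<J} (\<lambda>_. {..Q})" if x: "x \<in> X" for x
  proof (rule PiE_I)
    fix i assume i: "i \<in> {..<J}"
    have "(f x i + W) * real Q / (2 * W) \<le> (2 * W) * real Q / (2 * W)"
      using fb[OF x, of i] i W by (intro divide_right_mono mult_right_mono) auto
    then have "(f x i + W) * real Q / (2 * W) \<le> real Q" using W by simp
    then have "\<lfloor>(f x i + W) * real Q / (2 * W)\<rfloor> \<le> int Q" by linarith
    then show "g x i \<in> {..Q}" using i by (simp add: g_def)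
  qed (simp add: g_def)
  have "card (PiE {..<J} (\<lambda>_. {..Q})) < card X"
    using big fin by (simp add: X_def card_PiE)
  moreover have "finite (PiE {..<J} (\<lambda>_. {..Q}))" by (simp add: finite_PiE)
  ultimately have "\<not> inj_on g X"
    using card_inj_on_le[of g X "PiE {..<J} (\<lambda>_. {..Q})"] gb by fastforce
  then obtain x y where xy: "x \<in> X" "y \<in> X" "x \<noteq> y" "g x = g y"
    unfolding inj_on_def by blast
  define p where "p j = int (x j) - int (y j)" for j
  show ?thesis
  proof (intro exI[of _ p] conjI ballI allI impI)
    show "\<exists>j\<in>I. p j \<noteq> 0"
    proof (rule ccontr)
      assume "\<not> ?thesis"
      then have "x j = y j" if "j \<in> I" for j using that by (auto simp: p_def)
      then have "x = y" using xy(1,2) unfolding X_def by (intro PiE_ext) auto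
      then show False using xy(3) by simp
    qed
    show "\<bar>p j\<bar> \<le> int H" if "j \<in> I" for j
    proof -
      have "x j \<le> H" "y j \<le> H" using that xy(1,2) unfolding X_def by auto
      then show ?thesis by (simp add: p_def)
    qed
    fix i assume i: "i < J"
    have ge: "0 \<le> (f z i + W) * real Q / (2 * W)" if "z \<in> X" for z
      using fb[OF that i] W by (intro divide_nonneg_pos mult_nonneg_nonneg) auto
    have "nat \<lfloor>(f x i + W) * real Q / (2 * W)\<rfloor> = nat \<lfloor>(f y i + W) * real Q / (2 * W)\<rfloor>"
      using fun_cong[OF xy(4), of i] i by (simp add: g_def)
    then have "\<lfloor>(f x i + W) * real Q / (2 * W)\<rfloor> = \<lfloor>(f y i + W) * real Q / (2 * W)\<rfloor>"
      using ge[OF xy(1)] ge[OF xy(2)] by (simp add: nat_eq_iff2)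
    then have "\<bar>(f x i + W) * real Q / (2 * W) - (f y i + W) * real Q / (2 * W)\<bar> \<le> 1"
      by linarith
    also have "(f x i + W) * real Q / (2 * W) - (f y i + W) * real Q / (2 * W)
        = (f x i - f y i) * (real Q / (2 * W))"
      by (simp add: algebra_simps flip: diff_divide_distrib)
    finally have "\<bar>f x i - f y i\<bar> * (real Q / (2 * W)) \<le> 1"
      using W by (simp add: abs_mult)
    then have "\<bar>f x i - f y i\<bar> \<le> 2 * W / real Q" using W Q by (simp add: field_simps)
    moreover have "(\<Sum>j\<in>I. \<phi> i j * of_int (p j)) = f x i - f y i"
      by (simp add: f_def p_def algebra_simps sum_subtractf)
    ultimately show "\<bar>\<Sum>j\<in>I. \<phi> i j * of_int (p j)\<bar> \<le> 2 * real (card I) * B * real H / real Q"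
      by (simp add: W_def mult_ac)
  qed
qed

text \<open>For \<open>y\<close> close to 1 the coefficients of this expansion decay geometrically in \<open>i\<close>.\<close>

lemma newton_expansion:
  fixes y :: "'a :: comm_ring_1"
  assumes "x \<le> R"
  shows "of_nat (x choose k) * y ^ x =
    (\<Sum>i\<le>R. of_nat (x choose i) * (of_nat (i choose k) * (y - 1) ^ (i - k) * y ^ k))"
proof (cases "k \<le> x")
  case False
  have "of_nat (x choose i) * (of_nat (i choose k) * (y - 1) ^ (i - k) * y ^ k) = (0::'a)" for i
    using False by (cases "x < i") (auto simp: binomial_eq_0)
  then show ?thesis using False by (simp add: binomial_eq_0)
next
  case True
  have "y ^ (x - k) = ((y - 1) + 1) ^ (x - k)" by simp
  also have "\<dots> = (\<Sum>j\<le>x - k. of_nat ((x - k) choose j) * (y - 1) ^ j)"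
    by (subst binomial_ring) simp
  finally have "of_nat (x choose k) * y ^ x
      = of_nat (x choose k) * y ^ k * (\<Sum>j\<le>x - k. of_nat ((x - k) choose j) * (y - 1) ^ j)"
    using True by (metis (no_types) le_add_diff_inverse mult.assoc power_add)
  also have "\<dots> = (\<Sum>j\<le>x - k. of_nat ((x choose k) * ((x - k) choose j)) * (y - 1) ^ j * y ^ k)"
    by (simp add: sum_distrib_left mult_ac)
  \<comment> \<open>Substitute \<open>i = k + j\<close>: choosing \<open>k + j\<close> out of
    \<open>x\<close> and then \<open>k\<close> of these amounts to choosing \<open>k\<close> and
    then \<open>j\<close> of the rest.\<close>
  also have "\<dots> = (\<Sum>i\<in>{k..x}. of_nat (x choose i) * (of_nat (i choose k) * (y - 1) ^ (i - k) * y ^ k))"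
  proof (rule sum.reindex_bij_witness[of _ "\<lambda>i. i - k" "\<lambda>j. k + j"])
    fix j assume j: "j \<in> {..x - k}"
    have "(x choose (k + j)) * ((k + j) choose k) = (x choose k) * ((x - k) choose j)"
      using choose_mult[of k "k + j" x] j True by simp
    then show "of_nat (x choose (k + j)) * (of_nat ((k + j) choose k) * (y - 1) ^ (k + j - k) * y ^ k)
      = of_nat ((x choose k) * ((x - k) choose j)) * (y - 1) ^ j * y ^ k"
      by (simp add: mult_ac flip: of_nat_mult)
  qed (use True in auto)
  also have "\<dots> = (\<Sum>i\<le>R. of_nat (x choose i) * (of_nat (i choose k) * (y - 1) ^ (i - k) * y ^ k))"
    by (rule sum.mono_neutral_left) (use assms in \<open>auto simp: not_le binomial_eq_0\<close>)
  finally show ?thesis .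
qed

section \<open>Elementary estimates for exponentials and powers\<close>

lemma power_over_fact_le_exp:
  assumes "0 \<le> (z::real)"
  shows "z ^ i / fact i \<le> exp z"
proof -
  have "z ^ i / fact i = (\<Sum>j\<in>{i}. inverse (fact j) * z ^ j)" by (simp add: divide_inverse mult.commute)
  also have "\<dots> \<le> (\<Sum>j. inverse (fact j) * z ^ j)"
    by (rule sum_le_suminf) (use assms summable_exp[of z] in auto)
  finally show ?thesis by (simp add: exp_def scaleR_conv_of_real divide_inverse mult.commute)
qed

text \<open>For \<open>i \<ge> J\<close> the factor \<open>exp (- J) * 3 ^ i\<close> is at least
  \<open>exp (i - J) \<ge> 1\<close> and may be inserted; it turns \<open>z ^ i\<close> into
  \<open>(3 * z) ^ i\<close>.\<close>

lemma exp_tail_le: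
  assumes "0 \<le> (z::real)"
  shows "(\<Sum>i\<in>{J..<R}. z ^ i / fact i) \<le> exp (- real J) * exp (3 * z)"
proof -
  have "z ^ i / fact i \<le> exp (- real J) * ((3 * z) ^ i / fact i)" if "J \<le> i" for i
  proof -
    have "1 = exp (- real J) * exp (real J)" by (simp flip: exp_add)
    also have "\<dots> \<le> exp (- real J) * exp (real i)" using that by simp
    also have "\<dots> = exp (- real J) * exp 1 ^ i" by (simp flip: exp_of_nat_mult)
    also have "\<dots> \<le> exp (- real J) * 3 ^ i"
      by (intro mult_left_mono power_mono) (use exp_le in auto)
    finally have "z ^ i * 1 \<le> z ^ i * (exp (- real J) * 3 ^ i)"
      by (rule mult_left_mono) (use assms in simp)
    then show ?thesis by (simp add: field_simps power_mult_distrib)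
  qed
  then have "(\<Sum>i\<in>{J..<R}. z ^ i / fact i) \<le> (\<Sum>i\<in>{J..<R}. exp (- real J) * ((3 * z) ^ i / fact i))"
    by (intro sum_mono) auto
  also have "\<dots> = exp (- real J) * (\<Sum>i\<in>{J..<R}. inverse (fact i) * (3 * z) ^ i)"
    by (simp add: sum_distrib_left divide_inverse mult_ac)
  also have "\<dots> \<le> exp (- real J) * (\<Sum>i. inverse (fact i) * (3 * z) ^ i)"
    by (intro mult_left_mono sum_le_suminf) (use assms summable_exp[of "3 * z"] in auto)
  finally show ?thesis by (simp add: exp_def scaleR_conv_of_real divide_inverse mult.commute)
qed

lemma choose_le_power_over_fact: "real (n choose k) \<le> real n ^ k / fact k"
proof (cases "k \<le> n")
  case True
  have "fact k * (n choose k) \<le> n ^ k"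
  proof -
    have "fact n = (fact k * (n choose k)) * fact (n - k)"
      using binomial_fact_lemma[OF True] by (simp add: mult_ac)
    then have "fact n div fact (n - k) = fact k * (n choose k)" by simp
    then show ?thesis using fact_div_fact_le_pow[OF True] by simp
  qed
  then have "real (fact k * (n choose k)) \<le> real (n ^ k)" by (rule of_nat_mono)
  then show ?thesis by (simp add: field_simps)
qed (simp add: binomial_eq_0)

text \<open>The induction carries the constant \<open>2 ^ n - 1\<close>, which reproduces itself as
  \<open>2 * (2 ^ n - 1) + 1 = 2 ^ (n + 1) - 1\<close>.\<close>

lemma norm_power_diff_le:
  fixes x y :: complex
  assumes "norm (x - y) \<le> \<epsilon> * norm y" "0 \<le> \<epsilon>" "\<epsilon> \<le> 1"
  shows "norm (x ^ n - y ^ n) \<le> 2 ^ n * \<epsilon> * norm y ^ n"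
proof -
  have x: "norm x \<le> 2 * norm y"
  proof -
    have "norm x \<le> norm (x - y) + norm y" by (metis diff_add_cancel norm_triangle_ineq)
    also have "\<dots> \<le> 1 * norm y + norm y"
      using assms(1) mult_right_mono[OF assms(3), of "norm y"] by simp
    finally show ?thesis by simp
  qed
  have "norm (x ^ n - y ^ n) \<le> (2 ^ n - 1) * \<epsilon> * norm y ^ n"
  proof (induction n)
    case (Suc n)
    have "x ^ Suc n - y ^ Suc n = x * (x ^ n - y ^ n) + (x - y) * y ^ n" by (simp add: algebra_simps)
    then have "norm (x ^ Suc n - y ^ Suc n) \<le> norm x * norm (x ^ n - y ^ n) + norm (x - y) * norm y ^ n"
      by (metis norm_mult norm_power norm_triangle_ineq)
    also have "\<dots> \<le> (2 * norm y) * ((2 ^ n - 1) * \<epsilon> * norm y ^ n) + (\<epsilon> * norm y) * norm y ^ n"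
      by (intro add_mono mult_mono x Suc.IH assms(1)) (use assms(2) in auto)
    also have "\<dots> = (2 ^ Suc n - 1) * \<epsilon> * norm y ^ Suc n" by (simp add: algebra_simps)
    finally show ?case .
  qed simp
  also have "\<dots> \<le> 2 ^ n * \<epsilon> * norm y ^ n"
    by (intro mult_right_mono) (use assms in auto)
  finally show ?thesis .
qed

lemma abs_exp_minus_1_le:
  fixes x :: real
  assumes "\<bar>x\<bar> \<le> 1 / 2"
  shows "\<bar>exp x - 1\<bar> \<le> 2 * \<bar>x\<bar>"
proof -
  have "exp x \<le> 1 + 2 * \<bar>x\<bar>" using exp_bound_lemma[of x] assms by simp
  moreover have "1 + x \<le> exp x" by (rule exp_ge_add_one_self)
  ultimately show ?thesis by linarith
qed

text \<open>Gelfond's method with the parameters left open: \<open>K\<close> and \<open>L\<close>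
  count the powers of \<open>x\<close> and of \<open>a ^ x\<close> in the auxiliary polynomial,
  \<open>S\<close> and \<open>T\<close> the values of \<open>s\<close> and \<open>t\<close> in the
  points \<open>s + t * q\<close>. \<open>V\<close> bounds the logarithm of every size that occurs,
  \<open>\<tau>\<close> the distance of \<open>a ^ l\<close> from 1. Assumption \<open>big\<close>
  balances the pigeonhole count: with \<open>z = (d + 1) * V\<close>, of the order of
  \<open>z\<close> conditions, each costing of the order of \<open>z\<close> in logarithmic scale,
  against \<open>K * L\<close> unknowns with logarithm up to \<open>V\<close>.\<close>

lemma two_logs_core:
  fixes a \<tau> g h V \<Omega> :: real and A a1 a2 A1 A2 :: complex and d K L S S2 T q :: nat
  assumes v: "i0 < d" "v i0 \<noteq> 0"
    and a: "0 < a" "a \<noteq> 1" "of_real a = a1 / a2" "a2 \<noteq> 0"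
    and A: "A = A1 / A2" "A1 \<noteq> 0" "A2 \<noteq> 0"
    and ha: "hgt d v (exp g) a1" "hgt d v (exp g) a2" "0 \<le> g"
    and hA: "hgt d v (exp h) A1" "hgt d v (exp h) A2" "0 \<le> h"
    and approx: "norm (A - of_real (a ^ q)) \<le> exp (- \<Omega>) * a ^ q"
    and \<tau>: "0 < \<tau>" "\<tau> \<le> 1 / 2" "real L * \<bar>ln a\<bar> \<le> \<tau> / 2"
    and KL: "0 < K" "0 < L"
    and V: "ln (real (K * L)) + real K * ln (2 / \<tau>) + 6 * \<tau> * real (S + T * q)
      + g * real L * real S + h * real L * real T + real L * real T \<le> V" "1 \<le> V"
    and big: "42 * (real d + 1)\<^sup>2 * V \<le> real (K * L)"
    and \<Omega>: "4 * (real d + 1) * V \<le> \<Omega>"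
    and S: "S2 + L \<le> S" "S2 \<le> q" "K * L < S2 * T"
  shows False
proof -
  define M where "M = K * L"
  define I where "I = {..<K} \<times> {..<L}"
  define R where "R = S + T * q"
  define C where "C = (2 / \<tau>) ^ K"
  \<comment> \<open>\<open>E\<close> majorises all later estimates factor by factor: the number of
    terms, the Newton coefficients and binomials (\<open>C\<close> and
    \<open>exp (6 * \<tau> * R)\<close>), the heights of the algebraic factors, and the factor
    \<open>2 ^ (l * t)\<close> lost on passing from \<open>a ^ q\<close> to
    \<open>A\<close>.\<close>
  define E where "E = real M * C * exp (6 * \<tau> * real R) * exp (g * real L * real S + h * real L * real T) * exp (real L * real T)"
  have I: "finite I" "card I = M" by (auto simp: I_def M_def)
  have M1: "1 \<le> real M" using KL by (simp add: M_def Suc_le_eq flip: of_nat_mult)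
  have C_exp: "C = exp (real K * ln (2 / \<tau>))" using \<tau> by (simp add: C_def exp_of_nat_mult)
  have C1: "1 \<le> C" unfolding C_def using \<tau> by (intro one_le_power) (simp add: field_simps)
  have E: "E \<le> exp V"
  proof -
    have "E = exp (ln (real M) + real K * ln (2 / \<tau>) + 6 * \<tau> * real R
      + (g * real L * real S + h * real L * real T) + real L * real T)"
      using M1 by (simp add: E_def C_exp exp_add)
    then show ?thesis using V(1) by (simp add: M_def R_def)
  qed
  \<comment> \<open>The factor \<open>d + 1\<close> pays for Liouville's inequality, which will cost
    \<open>exp (2 * V) ^ d\<close>.\<close>
  define z where "z = (real d + 1) * V"
  have z: "V \<le> z" "1 \<le> z"
  proof -
    show "V \<le> z" using mult_right_mono[of 1 "real d + 1" V] V(2) by (simp add: z_def)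
    then show "1 \<le> z" using V(2) by simp
  qed
  define H where "H = nat \<lfloor>exp V\<rfloor>"
  have H: "1 \<le> H" "real H \<le> exp V" "exp V < real H + 1"
  proof -
    have "1 \<le> exp V" using V(2) by simp
    then show "1 \<le> H" "real H \<le> exp V" "exp V < real H + 1" unfolding H_def by linarith+
  qed
  have EH: "E * real H \<le> exp (2 * V)"
  proof -
    have "E * real H \<le> exp V * exp V" by (rule mult_mono[OF E H(2)]) auto
    then show ?thesis by (simp flip: exp_add)
  qed
  \<comment> \<open>From index \<open>J\<close> on, the Newton tail gains a factor
    \<open>exp (- 2 * z - 2)\<close> by itself. Only the first \<open>J\<close> coefficients have to
    be made small through the choice of \<open>p\<close>, and \<open>Q\<close> is taken so that they
    reach the same precision.\<close>
  define J where "J = nat \<lceil>2 * z + 2\<rceil>"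
  have J: "2 * z + 2 \<le> real J" "real J \<le> 5 * z + 1" unfolding J_def using z by linarith+
  have J6: "real J \<le> 6 * z" using J z by simp
  define Q where "Q = nat \<lceil>2 * real J * exp (2 * z + 2)\<rceil>"
  have Q: "2 * real J * exp (2 * z + 2) \<le> real Q" unfolding Q_def by linarith
  have J1: "1 \<le> real J" using J z by simp
  have Q0: "0 < Q"
  proof -
    have "0 < 2 * real J * exp (2 * z + 2)" using J1 by simp
    then show ?thesis using Q by linarith
  qed
  have Q1: "real Q + 1 \<le> exp (7 * z)"
  proof -
    have "0 \<le> 2 * real J * exp (2 * z + 2)" by simp
    then have "real Q + 1 \<le> 2 * real J * exp (2 * z + 2) + 2" unfolding Q_def by linarith
    also have "\<dots> \<le> 2 * (6 * z) * exp (2 * z + 2) + 2 * (z * exp (2 * z + 2))"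
    proof (intro add_mono mult_mono)
      show "2 \<le> 2 * (z * exp (2 * z + 2))" using mult_mono[of 1 z 1 "exp (2 * z + 2)"] z by simp
    qed (use J6 z in auto)
    also have "\<dots> = 14 * z * exp (2 * z + 2)" by simp
    also have "\<dots> \<le> exp 3 * exp (z - 1) * exp (2 * z + 2)"
    proof (intro mult_right_mono mult_mono)
      have "(5 / 2 :: real) \<le> exp 1" using exp_lower_Taylor_quadratic[of 1] by simp
      then have "(5 / 2 :: real) ^ 3 \<le> exp 1 ^ 3" by (intro power_mono) auto
      moreover have "exp (3::real) = exp 1 ^ 3" using exp_of_nat_mult[of 3 "1::real"] by simp
      ultimately show "14 \<le> exp (3::real)" by (simp add: power3_eq_cube)
      show "z \<le> exp (z - 1)" using exp_ge_add_one_self[of "z - 1"] by simp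
    qed (use z in auto)
    also have "\<dots> = exp (3 * z + 4)" by (simp add: algebra_simps flip: exp_add)
    also have "\<dots> \<le> exp (7 * z)" using z by simp
    finally show ?thesis .
  qed
  have pigeon: "(Q + 1) ^ J < (H + 1) ^ card I"
  proof -
    have "real ((Q + 1) ^ J) = (real Q + 1) ^ J" by (simp add: add.commute)
    also have "\<dots> \<le> exp (7 * z) ^ J" by (rule power_mono[OF Q1]) simp
    also have "\<dots> = exp (real J * (7 * z))" by (rule exp_of_nat_mult[symmetric])
    \<comment> \<open>Here the constant \<open>42 = 6 * 7\<close> of \<open>big\<close> arises:
      \<open>J \<le> 6 * z\<close> forms, each with \<open>Q + 1 \<le> exp (7 * z)\<close>
      boxes.\<close>
    also have "\<dots> \<le> exp (real M * V)"
    proof -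
      have "real J * (7 * z) \<le> 6 * z * (7 * z)" by (intro mult_right_mono J6) (use z in auto)
      also have "\<dots> = (42 * (real d + 1)\<^sup>2 * V) * V" by (simp add: z_def power2_eq_square)
      also have "\<dots> \<le> real M * V" using big V(2) unfolding M_def by (intro mult_right_mono) auto
      finally show ?thesis by simp
    qed
    also have "\<dots> = exp V ^ M" by (rule exp_of_nat_mult)
    also have "\<dots> < (real H + 1) ^ M"
      by (rule power_strict_mono[OF H(3)]) (use M1 in auto)
    also have "\<dots> = real ((H + 1) ^ card I)" using I by (simp add: add.commute)
    finally show ?thesis by (simp only: of_nat_less_iff)
  qed
  \<comment> \<open>\<open>c i (k, l)\<close> is the \<open>i\<close>-th Newton coefficient of
    \<open>x \<mapsto> (x choose k) * a ^ (l * x)\<close>. In \<open>\<phi>\<close> it is scaled by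
    \<open>R choose i\<close>, the maximum of \<open>x choose i\<close> on the range, so that one
    small form serves all \<open>x \<le> R\<close> at once.\<close>
  define c where "c i j = (case j of (k, l) \<Rightarrow> real (i choose k) * (a ^ l - 1) ^ (i - k) * (a ^ l) ^ k)" for i j
  define \<phi> where "\<phi> i j = real (R choose i) * c i j" for i and j :: "nat \<times> nat"
  have al: "\<bar>a ^ l - 1\<bar> \<le> \<tau>" "a ^ l \<le> 2" "0 < a ^ l" if "l < L" for l
  proof -
    have e: "a ^ l = exp (real l * ln a)" using a(1) by (simp add: exp_of_nat_mult)
    have "\<bar>real l * ln a\<bar> \<le> real L * \<bar>ln a\<bar>" using that by (simp add: abs_mult mult_right_mono)
    then have b: "\<bar>real l * ln a\<bar> \<le> \<tau> / 2" using \<tau>(3) by simp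
    then have "\<bar>a ^ l - 1\<bar> \<le> 2 * \<bar>real l * ln a\<bar>"
      unfolding e by (intro abs_exp_minus_1_le) (use \<tau> in auto)
    then show "\<bar>a ^ l - 1\<bar> \<le> \<tau>" using b by simp
    then show "a ^ l \<le> 2" using \<tau>(2) by linarith
    show "0 < a ^ l" using a(1) by simp
  qed
  have \<phi>_le: "\<bar>\<phi> i j\<bar> \<le> C * ((2 * \<tau> * real R) ^ i / fact i)" if j: "j \<in> I" for i j
  proof -
    obtain k l where kl: "j = (k, l)" "k < K" "l < L" using j unfolding I_def by auto
    have "\<bar>c i j\<bar> \<le> C * (2 * \<tau>) ^ i"
    proof (cases "k \<le> i")
      case False
      then show ?thesis using C1 \<tau> by (simp add: c_def kl binomial_eq_0)
    next
      case True
      have "\<bar>c i j\<bar> = real (i choose k) * \<bar>a ^ l - 1\<bar> ^ (i - k) * (a ^ l) ^ k"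
        using a(1) by (simp add: c_def kl abs_mult power_abs)
      also have "\<dots> \<le> 2 ^ i * \<tau> ^ (i - k) * 2 ^ k"
      proof (intro mult_mono power_mono)
        have "i choose k \<le> 2 ^ i" by (rule binomial_le_pow2)
        then show "real (i choose k) \<le> 2 ^ i" by (metis of_nat_le_iff of_nat_numeral of_nat_power)
      qed (use al[OF kl(3)] \<tau> in auto)
      \<comment> \<open>Only \<open>\<tau> ^ (i - k)\<close> is available; completing it to
        \<open>\<tau> ^ i\<close> is what \<open>C = (2 / \<tau>) ^ K\<close> pays for.\<close>
      also have "\<dots> = (2 / \<tau>) ^ k * (2 * \<tau>) ^ i"
        using True \<tau> by (simp add: power_diff power_mult_distrib power_divide)
      also have "\<dots> \<le> C * (2 * \<tau>) ^ i"
        unfolding C_def by (intro mult_right_mono power_increasing) (use kl \<tau> in \<open>auto simp: field_simps\<close>)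
      finally show ?thesis .
    qed
    then have "\<bar>\<phi> i j\<bar> \<le> (real R ^ i / fact i) * (C * (2 * \<tau>) ^ i)"
      unfolding \<phi>_def abs_mult by (intro mult_mono) (use choose_le_power_over_fact in auto)
    then show ?thesis by (simp add: power_mult_distrib mult_ac)
  qed
  have zR: "0 \<le> 2 * \<tau> * real R" using \<tau> by simp
  define B where "B = C * exp (2 * \<tau> * real R)"
  have \<phi>_B: "\<bar>\<phi> i j\<bar> \<le> B" if "i < J" "j \<in> I" for i j
  proof -
    have "C * ((2 * \<tau> * real R) ^ i / fact i) \<le> B"
      unfolding B_def by (intro mult_left_mono power_over_fact_le_exp zR) (use C1 in auto)
    then show ?thesis using \<phi>_le[OF that(2), of i] by linarith
  qed
  have B0: "0 < B" using C1 by (simp add: B_def)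
  have "\<exists>p :: nat \<times> nat \<Rightarrow> int. (\<exists>j\<in>I. p j \<noteq> 0) \<and> (\<forall>j\<in>I. \<bar>p j\<bar> \<le> int H) \<and>
      (\<forall>i<J. \<bar>\<Sum>j\<in>I. \<phi> i j * of_int (p j)\<bar> \<le> 2 * real (card I) * B * real H / real Q)"
    by (rule pigeonhole_linear_forms) (use I(1) \<phi>_B B0 H(1) Q0 pigeon in simp_all)
  then obtain p :: "nat \<times> nat \<Rightarrow> int" where p: "\<exists>j\<in>I. p j \<noteq> 0" "\<And>j. j \<in> I \<Longrightarrow> \<bar>p j\<bar> \<le> int H"
    "\<And>i. i < J \<Longrightarrow> \<bar>\<Sum>j\<in>I. \<phi> i j * of_int (p j)\<bar> \<le> 2 * real M * B * real H / real Q"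
    unfolding I(2) by blast
  have pH: "\<bar>real_of_int (p j)\<bar> \<le> real H" if "j \<in> I" for j
    using p(2)[OF that] by (metis of_int_abs of_int_le_iff of_int_of_nat_eq)
  have xR: "s + t * q \<le> R" if "s < S" "t < T" for s t
    unfolding R_def by (intro add_mono mult_right_mono) (use that in auto)
  have bin: "real (x choose k) \<le> C * exp (\<tau> * real R)" if "x \<le> R" "k < K" for x k
  proof -
    have "x choose k \<le> R choose k" using that(1) by (rule binomial_right_mono)
    then have "real (x choose k) \<le> real (R choose k)" by simp
    also have "\<dots> \<le> real R ^ k / fact k" by (rule choose_le_power_over_fact)
    also have "\<dots> = (1 / \<tau>) ^ k * ((\<tau> * real R) ^ k / fact k)"
      using \<tau> by (simp add: power_mult_distrib power_divide)
    also have "\<dots> \<le> C * exp (\<tau> * real R)"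
    proof (intro mult_mono power_over_fact_le_exp)
      have "(1 / \<tau>) ^ k \<le> (2 / \<tau>) ^ k" by (intro power_mono divide_right_mono) (use \<tau> in auto)
      also have "\<dots> \<le> C" unfolding C_def by (rule power_increasing) (use that \<tau> in \<open>auto simp: field_simps\<close>)
      finally show "(1 / \<tau>) ^ k \<le> C" .
    qed (use \<tau> C1 in auto)
    finally show ?thesis .
  qed
  define f where "f x = (\<Sum>(k, l)\<in>I. of_int (p (k, l)) * real (x choose k) * a ^ (l * x))" for x
  have f_small: "\<bar>f x\<bar> \<le> 2 * exp (- 2 * z - 2) * exp (2 * V)" if x: "x \<le> R" for x
  proof -
    have "f x = (\<Sum>j\<in>I. \<Sum>i\<le>R. real (x choose i) * (c i j * of_int (p j)))"
      unfolding f_def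
    proof (rule sum.cong[OF refl], clarify)
      fix k l assume "(k, l) \<in> I"
      have "real (x choose k) * (a ^ l) ^ x = (\<Sum>i\<le>R. real (x choose i) * c i (k, l))"
        using newton_expansion[OF x, of k "a ^ l"] by (simp add: c_def)
      then have "of_int (p (k, l)) * (real (x choose k) * (a ^ l) ^ x)
          = of_int (p (k, l)) * (\<Sum>i\<le>R. real (x choose i) * c i (k, l))" by simp
      also have "\<dots> = (\<Sum>i\<le>R. real (x choose i) * (c i (k, l) * of_int (p (k, l))))"
        unfolding sum_distrib_left by (rule sum.cong) simp_all
      finally show "of_int (p (k, l)) * real (x choose k) * a ^ (l * x)
          = (\<Sum>i\<le>R. real (x choose i) * (c i (k, l) * of_int (p (k, l))))"
        by (simp only: power_mult mult.assoc)
    qed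
    also have "\<dots> = (\<Sum>i\<le>R. real (x choose i) * (\<Sum>j\<in>I. c i j * of_int (p j)))"
      by (subst sum.swap) (simp add: sum_distrib_left)
    finally have "\<bar>f x\<bar> \<le> (\<Sum>i\<le>R. \<bar>real (x choose i) * (\<Sum>j\<in>I. c i j * of_int (p j))\<bar>)" by simp
    also have "\<dots> \<le> (\<Sum>i\<le>R. \<bar>\<Sum>j\<in>I. \<phi> i j * of_int (p j)\<bar>)"
    proof (rule sum_mono)
      fix i
      have "x choose i \<le> R choose i" using x by (rule binomial_right_mono)
      then have "\<bar>real (x choose i) * (\<Sum>j\<in>I. c i j * of_int (p j))\<bar> \<le> real (R choose i) * \<bar>\<Sum>j\<in>I. c i j * of_int (p j)\<bar>"
        unfolding abs_mult by (intro mult_right_mono) auto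
      also have "\<dots> = \<bar>\<Sum>j\<in>I. \<phi> i j * of_int (p j)\<bar>"
        by (simp add: \<phi>_def mult.assoc abs_mult flip: sum_distrib_left)
      finally show "\<bar>real (x choose i) * (\<Sum>j\<in>I. c i j * of_int (p j))\<bar> \<le> \<bar>\<Sum>j\<in>I. \<phi> i j * of_int (p j)\<bar>" .
    qed
    \<comment> \<open>Split at \<open>J\<close>: below it the pigeonhole principle applies, above it
      the decay of the coefficients. This is an inequality because \<open>J\<close> may exceed
      \<open>R\<close>.\<close>
    also have "\<dots> \<le> (\<Sum>i\<in>{..<J} \<union> {J..<Suc R}. \<bar>\<Sum>j\<in>I. \<phi> i j * of_int (p j)\<bar>)"
      by (rule sum_mono2) auto
    also have "\<dots> = (\<Sum>i<J. \<bar>\<Sum>j\<in>I. \<phi> i j * of_int (p j)\<bar>) + (\<Sum>i\<in>{J..<Suc R}. \<bar>\<Sum>j\<in>I. \<phi> i j * of_int (p j)\<bar>)"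
      by (rule sum.union_disjoint) auto
    also have "\<dots> \<le> exp (- 2 * z - 2) * exp (2 * V) + exp (- 2 * z - 2) * exp (2 * V)"
    proof (rule add_mono)
      have "(\<Sum>i<J. \<bar>\<Sum>j\<in>I. \<phi> i j * of_int (p j)\<bar>) \<le> (\<Sum>i<J. 2 * real M * B * real H / real Q)"
        by (rule sum_mono) (use p(3) in auto)
      also have "\<dots> = (2 * real J / real Q) * (real M * B * real H)" by simp
      also have "\<dots> \<le> exp (- 2 * z - 2) * exp (2 * V)"
      proof (rule mult_mono)
        have "2 * real J * exp (2 * z + 2) * exp (- 2 * z - 2) \<le> real Q * exp (- 2 * z - 2)"
          by (rule mult_right_mono[OF Q]) simp
        also have "2 * real J * exp (2 * z + 2) * exp (- 2 * z - 2) = 2 * real J"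
          by (simp add: mult.assoc flip: exp_add)
        finally show "2 * real J / real Q \<le> exp (- 2 * z - 2)" using Q0 by (simp add: field_simps)
        have "real M * B \<le> E"
        proof -
          have "real M * B = real M * C * exp (2 * \<tau> * real R) * 1 * 1" by (simp add: B_def)
          also have "\<dots> \<le> E" unfolding E_def
            by (intro mult_mono) (use \<tau> ha hA C1 in \<open>auto intro!: add_nonneg_nonneg mult_nonneg_nonneg\<close>)
          finally show ?thesis .
        qed
        then have "real M * B * real H \<le> E * real H" by (rule mult_right_mono) simp
        then show "real M * B * real H \<le> exp (2 * V)" using EH by linarith
      qed (use B0 in auto)
      finally show "(\<Sum>i<J. \<bar>\<Sum>j\<in>I. \<phi> i j * of_int (p j)\<bar>) \<le> exp (- 2 * z - 2) * exp (2 * V)" .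
      have "(\<Sum>i\<in>{J..<Suc R}. \<bar>\<Sum>j\<in>I. \<phi> i j * of_int (p j)\<bar>)
          \<le> (\<Sum>i\<in>{J..<Suc R}. real M * real H * C * ((2 * \<tau> * real R) ^ i / fact i))"
      proof (rule sum_mono)
        fix i
        have "\<bar>\<Sum>j\<in>I. \<phi> i j * of_int (p j)\<bar> \<le> (\<Sum>j\<in>I. \<bar>\<phi> i j\<bar> * \<bar>of_int (p j)\<bar>)"
          unfolding abs_mult[symmetric] by (rule sum_abs)
        also have "\<dots> \<le> (\<Sum>j\<in>I. C * ((2 * \<tau> * real R) ^ i / fact i) * real H)"
          by (intro sum_mono mult_mono \<phi>_le pH) (use C1 zR in auto)
        finally show "\<bar>\<Sum>j\<in>I. \<phi> i j * of_int (p j)\<bar> \<le> real M * real H * C * ((2 * \<tau> * real R) ^ i / fact i)"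
          by (simp add: I mult_ac)
      qed
      also have "\<dots> = real M * real H * C * (\<Sum>i\<in>{J..<Suc R}. (2 * \<tau> * real R) ^ i / fact i)"
        by (simp only: sum_distrib_left)
      also have "\<dots> \<le> real M * real H * C * (exp (- real J) * exp (3 * (2 * \<tau> * real R)))"
        by (intro mult_left_mono exp_tail_le zR) (use C1 in auto)
      also have "\<dots> = exp (- real J) * ((real M * C * exp (6 * \<tau> * real R) * 1 * 1) * real H)"
        by (simp add: mult_ac)
      also have "\<dots> \<le> exp (- 2 * z - 2) * (E * real H)"
        unfolding E_def by (intro mult_mono)
          (use \<tau> ha hA C1 J(1) in \<open>auto intro!: add_nonneg_nonneg mult_nonneg_nonneg\<close>)
      also have "\<dots> \<le> exp (- 2 * z - 2) * exp (2 * V)" by (intro mult_left_mono EH) simp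
      finally show "(\<Sum>i\<in>{J..<Suc R}. \<bar>\<Sum>j\<in>I. \<phi> i j * of_int (p j)\<bar>) \<le> exp (- 2 * z - 2) * exp (2 * V)" .
    qed
    finally show ?thesis by (simp add: mult_ac)
  qed
  \<comment> \<open>\<open>f\<close> is small by analysis, \<open>Pv\<close> is algebraic of
    controlled height; they differ only by \<open>A ^ (l * t)\<close> in place of
    \<open>(a ^ q) ^ (l * t)\<close>.\<close>
  define Pv where "Pv s t = (\<Sum>(k, l)\<in>I. of_int (p (k, l)) * of_nat ((s + t * q) choose k) * (of_real a ^ s * A ^ t) ^ l)" for s t
  have diff: "norm (Pv s t - of_real (f (s + t * q))) \<le> exp (- \<Omega>) * exp (2 * V)" if st: "s < S" "t < T" for s t
  proof -
    let ?x = "s + t * q"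
    have "Pv s t - of_real (f ?x) = (\<Sum>(k, l)\<in>I. of_int (p (k, l)) * of_nat (?x choose k) *
        (of_real a ^ (l * s) * (A ^ (l * t) - of_real (a ^ q) ^ (l * t))))"
      unfolding Pv_def f_def of_real_sum sum_subtractf[symmetric]
      by (rule sum.cong) (auto simp: algebra_simps power_add power_mult_distrib simp flip: power_mult)
    also have "norm \<dots> \<le> (\<Sum>j\<in>I. real H * (C * exp (\<tau> * real R)) * (exp (\<tau> * real R) * exp (real L * real T) * exp (- \<Omega>)))"
    proof (rule sum_norm_le, clarify)
      fix k l assume kl: "(k, l) \<in> I"
      then have l: "l < L" "k < K" by (auto simp: I_def)
      have "norm (A ^ (l * t) - of_real (a ^ q) ^ (l * t)) \<le> 2 ^ (l * t) * exp (- \<Omega>) * norm (of_real (a ^ q) :: complex) ^ (l * t)"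
      proof (rule norm_power_diff_le)
        show "norm (A - of_real (a ^ q)) \<le> exp (- \<Omega>) * norm (of_real (a ^ q) :: complex)"
          using approx a(1) by (simp add: norm_power)
        have "0 \<le> 4 * (real d + 1) * V" using V(2) by simp
        then show "exp (- \<Omega>) \<le> 1" using \<Omega> by simp
      qed simp
      then have "norm (of_real a ^ (l * s) * (A ^ (l * t) - of_real (a ^ q) ^ (l * t)))
          \<le> a ^ (l * s) * (2 ^ (l * t) * exp (- \<Omega>) * (a ^ q) ^ (l * t))"
        using a(1) by (simp add: norm_mult norm_power mult_left_mono)
      also have "\<dots> = a ^ (l * ?x) * 2 ^ (l * t) * exp (- \<Omega>)"
        by (simp add: algebra_simps power_add flip: power_mult)
      also have "\<dots> \<le> exp (\<tau> * real R) * exp (real L * real T) * exp (- \<Omega>)"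
      proof (intro mult_right_mono mult_mono)
        have "a ^ (l * ?x) = exp (real ?x * (real l * ln a))"
          using a(1) by (simp only: exp_of_nat_mult exp_ln power_mult)
        also have "\<dots> \<le> exp (real R * \<tau>)"
        proof -
          have "real l * ln a \<le> real l * \<bar>ln a\<bar>" by (intro mult_left_mono) auto
          also have "\<dots> \<le> real L * \<bar>ln a\<bar>" using l by (intro mult_right_mono) auto
          finally have "real l * ln a \<le> real L * \<bar>ln a\<bar>" .
          then have "real l * ln a \<le> \<tau>" using \<tau> by linarith
          then have "real ?x * (real l * ln a) \<le> real ?x * \<tau>" by (intro mult_left_mono) auto
          also have "\<dots> \<le> real R * \<tau>" using of_nat_mono[OF xR[OF st], where 'a = real] \<tau> by (intro mult_right_mono) simp_all
          finally show ?thesis by simp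
        qed
        finally show "a ^ (l * ?x) \<le> exp (\<tau> * real R)" by (simp add: mult.commute)
        have "(2::real) ^ (l * t) \<le> exp 1 ^ (l * t)"
          by (rule power_mono) (use exp_ge_add_one_self[of 1] in auto)
        also have "\<dots> = exp (real (l * t))" by (simp flip: exp_of_nat_mult)
        also have "\<dots> \<le> exp (real L * real T)" using l st by (auto intro!: mult_mono)
        finally show "(2::real) ^ (l * t) \<le> exp (real L * real T)" .
      qed (use a(1) in auto)
      finally have *: "norm (of_real a ^ (l * s) * (A ^ (l * t) - of_real (a ^ q) ^ (l * t)))
          \<le> exp (\<tau> * real R) * exp (real L * real T) * exp (- \<Omega>)" .
      show "norm (of_int (p (k, l)) * of_nat (?x choose k) * (of_real a ^ (l * s) * (A ^ (l * t) - of_real (a ^ q) ^ (l * t))))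
         \<le> real H * (C * exp (\<tau> * real R)) * (exp (\<tau> * real R) * exp (real L * real T) * exp (- \<Omega>))"
        unfolding norm_mult[of "of_int _ * _"] norm_mult[of "of_int _"] norm_of_int norm_of_nat
        by (intro mult_mono * pH kl bin xR st l) (use C1 in auto)
    qed
    also have "\<dots> = exp (- \<Omega>) * ((real M * C * (exp (\<tau> * real R) * exp (\<tau> * real R)) * 1 * exp (real L * real T)) * real H)"
      by (simp add: I mult_ac)
    also have "\<dots> \<le> exp (- \<Omega>) * (E * real H)"
      unfolding E_def exp_add[symmetric]
      by (intro mult_mono) (use \<tau> ha hA C1 in \<open>auto intro!: add_nonneg_nonneg mult_nonneg_nonneg\<close>)
    also have "\<dots> \<le> exp (- \<Omega>) * exp (2 * V)" by (intro mult_left_mono EH) simp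
    finally show ?thesis .
  qed
  have vanish: "Pv s t = 0" if st: "s < S" "t < T" for s t
  proof (rule ccontr)
    assume nz: "Pv s t \<noteq> 0"
    \<comment> \<open>A common denominator of the powers \<open>(a ^ s * A ^ t) ^ l\<close> for all
      \<open>l < L\<close>.\<close>
    define m where "m = a2 ^ (s * (L - 1)) * A2 ^ (t * (L - 1))"
    have split: "z ^ (L - 1) = z ^ l * z ^ (L - 1 - l)" if "l < L" for z :: complex and l
      using that by (simp flip: power_add)
    have G: "exp g ^ (s * (L - 1)) * exp h ^ (t * (L - 1)) \<le> exp (g * real L * real S + h * real L * real T)"
    proof -
      have "exp g ^ (s * (L - 1)) * exp h ^ (t * (L - 1)) = exp (real (s * (L - 1)) * g + real (t * (L - 1)) * h)"
        by (simp only: exp_add exp_of_nat_mult)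
      also have "\<dots> \<le> exp (real (S * L) * g + real (T * L) * h)"
        unfolding exp_le_cancel_iff
        by (intro add_mono mult_right_mono of_nat_mono mult_mono) (use st ha hA in auto)
      finally show ?thesis by (simp add: mult_ac)
    qed
    have m_hgt: "hgt d v (exp (g * real L * real S + h * real L * real T)) m"
      unfolding m_def by (rule hgt_mono[OF hgt_mult[OF hgt_power[OF ha(2)] hgt_power[OF hA(2)]] G])
    have Z: "m * Pv s t = (\<Sum>(k, l)\<in>I. of_int (p (k, l)) * of_int (int ((s + t * q) choose k)) *
       ((a1 ^ l * a2 ^ (L - 1 - l)) ^ s * (A1 ^ l * A2 ^ (L - 1 - l)) ^ t))"
      unfolding Pv_def sum_distrib_left
    proof (rule sum.cong[OF refl], clarify)
      fix k l assume "(k, l) \<in> I"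
      then have l: "l < L" by (simp add: I_def)
      have e: "m = (a2 ^ l * a2 ^ (L - 1 - l)) ^ s * (A2 ^ l * A2 ^ (L - 1 - l)) ^ t"
        unfolding m_def mult.commute[of s "L - 1"] mult.commute[of t "L - 1"] power_mult
        by (simp only: split[OF l])
      have "(of_real a ^ s * A ^ t) ^ l = (a1 ^ l / a2 ^ l) ^ s * (A1 ^ l / A2 ^ l) ^ t"
        unfolding a(3) A(1) by (simp add: power_mult_distrib power_divide mult.commute[of _ l] flip: power_mult)
      then show "m * (of_int (p (k, l)) * of_nat ((s + t * q) choose k) * (of_real a ^ s * A ^ t) ^ l)
        = of_int (p (k, l)) * of_int (int ((s + t * q) choose k)) * ((a1 ^ l * a2 ^ (L - 1 - l)) ^ s * (A1 ^ l * A2 ^ (L - 1 - l)) ^ t)"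
        unfolding e using a(4) A(3) by (simp add: power_mult_distrib power_divide)
    qed
    have Z_hgt: "hgt d v (\<Sum>j\<in>I. real H * (C * exp (\<tau> * real R)) * exp (g * real L * real S + h * real L * real T)) (m * Pv s t)"
      unfolding Z
    proof (rule hgt_sum[OF I(1)], clarify)
      fix k l assume kl: "(k, l) \<in> I"
      then have l: "l < L" "k < K" by (auto simp: I_def)
      have "hgt d v ((exp g ^ l * exp g ^ (L - 1 - l)) ^ s * (exp h ^ l * exp h ^ (L - 1 - l)) ^ t)
          ((a1 ^ l * a2 ^ (L - 1 - l)) ^ s * (A1 ^ l * A2 ^ (L - 1 - l)) ^ t)"
        by (intro hgt_mult hgt_power ha hA)
      moreover have "(exp g ^ l * exp g ^ (L - 1 - l)) ^ s * (exp h ^ l * exp h ^ (L - 1 - l)) ^ t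
          \<le> exp (g * real L * real S + h * real L * real T)"
      proof -
        have "exp g ^ l * exp g ^ (L - 1 - l) = exp g ^ (L - 1)" "exp h ^ l * exp h ^ (L - 1 - l) = exp h ^ (L - 1)"
          using l by (simp_all flip: power_add)
        then show ?thesis
          using G unfolding mult.commute[of s "L - 1"] mult.commute[of t "L - 1"] power_mult by (simp only:)
      qed
      ultimately have 1: "hgt d v (exp (g * real L * real S + h * real L * real T))
          ((a1 ^ l * a2 ^ (L - 1 - l)) ^ s * (A1 ^ l * A2 ^ (L - 1 - l)) ^ t)"
        by (rule hgt_mono)
      have 2: "hgt d v (real H) (of_int (p (k, l)))" by (rule hgt_of_int) (use pH[OF kl] in simp)
      have 3: "hgt d v (C * exp (\<tau> * real R)) (of_int (int ((s + t * q) choose k)))"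
        by (rule hgt_of_int) (use bin[OF xR[OF st] l(2)] in simp)
      show "hgt d v (real H * (C * exp (\<tau> * real R)) * exp (g * real L * real S + h * real L * real T))
         (of_int (p (k, l)) * of_int (int ((s + t * q) choose k)) * ((a1 ^ l * a2 ^ (L - 1 - l)) ^ s * (A1 ^ l * A2 ^ (L - 1 - l)) ^ t))"
        by (intro hgt_mult 1 2 3)
    qed
    have "(\<Sum>j\<in>I. real H * (C * exp (\<tau> * real R)) * exp (g * real L * real S + h * real L * real T))
       = (real M * C * exp (\<tau> * real R) * exp (g * real L * real S + h * real L * real T) * 1) * real H"
      by (simp add: I mult_ac)
    also have "\<dots> \<le> E * real H"
      unfolding E_def by (intro mult_mono)
        (use \<tau> ha hA C1 in \<open>auto intro!: add_nonneg_nonneg mult_nonneg_nonneg\<close>)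
    also have "\<dots> \<le> exp (2 * V)" by (rule EH)
    finally have hZ: "hgt d v (exp (2 * V)) (m * Pv s t)" by (rule hgt_mono[OF Z_hgt])
    have m0: "m \<noteq> 0" using a(4) A(3) by (simp add: m_def)
    have "1 \<le> norm (m * Pv s t) * exp (2 * V) ^ (d - 1)"
      by (rule hgt_liouville[OF hZ v]) (use nz m0 V(2) in auto)
    also have "\<dots> \<le> (exp (2 * V) * norm (Pv s t)) * exp (2 * V) ^ (d - 1)"
    proof (intro mult_right_mono)
      have "norm m \<le> exp (g * real L * real S + h * real L * real T)" by (rule hgt_norm_le[OF m_hgt v])
      also have "\<dots> = 1 * 1 * 1 * exp (g * real L * real S + h * real L * real T) * 1" by simp
      also have "\<dots> \<le> E" unfolding E_def
        by (intro mult_mono) (use M1 \<tau> ha hA C1 in \<open>auto intro!: add_nonneg_nonneg mult_nonneg_nonneg\<close>)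
      also have "\<dots> \<le> exp V" by (rule E)
      also have "\<dots> \<le> exp (2 * V)" using V(2) by simp
      finally show "norm (m * Pv s t) \<le> exp (2 * V) * norm (Pv s t)"
        by (simp add: norm_mult mult_right_mono)
    qed auto
    also have "\<dots> = norm (Pv s t) * exp (2 * V) ^ Suc (d - 1)" by simp
    also have "Suc (d - 1) = d" using v(1) by simp
    also have "exp (2 * V) ^ d = exp (2 * z - 2 * V)"
      by (simp add: z_def algebra_simps flip: exp_of_nat_mult)
    finally have low: "1 \<le> norm (Pv s t) * exp (2 * z - 2 * V)" .
    \<comment> \<open>Liouville gives at least \<open>exp (2 * V - 2 * z)\<close>, the construction
      at most \<open>3 * exp (2 * V - 2 * z - 2)\<close>; these collide because
      \<open>exp 2 > 3\<close>.\<close>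
    have "norm (Pv s t) \<le> norm (Pv s t - of_real (f (s + t * q))) + norm (of_real (f (s + t * q)) :: complex)"
      by (metis diff_add_cancel norm_triangle_ineq)
    also have "\<dots> \<le> exp (- \<Omega>) * exp (2 * V) + 2 * exp (- 2 * z - 2) * exp (2 * V)"
      using diff[OF st] f_small[OF xR[OF st]] by simp
    also have "\<dots> \<le> exp (- 2 * z - 2) * exp (2 * V) + 2 * exp (- 2 * z - 2) * exp (2 * V)"
    proof -
      have "4 * z \<le> \<Omega>" using \<Omega> unfolding z_def by (simp only: mult.assoc)
      then have "2 * z + 2 \<le> \<Omega>" using z by linarith
      then show ?thesis by simp
    qed
    also have "\<dots> = 3 * exp (- 2 * z - 2) * exp (2 * V)" by simp
    finally have "1 \<le> (3 * exp (- 2 * z - 2) * exp (2 * V)) * exp (2 * z - 2 * V)"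
      using low by (meson exp_ge_zero mult_right_mono order_trans)
    also have "\<dots> = 3 * exp (- 2 :: real)" by (simp add: mult.assoc flip: exp_add)
    finally have "exp 2 \<le> (3::real)" by (simp add: exp_minus field_simps)
    moreover have "(4::real) \<le> exp 2"
    proof -
      have "(2::real) * 2 \<le> exp 1 * exp 1" by (intro mult_mono) (use exp_ge_add_one_self[of 1] in auto)
      then show ?thesis by (simp flip: exp_add)
    qed
    ultimately show False by simp
  qed
  have "p (k, l) = 0" if kl: "k < K" "l < L" for k l
  proof -
    have "(of_int (p (k, l)) :: complex) = 0"
    proof (rule zero_estimate[where p = "\<lambda>k l. of_int (p (k, l))" and a = "of_real a" and A = A and S = S and T = T and q = q])
      show "inj_on (\<lambda>l. complex_of_real a ^ l) {..<L}"
      proof (rule inj_onI)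
        fix l m assume "complex_of_real a ^ l = complex_of_real a ^ m"
        then have "a ^ l = a ^ m" by (metis of_real_eq_iff of_real_power)
        then have "real l * ln a = real m * ln a" using a(1) by (metis ln_realpow)
        then show "l = m" using a(1,2) by simp
      qed
      show "complex_of_real a \<noteq> 0" using a(1) by simp
      show "A \<noteq> 0" using A by simp
      fix s t assume "s < S" "t < T"
      from vanish[OF this] show "(\<Sum>k<K. \<Sum>l<L. of_int (p (k, l)) * of_nat ((s + t * q) choose k) * (complex_of_real a ^ s * A ^ t) ^ l) = 0"
        by (simp add: Pv_def I_def sum.cartesian_product)
    qed (use S kl in auto)
    then show ?thesis by simp
  qed
  then show False using p(1) unfolding I_def by auto
qed

lemma ln_le_two_sqrt: "0 < x \<Longrightarrow> ln x \<le> 2 * sqrt x"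
  using ln_le_minus_one[of "sqrt x"] by (simp add: ln_sqrt)

text \<open>\<open>two_logs_core\<close> with explicit parameters. Here \<open>n'\<close> measures
  the height of \<open>a\<close>; in the application it is the multiplier found by Dirichlet's
  theorem. With \<open>X = n' * q0 * L\<close> one gets \<open>K * L = Y ^ 9 * X\<close> against
  \<open>V = Y ^ 6 * X\<close>, and the spare \<open>Y ^ 3\<close> covers
  \<open>42 * (d + 1)^2\<close>. The exponent 80 is that of \<open>L ^ 4\<close>.\<close>

lemma two_logs:
  fixes a \<Omega> :: real and A a1 a2 A1 A2 :: complex and d Y n' q :: nat
  assumes Y: "1000 \<le> Y" "d + 1 \<le> Y" and n': "1 \<le> n'" and q: "Y ^ 70 \<le> q"
    and v: "i0 < d" "v i0 \<noteq> 0"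
    and a: "0 < a" "a \<noteq> 1" "of_real a = a1 / a2" "a2 \<noteq> 0"
    and A: "A = A1 / A2" "A1 \<noteq> 0" "A2 \<noteq> 0"
    and ha: "hgt d v (exp (real Y * real n')) a1" "hgt d v (exp (real Y * real n')) a2"
    and hA: "hgt d v (exp (real Y * real q / real Y ^ 80)) A1" "hgt d v (exp (real Y * real q / real Y ^ 80)) A2"
    and ln_a: "\<bar>ln a\<bar> \<le> real Y / real Y ^ 80"
    and approx: "norm (A - of_real (a ^ q)) \<le> exp (- (real n' * real q / real Y)) * a ^ q"
  shows False
proof -
  \<comment> \<open>\<open>L\<close> exceeds every small power of \<open>Y\<close> below, and
    \<open>q\<close> is about \<open>q0 * L^2\<close>. With \<open>\<tau> = 1 / L^2\<close> the
    range \<open>T * q\<close> of the points then contributes only about \<open>Y ^ 5 * X\<close> to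
    the exponent.\<close>
  define L where "L = Y ^ 20"
  define q0 where "q0 = q div L\<^sup>2"
  define T where "T = Y ^ 5 * L * n'"
  define K where "K = Y ^ 9 * n' * q0"
  \<comment> \<open>The summand 1 makes \<open>K * L < S2 * T\<close> strict;
    \<open>Y ^ 4 * q0 * T\<close> equals \<open>K * L\<close>.\<close>
  define S2 where "S2 = Y ^ 4 * q0 + 1"
  define y l Q nn where "y = real Y" and "l = real L" and "Q = real q0" and "nn = real n'"
  have y: "1000 \<le> y" using Y by (simp add: y_def)
  have l: "l = y ^ 20" by (simp add: l_def L_def y_def)
  have yl: "1000 * y ^ k \<le> l" if "k < 20" for k
  proof -
    have "1000 * y ^ k \<le> y * y ^ k" by (rule mult_right_mono) (use y in auto)
    also have "\<dots> = y ^ Suc k" by simp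
    also have "\<dots> \<le> y ^ 20" by (rule power_increasing) (use that y in auto)
    finally show ?thesis by (simp add: l)
  qed
  have L2: "0 < L\<^sup>2" using Y by (simp add: L_def)
  have L2q: "q0 * L\<^sup>2 \<le> q" unfolding q0_def by (simp add: div_times_less_eq_dividend)
  have qL2: "q < (q0 + 1) * L\<^sup>2" unfolding q0_def
    using dividend_less_div_times[OF L2, of q] by simp
  have q0L: "Y ^ 30 \<le> q0"
  proof -
    have "Y ^ 30 * L\<^sup>2 = Y ^ 70" by (simp add: L_def flip: power_mult power_add)
    moreover have "Y ^ 30 = Y ^ 30 * L\<^sup>2 div L\<^sup>2" using L2 by simp
    ultimately have "Y ^ 30 = Y ^ 70 div L\<^sup>2" by (simp only:)
    also have "\<dots> \<le> q0" unfolding q0_def by (rule div_le_mono[OF q])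
    finally show ?thesis .
  qed
  have Ql: "1000 * l \<le> Q"
  proof -
    have "1000 * l \<le> y * y ^ 20" unfolding l by (rule mult_right_mono) (use y in auto)
    also have "\<dots> = y ^ 21" using power_Suc[of y 20] by simp
    also have "\<dots> \<le> y ^ 30" by (rule power_increasing) (use y in auto)
    also have "\<dots> \<le> Q" using of_nat_mono[OF q0L, where 'a = real] by (simp add: Q_def y_def)
    finally show ?thesis .
  qed
  have l1: "1 \<le> l" "1000 \<le> l" using yl[of 0] by auto
  have Q1: "1 \<le> Q" "0 < Q" using Ql l1 by linarith+
  have nn: "1 \<le> nn" using n' by (simp add: nn_def)
  have qQ: "Q * l\<^sup>2 \<le> real q" "real q \<le> 2 * Q * l\<^sup>2"
  proof -
    show "Q * l\<^sup>2 \<le> real q"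
      using of_nat_mono[OF L2q, where 'a = real] by (simp add: Q_def l_def)
    have "real q \<le> real ((q0 + 1) * L\<^sup>2)" using qL2 by (intro of_nat_mono) simp
    also have "\<dots> = (Q + 1) * l\<^sup>2" by (simp add: Q_def l_def algebra_simps)
    also have "\<dots> \<le> (2 * Q) * l\<^sup>2" by (rule mult_right_mono) (use Q1 in auto)
    finally show "real q \<le> 2 * Q * l\<^sup>2" by simp
  qed
  define X where "X = nn * Q * l"
  have X1: "1 \<le> X" unfolding X_def using nn Q1 l1 mult_mono[of 1 "nn * Q" 1 l] mult_mono[of 1 nn 1 Q] by simp
  have X0: "0 \<le> nn * Q" "0 \<le> X" "0 < X" using nn Q1 X1 by auto
  have KL: "real (K * L) = y ^ 9 * X" by (simp add: K_def X_def y_def Q_def l_def nn_def)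
  have T: "real T = y ^ 5 * l * nn" by (simp add: T_def y_def l_def nn_def)
  have S: "real (S2 + L) \<le> 3 * y ^ 4 * Q"
  proof -
    have "1 * Q \<le> y ^ 4 * Q" by (rule mult_right_mono) (use y Q1 in auto)
    moreover have "real (S2 + L) = y ^ 4 * Q + 1 + l" by (simp add: S2_def y_def Q_def l_def)
    ultimately show ?thesis using Ql l1 by linarith
  qed
  define V where "V = y ^ 6 * X"
  have yk: "1 \<le> y ^ k" for k using y by simp
  have V1: "X \<le> V" unfolding V_def using mult_right_mono[OF yk[of 6] X0(2)] by simp
  show False
  proof (rule two_logs_core[OF v a A ha _ hA _ approx, where K = K and L = L and T = T and ?S2.0 = S2
        and S = "S2 + L" and \<tau> = "1 / l\<^sup>2" and V = V])
    show "0 < 1 / l\<^sup>2" using l1 by simp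
    show "1 / l\<^sup>2 \<le> 1 / 2"
    proof -
      have "2 \<le> l * 1" using l1 by simp
      also have "\<dots> \<le> l * l" by (rule mult_left_mono) (use l1 in auto)
      finally show ?thesis by (simp add: power2_eq_square field_simps)
    qed
    show "real L * \<bar>ln a\<bar> \<le> 1 / l\<^sup>2 / 2"
    proof -
      have "y ^ 80 = l ^ 4" by (simp add: l flip: power_mult)
      then have "real L * \<bar>ln a\<bar> \<le> l * (y / l ^ 4)"
        using ln_a by (intro mult_mono) (auto simp: l_def y_def)
      also have "\<dots> = (y / l) / l\<^sup>2" using l1 by (simp add: field_simps power2_eq_square eval_nat_numeral)
      also have "\<dots> \<le> (1 / 2) / l\<^sup>2"
        by (intro divide_right_mono) (use yl[of 1] l1 in \<open>auto simp: field_simps\<close>)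
      finally show ?thesis by simp
    qed
    show "0 < K" using Y n' Q1 by (simp add: K_def Q_def)
    show "0 < L" using Y by (simp add: L_def)
    show "1 \<le> V" using V1 X1 by simp
    show "ln (real (K * L)) + real K * ln (2 / (1 / l\<^sup>2)) + 6 * (1 / l\<^sup>2) * real (S2 + L + T * q) +
       real Y * real n' * real L * real (S2 + L) + real Y * real q / real Y ^ 80 * real L * real T + real L * real T \<le> V"
    proof -
      \<comment> \<open>Each of the six summands is bounded by \<open>V / 6\<close>.\<close>
      have "ln (real (K * L)) \<le> V / 6"
      proof -
        define M where "M = y ^ 9 * X"
        have M: "0 < M" unfolding M_def using X0 y by simp
        have "144 * y ^ 6 \<le> y * y ^ 6" by (rule mult_right_mono) (use y in auto)
        also have "\<dots> = y ^ 7 * 1" by (simp add: eval_nat_numeral)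
        also have "\<dots> \<le> y ^ 9 * X" by (intro mult_mono power_increasing X1) (use y in auto)
        finally have "(12 * y ^ 3)\<^sup>2 \<le> M" by (simp add: M_def power_mult_distrib flip: power_mult)
        then have "12 * y ^ 3 \<le> sqrt M" by (rule real_le_rsqrt)
        then have "12 * y ^ 3 * sqrt M \<le> sqrt M * sqrt M" by (intro mult_right_mono) (use M in auto)
        then have "12 * y ^ 3 * sqrt M \<le> M" using M by simp
        also have "M = 6 * y ^ 3 * (V / 6)" by (simp add: M_def V_def eval_nat_numeral)
        finally have "6 * y ^ 3 * (2 * sqrt M) \<le> 6 * y ^ 3 * (V / 6)" by simp
        then have "2 * sqrt M \<le> V / 6" using y by (subst (asm) mult_le_cancel_left_pos) auto
        then show ?thesis using ln_le_two_sqrt[OF M] unfolding KL M_def by linarith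
      qed
      moreover have "real K * ln (2 / (1 / l\<^sup>2)) \<le> V / 6"
      proof -
        have "ln (2 / (1 / l\<^sup>2)) = ln 2 + 40 * ln y" using y
          by (simp add: ln_mult l ln_realpow flip: power_mult)
        also have "\<dots> \<le> 1 + 40 * y" using ln_le_minus_one[of 2] ln_le_minus_one[of y] y by simp
        also have "\<dots> \<le> y * y" using y mult_right_mono[of 1000 y y] by linarith
        finally have "real K * ln (2 / (1 / l\<^sup>2)) \<le> real K * (y * y)" by (rule mult_left_mono) simp
        also have "\<dots> = y ^ 6 * (nn * Q) * y ^ 5" by (simp add: K_def y_def nn_def Q_def eval_nat_numeral)
        also have "\<dots> \<le> y ^ 6 * (nn * Q) * (l / 6)"
        proof (intro mult_left_mono)
          show "y ^ 5 \<le> l / 6" using yl[of 5] yk[of 5] by linarith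
        qed (use X0 y in auto)
        finally show ?thesis by (simp add: V_def X_def)
      qed
      moreover have "6 * (1 / l\<^sup>2) * real (S2 + L + T * q) \<le> V / 6"
      proof -
        have "real (S2 + L) \<le> real T * real q"
        proof -
          have "3 * y ^ 4 * Q \<le> y * y ^ 4 * (Q * 1)" by (intro mult_mono) (use y Q1 in auto)
          also have "\<dots> \<le> y ^ 5 * l * nn * (Q * l\<^sup>2)"
          proof (rule mult_mono)
            have "y * y ^ 4 = y ^ 5 * 1 * 1" by (simp add: eval_nat_numeral)
            also have "\<dots> \<le> y ^ 5 * l * nn" by (intro mult_mono) (use y l1 nn in auto)
            finally show "y * y ^ 4 \<le> y ^ 5 * l * nn" .
            show "Q * 1 \<le> Q * l\<^sup>2" by (intro mult_left_mono one_le_power) (use l1 Q1 in auto)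
          qed (use y l1 nn Q1 in auto)
          also have "\<dots> \<le> real T * real q" unfolding T by (intro mult_left_mono qQ) (use y l1 nn in auto)
          finally show ?thesis using S by linarith
        qed
        then have "real (S2 + L + T * q) \<le> 2 * (real T * real q)" by simp
        also have "\<dots> \<le> 2 * (y ^ 5 * l * nn * (2 * Q * l\<^sup>2))" unfolding T
          by (intro mult_left_mono qQ) (use y l1 nn in auto)
        finally have "6 * (1 / l\<^sup>2) * real (S2 + L + T * q) \<le> 6 * (1 / l\<^sup>2) * (2 * (y ^ 5 * l * nn * (2 * Q * l\<^sup>2)))"
          by (intro mult_left_mono) auto
        also have "\<dots> = 24 * (y ^ 5 * X)" using l1 by (simp add: X_def)
        also have "\<dots> \<le> y / 6 * (y ^ 5 * X)" by (intro mult_right_mono) (use y X0 in auto)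
        also have "\<dots> = V / 6" by (simp add: V_def eval_nat_numeral)
        finally show ?thesis .
      qed
      moreover have "real Y * real n' * real L * real (S2 + L) \<le> V / 6"
      proof -
        have "real Y * real n' * real L * real (S2 + L) \<le> y * nn * l * (3 * y ^ 4 * Q)"
          unfolding y_def[symmetric] nn_def[symmetric] l_def[symmetric]
          by (intro mult_left_mono S) (use y nn l1 in auto)
        also have "\<dots> = 3 * (y ^ 5 * X)" by (simp add: X_def eval_nat_numeral)
        also have "\<dots> \<le> y / 6 * (y ^ 5 * X)" by (intro mult_right_mono) (use y X0 in auto)
        also have "\<dots> = V / 6" by (simp add: V_def eval_nat_numeral)
        finally show ?thesis .
      qed
      moreover have "real Y * real q / real Y ^ 80 * real L * real T \<le> V / 6"
      proof -
        have e: "y ^ 80 = l ^ 4" by (simp add: l flip: power_mult)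
        have "real Y * real q / real Y ^ 80 * real L * real T = (y ^ 6 * nn / l\<^sup>2) * real q"
          unfolding y_def[symmetric] l_def[symmetric] T e using l1
          by (simp add: field_simps eval_nat_numeral)
        also have "\<dots> \<le> (y ^ 6 * nn / l\<^sup>2) * (2 * Q * l\<^sup>2)"
          by (intro mult_left_mono qQ) (use y nn in auto)
        also have "\<dots> = y ^ 6 * (nn * Q) * 2" using l1 by simp
        also have "\<dots> \<le> y ^ 6 * (nn * Q) * (l / 6)" by (intro mult_left_mono) (use X0 y l1 in auto)
        finally show ?thesis by (simp add: V_def X_def)
      qed
      moreover have "real L * real T \<le> V / 6"
      proof -
        have "real L * real T = y ^ 5 * nn * l * l" by (simp add: T l_def)
        also have "\<dots> \<le> y ^ 5 * nn * l * (y * Q / 6)"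
        proof (intro mult_left_mono)
          have "1 * Q \<le> y * Q" by (rule mult_right_mono) (use y Q1 in auto)
          then show "l \<le> y * Q / 6" using Ql l1 by linarith
        qed (use y nn l1 in auto)
        also have "\<dots> = V / 6" by (simp add: V_def X_def eval_nat_numeral)
        finally show ?thesis .
      qed
      ultimately show ?thesis by linarith
    qed
    have d: "real d + 1 \<le> y" using Y(2) by (simp add: y_def flip: of_nat_Suc)
    show "42 * (real d + 1)\<^sup>2 * V \<le> real (K * L)"
    proof -
      have "42 * (real d + 1)\<^sup>2 * V \<le> y * y\<^sup>2 * V"
        by (intro mult_mono mult_right_mono power_mono d) (use y V1 X0 in auto)
      also have "\<dots> = y ^ 9 * X" by (simp add: V_def eval_nat_numeral)
      finally show ?thesis by (simp only: KL)
    qed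
    show "4 * (real d + 1) * V \<le> real n' * real q / real Y"
    proof -
      have "4 * (real d + 1) * V \<le> 4 * y * V" by (intro mult_right_mono mult_left_mono d) (use V1 X0 in auto)
      also have "\<dots> = nn * Q * l * (4 * y ^ 8) / y" using y by (simp add: V_def X_def eval_nat_numeral)
      \<comment> \<open>The decisive comparison: \<open>n' * q / Y\<close> contains one factor
        \<open>L\<close> more than \<open>V\<close>, and \<open>L\<close> beats the powers of
        \<open>Y\<close> lost elsewhere.\<close>
      also have "\<dots> \<le> nn * Q * l * l / y"
        by (intro divide_right_mono mult_left_mono) (use yl[of 8] yk[of 8] y nn Q1 l1 in auto)
      also have "\<dots> = nn * (Q * l\<^sup>2) / y" by (simp add: power2_eq_square)
      also have "\<dots> \<le> nn * real q / y" by (intro divide_right_mono mult_left_mono qQ) (use y nn in auto)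
      finally show ?thesis by (simp add: nn_def y_def)
    qed
    show "S2 \<le> q"
    proof -
      have "real S2 = y ^ 4 * Q + 1" by (simp add: S2_def y_def Q_def)
      also have "\<dots> \<le> y ^ 4 * Q + y ^ 4 * Q" using mult_mono[of 1 "y ^ 4" 1 Q] yk[of 4] Q1 by (simp add: mult.commute)
      also have "\<dots> = (2 * y ^ 4) * Q" by simp
      also have "\<dots> \<le> (l * l) * Q"
        by (intro mult_right_mono mult_mono) (use l1 yl[of 4] yk[of 4] Q1 y in auto)
      also have "\<dots> \<le> real q" using qQ by (simp add: power2_eq_square mult_ac)
      finally show ?thesis by simp
    qed
    show "K * L < S2 * T"
    proof -
      have "0 < T" using Y n' by (simp add: T_def L_def)
      moreover have "Y ^ 9 = Y ^ 4 * Y ^ 5" by (simp flip: power_add)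
      ultimately show ?thesis by (simp add: K_def S2_def T_def algebra_simps)
    qed
  qed auto
qed

text \<open>The \<open>N + 1\<close> multiples \<open>k * \<theta>\<close> with
  \<open>k \<le> N\<close> have fractional parts in \<open>N\<close> intervals of length
  \<open>1 / N\<close>; subtract two that share one.\<close>

lemma dirichlet_approximation:
  fixes \<theta> :: real
  assumes "0 < N"
  shows "\<exists>(k::nat) (m::int). 1 \<le> k \<and> k \<le> N \<and> \<bar>real k * \<theta> - of_int m\<bar> \<le> 1 / real N"
proof -
  define f where "f k = nat \<lfloor>real N * frac (real k * \<theta>)\<rfloor>" for k :: nat
  have fN: "f k < N" for k
  proof -
    have "real N * frac (real k * \<theta>) < real N * 1"
      using assms frac_lt_1 by (intro mult_strict_left_mono) auto
    moreover have "0 \<le> real N * frac (real k * \<theta>)" by simp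
    ultimately show ?thesis unfolding f_def by linarith
  qed
  have "\<not> inj_on f {..N}"
  proof
    assume "inj_on f {..N}"
    then have "card {..N} \<le> card {..<N}" by (rule card_inj_on_le) (use fN in auto)
    then show False by simp
  qed
  then obtain i j where ij: "i \<le> N" "j \<le> N" "i < j" "f i = f j"
    unfolding inj_on_def by (metis atMost_iff linorder_neqE_nat)
  have "0 \<le> real N * frac (real k * \<theta>)" for k :: nat by simp
  then have "0 \<le> \<lfloor>real N * frac (real k * \<theta>)\<rfloor>" for k :: nat by simp
  then have "\<lfloor>real N * frac (real i * \<theta>)\<rfloor> = \<lfloor>real N * frac (real j * \<theta>)\<rfloor>"
    using ij(4) unfolding f_def by (metis int_nat_eq)
  then have "\<bar>real N * frac (real i * \<theta>) - real N * frac (real j * \<theta>)\<bar> \<le> 1"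
    by linarith
  then have "real N * \<bar>frac (real j * \<theta>) - frac (real i * \<theta>)\<bar> \<le> 1"
    by (simp add: abs_mult abs_minus_commute flip: right_diff_distrib)
  then have "\<bar>frac (real j * \<theta>) - frac (real i * \<theta>)\<bar> \<le> 1 / real N"
    using assms by (simp add: field_simps)
  moreover have "frac (real j * \<theta>) - frac (real i * \<theta>) = real (j - i) * \<theta> - of_int (\<lfloor>real j * \<theta>\<rfloor> - \<lfloor>real i * \<theta>\<rfloor>)"
    using ij(3) by (simp add: frac_def of_nat_diff algebra_simps)
  ultimately show ?thesis using ij by (intro exI[of _ "j - i"] exI[of _ "\<lfloor>real j * \<theta>\<rfloor> - \<lfloor>real i * \<theta>\<rfloor>"]) auto
qed

section \<open>Effective approximation by products of powers\<close>

lemma hgt_abs_ln_le: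
  assumes "hgt d v (exp b) u" "i0 < d" "v i0 \<noteq> 0" "0 \<le> b" "u \<noteq> 0"
  shows "\<bar>ln (norm u)\<bar> \<le> real d * b"
proof -
  have d: "1 \<le> real d" using assms(2) by simp
  have u: "0 < norm u" using assms(5) by simp
  have "norm u \<le> exp b" by (rule hgt_norm_le[OF assms(1-3)])
  then have "ln (norm u) \<le> b" using u by (metis exp_gt_zero ln_exp ln_le_cancel_iff)
  then have 1: "ln (norm u) \<le> real d * b" using mult_right_mono[OF d assms(4)] by linarith
  have "1 \<le> norm u * exp b ^ (d - 1)" by (rule hgt_liouville[OF assms(1-3)]) (use assms in auto)
  then have "ln 1 \<le> ln (norm u * exp b ^ (d - 1))" using u by (subst ln_le_cancel_iff) auto
  also have "\<dots> = ln (norm u) + real (d - 1) * b" using u by (simp add: ln_mult ln_realpow)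
  also have "\<dots> \<le> ln (norm u) + real d * b" using assms(4) by (intro add_left_mono mult_right_mono) auto
  finally show ?thesis using 1 by simp
qed

text \<open>Divide \<open>n\<close> by \<open>2 * k\<close> with quotient \<open>q\<close> and
  remainder \<open>r\<close>. The relation becomes \<open>A \<approx> a ^ q\<close>, where
  \<open>A\<close> collects what is left over: \<open>u\<close>, \<open>w\<close>,
  \<open>\<alpha> ^ r\<close> and a power of \<open>\<beta>\<close>, of total logarithmic height at
  most \<open>Y ^ 4 * q / N\<close>. The exponents fit as \<open>1280 = 4 * 320\<close> and
  \<open>320 = 4 * 80\<close>: for \<open>Z = Y ^ 4\<close> the number \<open>Z ^ 80\<close> in
  \<open>two_logs\<close> is \<open>N\<close>, and \<open>n \<ge> N ^ 4\<close> forces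
  \<open>q \<ge> N ^ 2\<close>.\<close>

lemma effective_approximation:
  fixes \<alpha> \<beta> :: real and u w :: complex and d Y n m :: nat
  assumes Y: "1000 \<le> Y" "d + 1 \<le> Y"
    and v: "i0 < d" "v i0 \<noteq> 0"
    and \<alpha>: "1 + 1 / real Y \<le> \<bar>\<alpha>\<bar>" "hgt d v (real Y) (of_real \<alpha>)"
    and \<beta>: "1 + 1 / real Y \<le> \<bar>\<beta>\<bar>" "hgt d v (real Y) (of_real \<beta>)"
    and indep: "\<And>x y :: nat. 1 \<le> x \<Longrightarrow> \<alpha> ^ x \<noteq> \<beta> ^ y"
    and u: "hgt d v (exp (real n / real Y ^ 1280)) u" "u \<noteq> 0"
    and w: "hgt d v (exp (real n / real Y ^ 1280)) w" "w \<noteq> 0"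
    and approx: "norm (u * of_real \<alpha> ^ n - w * of_real \<beta> ^ m) \<le> exp (- (real n / real Y)) * norm (u * of_real \<alpha> ^ n)"
  shows "n < Y ^ 1280"
proof (rule ccontr)
  assume "\<not> n < Y ^ 1280"
  then have n: "Y ^ 1280 \<le> n" by simp
  define y where "y = real Y"
  have y: "1000 \<le> y" using Y by (simp add: y_def)
  have yk: "1 \<le> y ^ k" for k using y by simp
  define N where "N = Y ^ 320"
  define \<nu> where "\<nu> = real N"
  have \<nu>: "\<nu> = y ^ 320" by (simp add: \<nu>_def N_def y_def)
  have \<nu>1: "1 \<le> \<nu>" unfolding \<nu> by (rule yk)
  have N: "0 < N" using Y by (simp add: N_def)
  define la lb where "la = ln \<bar>\<alpha>\<bar>" and "lb = ln \<bar>\<beta>\<bar>"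
  have ln_bounds: "1 / (2 * y) \<le> ln \<bar>x\<bar>" "ln \<bar>x\<bar> \<le> y" "0 < \<bar>x\<bar>"
    if x: "1 + 1 / real Y \<le> \<bar>x\<bar>" "hgt d v (real Y) (of_real x)" for x :: real
  proof -
    have iy: "0 < 1 / y" "1 / y \<le> 1" using y by auto
    show x0: "0 < \<bar>x\<bar>" using x(1) iy unfolding y_def by linarith
    have "1 / y - (1 / y)\<^sup>2 \<le> ln (1 + 1 / y)" by (rule ln_one_plus_pos_lower_bound) (use iy in auto)
    moreover have "(1 / y)\<^sup>2 \<le> 1 / (2 * y)"
      using y by (simp add: power2_eq_square field_simps)
    moreover have "1 / y - 1 / (2 * y) = 1 / (2 * y)" by (simp add: field_simps)
    moreover have "ln (1 + 1 / y) \<le> ln \<bar>x\<bar>"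
    proof (rule iffD2[OF ln_le_cancel_iff])
      show "0 < 1 + 1 / y" using iy by linarith
    qed (use x(1) x0 in \<open>simp_all add: y_def\<close>)
    ultimately show "1 / (2 * y) \<le> ln \<bar>x\<bar>" by linarith
    have "\<bar>x\<bar> \<le> y" using hgt_norm_le[OF x(2) v] by (simp add: y_def)
    then show "ln \<bar>x\<bar> \<le> y" using ln_le_minus_one[OF x0] by linarith
  qed
  have la: "1 / (2 * y) \<le> la" "la \<le> y" using ln_bounds[OF \<alpha>] by (auto simp: la_def)
  have lb: "1 / (2 * y) \<le> lb" "lb \<le> y" using ln_bounds[OF \<beta>] by (auto simp: lb_def)
  have la0: "0 < la" and lb0: "0 < lb" using la lb y by (auto intro: less_le_trans[of 0 "1 / (2 * y)"])
  have nz: "\<alpha> \<noteq> 0" "\<beta> \<noteq> 0" using ln_bounds(3)[OF \<alpha>] ln_bounds(3)[OF \<beta>] by auto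
  define \<theta> where "\<theta> = la / lb"
  have \<theta>: "0 < \<theta>" "\<theta> \<le> 2 * y\<^sup>2"
  proof -
    show "0 < \<theta>" using la0 lb0 by (simp add: \<theta>_def)
    have "\<theta> \<le> y / (1 / (2 * y))" unfolding \<theta>_def
      by (rule frac_le) (use la lb y in auto)
    then show "\<theta> \<le> 2 * y\<^sup>2" by (simp add: power2_eq_square)
  qed
  obtain k :: nat and mi :: int where k: "1 \<le> k" "k \<le> N" "\<bar>real k * \<theta> - of_int mi\<bar> \<le> 1 / \<nu>"
    using dirichlet_approximation[OF N, of \<theta>] unfolding \<nu>_def by blast
  have inv\<nu>: "1 / \<nu> \<le> 1" using \<nu>1 by simp
  have k1: "1 \<le> real k" using k(1) by simp
  have "0 \<le> mi"
  proof -
    have "0 < real k * \<theta>" using k1 \<theta> by simp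
    then have "- 1 < real_of_int mi" using k(3) inv\<nu> by linarith
    then show ?thesis by linarith
  qed
  then obtain m' where m': "mi = int m'" using nonneg_int_cases by blast
  have km: "\<bar>real k * \<theta> - real m'\<bar> \<le> 1 / \<nu>" using k(3) by (simp add: m')
  have m'_le: "real m' \<le> 3 * y\<^sup>2 * real k"
  proof -
    have "real m' \<le> real k * \<theta> + 1" using km inv\<nu> by linarith
    also have "\<dots> \<le> real k * (2 * y\<^sup>2) + real k * y\<^sup>2"
      using mult_mono[of 1 "real k" 1 "y\<^sup>2"] k1 yk[of 2] \<theta>(2) by (intro add_mono mult_left_mono) auto
    finally show ?thesis by (simp add: algebra_simps)
  qed
  \<comment> \<open>Even exponents make \<open>a\<close> positive although \<open>\<alpha>\<close>
    and \<open>\<beta>\<close> may be negative.\<close>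
  define a where "a = \<alpha> ^ (2 * k) / \<beta> ^ (2 * m')"
  have a0: "0 < a" using nz by (simp add: a_def power_mult)
  have ln_a: "ln a = 2 * (real k * la - real m' * lb)"
  proof -
    have "a = \<bar>\<alpha>\<bar> ^ (2 * k) / \<bar>\<beta>\<bar> ^ (2 * m')" by (simp add: a_def power_mult)
    then show ?thesis using nz by (simp add: ln_div ln_realpow la_def lb_def algebra_simps)
  qed
  have ln_a_le: "\<bar>ln a\<bar> \<le> 2 * y / \<nu>"
  proof -
    have "ln a = 2 * lb * (real k * \<theta> - real m')" using lb0 by (simp add: ln_a \<theta>_def field_simps)
    then have "\<bar>ln a\<bar> = 2 * lb * \<bar>real k * \<theta> - real m'\<bar>" using lb0 by (simp add: abs_mult)
    also have "\<dots> \<le> 2 * y * (1 / \<nu>)" by (intro mult_mono km) (use lb lb0 y in auto)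
    finally show ?thesis by simp
  qed
  define q r where "q = n div (2 * k)" and "r = n mod (2 * k)"
  have nqr: "n = 2 * k * q + r" by (simp add: q_def r_def)
  have r: "r < 2 * k" using k(1) by (simp add: r_def)
  have n_le: "real n \<le> 2 * \<nu> * (real q + 1)"
  proof -
    have "real n = real (2 * k * q + r)" by (simp only: nqr[symmetric])
    also have "\<dots> \<le> 2 * real k * (real q + 1)" using r by (simp add: algebra_simps)
    also have "\<dots> \<le> 2 * \<nu> * (real q + 1)" by (intro mult_right_mono) (use k(2) in \<open>auto simp: \<nu>_def\<close>)
    finally show ?thesis .
  qed
  have y4: "y ^ 1280 = \<nu> ^ 4" by (simp add: \<nu> flip: power_mult)
  have q_ge: "\<nu>\<^sup>2 \<le> real q"
  proof (rule ccontr)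
    assume "\<not> ?thesis"
    then have "real q + 1 \<le> 2 * \<nu>\<^sup>2" using one_le_power[OF \<nu>1, of 2] by linarith
    then have "real n \<le> 2 * \<nu> * (2 * \<nu>\<^sup>2)" using n_le \<nu>1 by (meson mult_left_mono order_trans zero_le_mult_iff zero_le_numeral order.trans zero_le_one)
    also have "\<dots> = 4 * \<nu> ^ 3" by (simp add: eval_nat_numeral)
    also have "\<dots> < \<nu> * \<nu> ^ 3"
    proof (rule mult_strict_right_mono)
      have "4 < y ^ 1" using y by simp
      also have "\<dots> \<le> \<nu>" unfolding \<nu> by (rule power_increasing) (use y in auto)
      finally show "4 < \<nu>" .
    qed (use \<nu>1 in auto)
    also have "\<dots> = y ^ 1280" using power_Suc[of \<nu> 3] by (simp add: y4)
    also have "\<dots> \<le> real n" using of_nat_mono[OF n, where 'a = real] by (simp add: y_def)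
    finally show False by simp
  qed
  \<comment> \<open>\<open>t\<close> is the natural unit: the logarithms of all the leftovers are
    bounded by \<open>t\<close> times a small power of \<open>y\<close>.\<close>
  define t where "t = real q / \<nu>"
  have t: "\<nu> \<le> t" "1 \<le> t"
  proof -
    show "\<nu> \<le> t" unfolding t_def using q_ge \<nu>1 by (simp add: field_simps power2_eq_square)
    then show "1 \<le> t" using \<nu>1 by linarith
  qed
  have q1: "1 \<le> real q" using q_ge one_le_power[OF \<nu>1, of 2] by linarith
  have n_small: "real n / y ^ 1280 \<le> 4 * t"
  proof -
    have "real n \<le> 2 * \<nu> * (real q + real q)"
      by (rule order_trans[OF n_le]) (use \<nu>1 q1 in \<open>intro mult_left_mono, auto\<close>)
    also have "\<dots> = 4 * t * \<nu> ^ 2" using \<nu>1 by (simp add: t_def power2_eq_square)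
    also have "\<dots> \<le> 4 * t * \<nu> ^ 4" by (intro mult_left_mono power_increasing) (use t \<nu>1 in auto)
    finally show ?thesis using \<nu>1 by (simp add: y4 field_simps)
  qed
  have r_le: "real r \<le> 2 * t"
  proof -
    have "r \<le> 2 * N" using r k(2) by linarith
    then have "real r \<le> 2 * \<nu>" using of_nat_mono[of r "2 * N", where 'a = real] by (simp add: \<nu>_def)
    then show ?thesis using t by linarith
  qed
  define A where "A = (w * of_real \<beta> ^ m) / (u * (of_real \<beta> ^ (2 * m' * q) * of_real \<alpha> ^ r))"
  have A_approx: "norm (A - of_real (a ^ q)) \<le> exp (- (real n / y)) * a ^ q"
  proof -
    have aq: "of_real (a ^ q) = (u * of_real \<alpha> ^ n) / (u * (of_real \<beta> ^ (2 * m' * q) * of_real \<alpha> ^ r) :: complex)"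
      using u(2) nz by (simp add: a_def nqr power_add power_divide flip: power_mult)
    have "A - of_real (a ^ q) = - (u * of_real \<alpha> ^ n - w * of_real \<beta> ^ m) / (u * (of_real \<beta> ^ (2 * m' * q) * of_real \<alpha> ^ r))"
      unfolding A_def aq by (simp add: diff_divide_distrib)
    then have "norm (A - of_real (a ^ q)) = norm (u * of_real \<alpha> ^ n - w * of_real \<beta> ^ m) / norm (u * (of_real \<beta> ^ (2 * m' * q) * of_real \<alpha> ^ r))"
      by (simp only: norm_divide norm_minus_cancel)
    also have "\<dots> \<le> exp (- (real n / y)) * norm (u * of_real \<alpha> ^ n) / norm (u * (of_real \<beta> ^ (2 * m' * q) * of_real \<alpha> ^ r))"
      by (intro divide_right_mono) (use approx in \<open>auto simp: y_def\<close>)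
    also have "\<dots> = exp (- (real n / y)) * norm (of_real (a ^ q) :: complex)"
      unfolding aq norm_divide by simp
    also have "norm (of_real (a ^ q) :: complex) = a ^ q" using a0 by (simp only: norm_of_real abs_of_pos zero_less_power)
    finally show ?thesis .
  qed
  have A0: "A \<noteq> 0" using w(2) u(2) nz by (simp add: A_def)
  have ln_A: "\<bar>ln (norm A)\<bar> \<le> 3 * y * t"
  proof -
    have e: "exp (- (real n / y)) \<le> 1 / 2"
    proof -
      have "y ^ 2 \<le> y ^ 1280" by (rule power_increasing) (use y in auto)
      also have "\<dots> \<le> real n" using of_nat_mono[OF n, where 'a = real] by (simp add: y_def)
      finally have "y \<le> real n / y" using y by (simp add: field_simps power2_eq_square)
      then have "2 \<le> 1 + real n / y" using y by linarith
      also have "\<dots> \<le> exp (real n / y)" by (rule exp_ge_add_one_self)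
      finally show ?thesis by (simp add: exp_minus field_simps)
    qed
    have aq: "0 < a ^ q" using a0 by simp
    have "norm (A - of_real (a ^ q)) \<le> 1 / 2 * a ^ q"
      using A_approx mult_right_mono[OF e less_imp_le[OF aq]] by linarith
    then have "norm A \<le> 2 * a ^ q" "a ^ q / 2 \<le> norm A"
      using norm_triangle_ineq2[of A "of_real (a ^ q)"] norm_triangle_ineq3[of A "of_real (a ^ q)"] aq
      by (auto simp: norm_of_real simp del: of_real_power)
    then have "ln (norm A) \<le> ln (2 * a ^ q)" "ln (a ^ q / 2) \<le> ln (norm A)"
      using A0 aq by (auto simp: ln_le_cancel_iff)
    then have "ln (norm A) \<le> ln 2 + real q * ln a" "real q * ln a - ln 2 \<le> ln (norm A)"
      using aq a0 by (auto simp: ln_mult ln_div ln_realpow)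
    moreover have "ln (2::real) \<le> 1" using ln_le_minus_one[of 2] by simp
    moreover have "real q * \<bar>ln a\<bar> \<le> 2 * y * t"
      using mult_left_mono[OF ln_a_le, of "real q"] by (simp add: t_def mult_ac)
    then have "\<bar>real q * ln a\<bar> \<le> 2 * y * t" by (simp add: abs_mult)
    moreover have "1 \<le> y * t" using mult_mono[of 1 y 1 t] y t by simp
    ultimately show ?thesis by linarith
  qed
  have lnu: "\<bar>ln (norm u)\<bar> \<le> 4 * y * t" and lnw: "\<bar>ln (norm w)\<bar> \<le> 4 * y * t"
  proof -
    have d: "real d \<le> y" using Y(2) by (simp add: y_def)
    have *: "real d * (real n / real Y ^ 1280) \<le> 4 * y * t"
      using mult_mono[OF d n_small] t y unfolding y_def[symmetric] by (simp add: mult_ac)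
    show "\<bar>ln (norm u)\<bar> \<le> 4 * y * t" using hgt_abs_ln_le[OF u(1) v _ u(2)] * by simp
    show "\<bar>ln (norm w)\<bar> \<le> 4 * y * t" using hgt_abs_ln_le[OF w(1) v _ w(2)] * by simp
  qed
  \<comment> \<open>Take logarithms in the definition of \<open>A\<close>:
    \<open>13 = 3 + 4 + 4 + 2\<close> stems from \<open>A\<close>, \<open>w\<close>,
    \<open>u\<close> and \<open>\<alpha> ^ r\<close>, and dividing by
    \<open>lb \<ge> 1 / (2 * y)\<close> doubles it to 26.\<close>
  have shift: "\<bar>real m - real (2 * m' * q)\<bar> \<le> 26 * y ^ 2 * t"
  proof -
    have "norm A = norm w * \<bar>\<beta>\<bar> ^ m / (norm u * (\<bar>\<beta>\<bar> ^ (2 * m' * q) * \<bar>\<alpha>\<bar> ^ r))"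
      by (simp add: A_def norm_mult norm_divide norm_power)
    then have "ln (norm A) = ln (norm w) + real m * lb - (ln (norm u) + (real (2 * m' * q) * lb + real r * la))"
      using u(2) w(2) nz by (simp add: ln_mult ln_div ln_realpow la_def lb_def)
    then have "(real m - real (2 * m' * q)) * lb = ln (norm A) - ln (norm w) + ln (norm u) + real r * la"
      by (simp add: algebra_simps)
    moreover have "real r * la \<le> (2 * t) * y" by (intro mult_mono r_le) (use la la0 t in auto)
    then have "real r * la \<le> 2 * y * t" by (simp add: mult_ac)
    moreover have "0 \<le> real r * la" using la0 by simp
    ultimately have "\<bar>(real m - real (2 * m' * q)) * lb\<bar> \<le> 13 * y * t"
      using ln_A lnu lnw by linarith
    then have "\<bar>real m - real (2 * m' * q)\<bar> * lb \<le> 13 * y * t" using lb0 by (simp add: abs_mult)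
    moreover have "\<bar>real m - real (2 * m' * q)\<bar> * (1 / (2 * y)) \<le> \<bar>real m - real (2 * m' * q)\<bar> * lb"
      by (rule mult_left_mono[OF lb(1)]) simp
    ultimately have "\<bar>real m - real (2 * m' * q)\<bar> * (1 / (2 * y)) \<le> 13 * y * t" by linarith
    then show ?thesis using y by (simp add: field_simps power2_eq_square)
  qed
  have pw: "hgt d v (exp (y * real j)) (of_real x ^ j)" if "hgt d v (real Y) (of_real x)" for x :: real and j
  proof -
    have "real Y \<le> exp y" using exp_ge_add_one_self[of y] unfolding y_def by linarith
    then have "hgt d v (exp y) (of_real x)" using that hgt_mono by blast
    from hgt_power[OF this, of j] show ?thesis by (simp add: exp_of_nat2_mult)
  qed
  define Z where "Z = Y ^ 4"
  have Z: "real Z = y ^ 4" by (simp add: Z_def y_def)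
  have h: "4 * t + y * (26 * y ^ 2 * t) + y * (2 * t) \<le> real Z * real q / real Z ^ 80"
  proof -
    have "real Z * real q / real Z ^ 80 = y ^ 4 * t" by (simp add: Z t_def \<nu> flip: power_mult)
    moreover have "4 * t + y * (26 * y ^ 2 * t) + y * (2 * t) \<le> (4 * y ^ 3 + 26 * y ^ 3 + 2 * y ^ 3) * t"
    proof -
      have "y ^ 1 \<le> y ^ 3" by (rule power_increasing) (use y in auto)
      then have "4 * t \<le> 4 * y ^ 3 * t" "y * (2 * t) \<le> 2 * y ^ 3 * t"
        using yk[of 3] t by (auto intro!: mult_right_mono simp: mult_ac)
      moreover have "y * (26 * y ^ 2 * t) = 26 * y ^ 3 * t" by (simp add: eval_nat_numeral)
      ultimately show ?thesis by (simp only: distrib_right)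
    qed
    moreover have "(4 * y ^ 3 + 26 * y ^ 3 + 2 * y ^ 3) * t \<le> y ^ 4 * t"
    proof (rule mult_right_mono)
      have "32 * y ^ 3 \<le> y * y ^ 3" by (rule mult_right_mono) (use y in auto)
      then show "4 * y ^ 3 + 26 * y ^ 3 + 2 * y ^ 3 \<le> y ^ 4" by (simp add: eval_nat_numeral)
    qed (use t in simp)
    ultimately show ?thesis by linarith
  qed
  \<comment> \<open>Truncated subtraction moves the power of \<open>\<beta>\<close> to the numerator
    or the denominator according to the sign of the shift; the other exponent is 0.\<close>
  define A1 where "A1 = w * of_real \<beta> ^ (m - 2 * m' * q)"
  define A2 where "A2 = u * (of_real \<beta> ^ (2 * m' * q - m) * of_real \<alpha> ^ r)"
  have A: "A = A1 / A2"
  proof (cases "2 * m' * q \<le> m")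
    case True
    then have "complex_of_real \<beta> ^ m = of_real \<beta> ^ (m - 2 * m' * q) * of_real \<beta> ^ (2 * m' * q)"
      by (simp flip: power_add)
    then show ?thesis using True nz u(2) by (simp add: A_def A1_def A2_def)
  next
    case False
    then have "complex_of_real \<beta> ^ (2 * m' * q) = of_real \<beta> ^ (2 * m' * q - m) * of_real \<beta> ^ m"
      by (simp flip: power_add)
    then show ?thesis using False nz u(2) by (simp add: A_def A1_def A2_def)
  qed
  have sh1: "y * real (m - 2 * m' * q) \<le> y * (26 * y ^ 2 * t)" "y * real (2 * m' * q - m) \<le> y * (26 * y ^ 2 * t)"
    using shift y t by (auto intro!: mult_left_mono simp: of_nat_diff_if)
  have hw: "hgt d v (exp (4 * t)) w" "hgt d v (exp (4 * t)) u"
    using hgt_mono[OF w(1), of "exp (4 * t)"] hgt_mono[OF u(1), of "exp (4 * t)"] n_small by (auto simp: y_def)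
  show False
  proof (rule two_logs[of Z d k q i0 v a "of_real \<alpha> ^ (2 * k)" "of_real \<beta> ^ (2 * m')" A A1 A2])
    have YZ: "Y \<le> Z" unfolding Z_def by (rule self_le_power) (use Y in auto)
    show "1000 \<le> Z" "d + 1 \<le> Z" using YZ Y by linarith+
    show "1 \<le> k" by (rule k(1))
    show "Z ^ 70 \<le> q"
    proof -
      have "real (Z ^ 70) = y ^ 280" by (simp add: Z flip: power_mult)
      also have "\<dots> \<le> y ^ 640" by (rule power_increasing) (use y in auto)
      also have "\<dots> = \<nu>\<^sup>2" by (simp add: \<nu> flip: power_mult)
      also have "\<dots> \<le> real q" by (rule q_ge)
      finally show ?thesis by (simp only: of_nat_le_iff)
    qed
    show "i0 < d" "v i0 \<noteq> 0" by (rule v)+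
    show "0 < a" by (rule a0)
    \<comment> \<open>Independence enters here: \<open>a = 1\<close> would be a relation between
      \<open>\<alpha>\<close> and \<open>\<beta>\<close> with positive exponent
      \<open>2 * k\<close>.\<close>
    show "a \<noteq> 1"
    proof
      assume "a = 1"
      then have "\<alpha> ^ (2 * k) = \<beta> ^ (2 * m')" using nz by (simp add: a_def)
      then show False using indep[of "2 * k" "2 * m'"] k(1) by simp
    qed
    show "complex_of_real a = of_real \<alpha> ^ (2 * k) / of_real \<beta> ^ (2 * m')" by (simp add: a_def)
    show "complex_of_real \<beta> ^ (2 * m') \<noteq> 0" using nz by simp
    show "A = A1 / A2" by (rule A)
    show "A1 \<noteq> 0" using w(2) nz by (simp add: A1_def)
    show "A2 \<noteq> 0" using u(2) nz by (simp add: A2_def)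
    show "hgt d v (exp (real Z * real k)) (of_real \<alpha> ^ (2 * k))"
    proof (rule hgt_mono[OF pw[OF \<alpha>(2)]])
      have "y * 2 \<le> y * y ^ 3" using power_increasing[of 1 3 y] y by (intro mult_left_mono) auto
      then have "y * 2 * real k \<le> y ^ 4 * real k" by (intro mult_right_mono) (auto simp: eval_nat_numeral)
      then show "exp (y * real (2 * k)) \<le> exp (real Z * real k)" by (simp add: Z)
    qed
    show "hgt d v (exp (real Z * real k)) (of_real \<beta> ^ (2 * m'))"
    proof (rule hgt_mono[OF pw[OF \<beta>(2)]])
      have "y * real (2 * m') \<le> y * (2 * (3 * y\<^sup>2 * real k))" using m'_le y by (intro mult_left_mono) (auto simp: mult_ac)
      also have "\<dots> = 6 * y ^ 3 * real k" by (simp add: eval_nat_numeral)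
      also have "\<dots> \<le> y * y ^ 3 * real k" by (intro mult_right_mono) (use y in auto)
      finally show "exp (y * real (2 * m')) \<le> exp (real Z * real k)" by (simp add: Z eval_nat_numeral)
    qed
    have yr: "y * real r \<le> y * (2 * t)" by (intro mult_left_mono r_le) (use y in auto)
    have nn: "0 \<le> y * (26 * y ^ 2 * t)" "0 \<le> y * (2 * t)" using y t by auto
    show "hgt d v (exp (real Z * real q / real Z ^ 80)) A1"
      unfolding A1_def
    proof (rule hgt_mono[OF hgt_mult[OF hw(1) pw[OF \<beta>(2)]]])
      have "4 * t + y * real (m - 2 * m' * q) \<le> real Z * real q / real Z ^ 80" using sh1(1) h nn by linarith
      then show "exp (4 * t) * exp (y * real (m - 2 * m' * q)) \<le> exp (real Z * real q / real Z ^ 80)"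
        unfolding exp_add[symmetric] exp_le_cancel_iff .
    qed
    show "hgt d v (exp (real Z * real q / real Z ^ 80)) A2"
      unfolding A2_def
    proof (rule hgt_mono[OF hgt_mult[OF hw(2) hgt_mult[OF pw[OF \<beta>(2)] pw[OF \<alpha>(2)]]]])
      have "4 * t + (y * real (2 * m' * q - m) + y * real r) \<le> real Z * real q / real Z ^ 80"
        using sh1(2) h yr by linarith
      then show "exp (4 * t) * (exp (y * real (2 * m' * q - m)) * exp (y * real r)) \<le> exp (real Z * real q / real Z ^ 80)"
        unfolding exp_add[symmetric] exp_le_cancel_iff .
    qed
    show "\<bar>ln a\<bar> \<le> real Z / real Z ^ 80"
    proof -
      have "2 * y \<le> y ^ 4"
      proof -
        have "2 * y \<le> y ^ 3 * y" using power_increasing[of 1 3 y] y by (intro mult_right_mono) auto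
        then show ?thesis by (simp add: eval_nat_numeral)
      qed
      then have "2 * y / \<nu> \<le> y ^ 4 / \<nu>" using \<nu>1 by (intro divide_right_mono) auto
      also have "\<dots> = real Z / real Z ^ 80" by (simp add: Z \<nu> flip: power_mult)
      finally show ?thesis using ln_a_le by linarith
    qed
    have "real k * real q / real Z \<le> real n / y"
    proof -
      have "real k * real q \<le> real n" using nqr by (simp flip: of_nat_mult)
      moreover have "y \<le> real Z" using YZ by (simp add: y_def)
      ultimately show ?thesis by (intro frac_le) (use y in auto)
    qed
    then have "exp (- (real n / y)) * a ^ q \<le> exp (- (real k * real q / real Z)) * a ^ q"
      using a0 by (intro mult_right_mono) auto
    then show "norm (A - of_real (a ^ q)) \<le> exp (- (real k * real q / real Z)) * a ^ q"
      using A_approx by linarith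
  qed
qed

section \<open>Isolating the contribution of one root\<close>

text \<open>The polynomial \<open>p\<close> in the shift operator, applied to the sequence
  \<open>u\<close>. Products of polynomials act as compositions, see
  \<open>opE_mult\<close>.\<close>

definition opE :: "complex poly \<Rightarrow> (nat \<Rightarrow> complex) \<Rightarrow> nat \<Rightarrow> complex" where
  "opE p u n = (\<Sum>i\<le>degree p. coeff p i * u (n + i))"

lemma opE_eq_sum:
  assumes "degree p \<le> N"
  shows "opE p u n = (\<Sum>i\<le>N. coeff p i * u (n + i))"
  unfolding opE_def by (rule sum.mono_neutral_left) (use assms in \<open>auto simp: coeff_eq_0\<close>)

lemma opE_0 [simp]: "opE 0 u n = 0"
  by (simp add: opE_def)

lemma opE_pCons: "opE (pCons a p) u n = a * u n + opE p u (n + 1)"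
proof -
  have "opE (pCons a p) u n = (\<Sum>i\<le>Suc (degree p). coeff (pCons a p) i * u (n + i))"
    by (rule opE_eq_sum) (rule degree_pCons_le)
  also have "\<dots> = a * u n + (\<Sum>i\<le>degree p. coeff p i * u (n + Suc i))"
    by (subst sum.atMost_Suc_shift) simp
  finally show ?thesis by (simp add: opE_def)
qed

lemma opE_add: "opE (p + q) u n = opE p u n + opE q u n"
proof -
  let ?N = "max (degree p) (degree q)"
  show ?thesis
    by (subst (1 2 3) opE_eq_sum[of _ ?N]) (auto simp: degree_add_le algebra_simps sum.distrib)
qed

lemma opE_smult: "opE (Polynomial.smult c p) u n = c * opE p u n"
  by (subst (1 2) opE_eq_sum[of _ "degree p"]) (auto simp: degree_smult_le sum_distrib_left mult.assoc)

lemma opE_diff: "opE (p - q) u n = opE p u n - opE q u n"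
  using opE_add[of "p - q" q u n] by simp

lemma opE_sum: "opE (\<Sum>i\<in>I. p i) u n = (\<Sum>i\<in>I. opE (p i) u n)"
  by (induction I rule: infinite_finite_induct) (auto simp: opE_add)

lemma opE_mult: "opE (p * q) u n = opE p (opE q u) n"
proof (induction p arbitrary: n)
  case (pCons a p)
  have "opE (pCons a p * q) u n = opE (Polynomial.smult a q) u n + opE (pCons 0 (p * q)) u n"
    by (simp add: opE_add)
  also have "\<dots> = a * opE q u n + opE p (opE q u) (n + 1)"
    by (simp add: opE_smult opE_pCons pCons.IH)
  finally show ?case by (simp add: opE_pCons)
qed simp

lemma opE_1 [simp]: "opE 1 u n = u n"
  by (simp add: one_pCons opE_pCons)

lemma opE_const [simp]: "opE [:c:] u n = c * u n"
  by (simp add: opE_pCons)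

lemma opE_linear [simp]: "opE [:- r, 1:] u n = u (n + 1) - r * u n"
  by (simp add: opE_pCons)

lemma opE_monom_1: "opE (monom 1 k) u n = u (n + k)"
  by (induction k arbitrary: n) (auto simp: monom_Suc opE_pCons)

lemma opE_zero_seq: "(\<And>n. u n = 0) \<Longrightarrow> opE p u n = 0"
  by (simp add: opE_def)

lemma opE_seq_sum: "opE p (\<lambda>n. \<Sum>i\<in>I. u i n) n = (\<Sum>i\<in>I. opE p (u i) n)"
  unfolding opE_def by (simp add: sum_distrib_left) (rule sum.swap)

lemma opE_seq_mult: "opE p (\<lambda>n. c * u n) n = c * opE p u n"
  unfolding opE_def by (simp add: sum_distrib_left mult_ac)

lemma opE_dvd_zero:
  assumes "q dvd p" "\<And>n. opE q u n = 0"
  shows "opE p u n = 0"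
proof -
  obtain s where "p = s * q" using assms(1) by (metis dvd_def mult.commute)
  then show ?thesis using assms(2) by (simp add: opE_mult opE_zero_seq)
qed

lemma degree_forward_difference:
  fixes p :: "complex poly"
  assumes "0 < degree p"
  shows "degree (pcompose p [:1, 1:] - p) < degree p"
proof (cases "pcompose p [:1, 1:] - p = 0")
  case False
  let ?q = "pcompose p [:1, 1:]"
  have d: "degree ?q = degree p" by simp
  have "coeff ?q (degree p) = coeff p (degree p)"
    using lead_coeff_comp[of "[:1, 1:]" p] by simp
  then have "coeff (?q - p) (degree p) = 0" by simp
  then show ?thesis using False d
    by (metis assms degree_diff_le eq_zero_or_degree_less less_le_not_le linorder_not_le order_refl)
qed (use assms in simp)

text \<open>One application of \<open>[:- r, 1:]\<close> replaces \<open>p\<close> by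
  \<open>r\<close> times its forward difference. This lowers the degree, and a constant is killed at
  once.\<close>

lemma opE_annihilates:
  assumes "degree p < j"
  shows "opE ([:- r, 1:] ^ j) (\<lambda>n. poly p (of_nat n) * r ^ n) n = 0"
  using assms
proof (induction j arbitrary: p n)
  case (Suc j)
  define q where "q = Polynomial.smult r (pcompose p [:1, 1:] - p)"
  have "opE [:- r, 1:] (\<lambda>n. poly p (of_nat n) * r ^ n) = (\<lambda>n. poly q (of_nat n) * r ^ n)"
    by (rule ext) (simp add: q_def poly_pcompose algebra_simps)
  then have step: "opE ([:- r, 1:] ^ Suc j) (\<lambda>n. poly p (of_nat n) * r ^ n) n
      = opE ([:- r, 1:] ^ j) (\<lambda>n. poly q (of_nat n) * r ^ n) n"
    unfolding power_Suc2 opE_mult by simp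
  show ?case
  proof (cases "degree p = 0")
    case True
    then obtain c where "p = [:c:]" by (metis degree_eq_zeroE)
    then have "q = 0" by (simp add: q_def)
    then show ?thesis unfolding step by (simp add: opE_zero_seq)
  next
    case False
    then have "degree q < degree p"
      unfolding q_def using degree_forward_difference[of p] degree_smult_le le_less_trans by blast
    then show ?thesis unfolding step using Suc by simp
  qed
qed simp

text \<open>The polynomial \<open>([:poly Q r:] - Q) ^ s\<close> is divisible by \<open>(X - r) ^ s\<close> and is congruent to a
  constant modulo \<open>Q\<close>; applied to the sequence it isolates the contribution of the root \<open>r\<close>.\<close>

lemma isolate_root:
  assumes exp: "root_expansion cs U a" and f: "characteristic_poly cs = [:- r, 1:] ^ s * Q"
    and Q: "poly Q r \<noteq> 0" and nz: "characteristic_poly cs \<noteq> 0" and s: "0 < s"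
  shows "opE (([:poly Q r:] - Q) ^ s) (\<lambda>n. of_int (U n)) n
    = poly Q r ^ s * (of_int (U n) - poly (a r) (of_nat n) * r ^ n)"
proof -
  let ?f = "characteristic_poly cs" and ?D = "poly Q r"
  define G where "G = [:?D:] - Q"
  define Z where "Z = {x. poly ?f x = 0}"
  have finZ: "finite Z" unfolding Z_def by (rule poly_roots_finite[OF nz])
  have rZ: "r \<in> Z" using s by (simp add: Z_def f)
  define w where "w x n = poly (a x) (of_nat n) * x ^ n" for x n
  have deg: "degree (a x) < Polynomial.order x ?f" if "x \<in> Z" for x
  proof -
    have "Polynomial.order x ?f \<noteq> 0" using that nz order_root by (auto simp: Z_def)
    moreover have "degree (a x) \<le> Polynomial.order x ?f - 1"
      using exp that unfolding root_expansion_def Z_def by blast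
    ultimately show ?thesis by linarith
  qed
  have Un: "of_int (U n) = (\<Sum>x\<in>Z. w x n)" for n
    using exp unfolding root_expansion_def Z_def w_def by blast
  have Q0: "Q \<noteq> 0" using nz f by auto
  have ord_r: "Polynomial.order r ?f = s"
  proof -
    have "Polynomial.order r ?f = Polynomial.order r ([:- r, 1:] ^ s) + Polynomial.order r Q"
      unfolding f by (rule order_mult) (use nz f in auto)
    moreover have "Polynomial.order r Q = 0" using Q by (simp add: order_0I)
    ultimately show ?thesis by (simp add: order_power_n_n)
  qed
  have other: "opE (G ^ j) (w x) n = ?D ^ j * w x n" if x: "x \<in> Z" "x \<noteq> r" for x j n
  proof -
    have "Polynomial.order x ?f = Polynomial.order x ([:- r, 1:] ^ s) + Polynomial.order x Q"
      unfolding f by (rule order_mult) (use nz f in auto)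
    moreover have "Polynomial.order x ([:- r, 1:] ^ s) = 0" using x by (intro order_0I) simp
    \<comment> \<open>\<open>Q\<close> carries the full multiplicity of every root other than
      \<open>r\<close>, hence annihilates the contribution of that root.\<close>
    ultimately have "[:- x, 1:] ^ Polynomial.order x ?f dvd Q" using order_1[of x Q] by simp
    moreover have "opE ([:- x, 1:] ^ Polynomial.order x ?f) (w x) n = 0" for n
      unfolding w_def by (rule opE_annihilates[OF deg[OF x(1)]])
    ultimately have "opE Q (w x) n = 0" for n by (rule opE_dvd_zero)
    then have G: "opE G (w x) = (\<lambda>n. ?D * w x n)" by (intro ext) (simp add: G_def opE_diff)
    show ?thesis
    proof (induction j)
      case (Suc j)
      have "opE (G ^ Suc j) (w x) n = opE (G ^ j) (\<lambda>n. ?D * w x n) n"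
        unfolding power_Suc2 opE_mult G ..
      also have "\<dots> = ?D * (?D ^ j * w x n)" unfolding opE_seq_mult Suc ..
      finally show ?case by simp
    qed simp
  qed
  have self: "opE (G ^ s) (w r) n = 0" for n
  proof (rule opE_dvd_zero)
    have "poly G r = 0" by (simp add: G_def)
    then have "[:- r, 1:] dvd G" by (simp add: poly_eq_0_iff_dvd)
    then show "[:- r, 1:] ^ s dvd G ^ s" by (rule dvd_power_same)
    show "opE ([:- r, 1:] ^ s) (w r) n = 0" for n
      unfolding w_def by (rule opE_annihilates) (use deg[OF rZ] ord_r in simp)
  qed
  have "opE (G ^ s) (\<lambda>n. of_int (U n)) n = (\<Sum>x\<in>Z. opE (G ^ s) (w x) n)"
    unfolding Un by (rule opE_seq_sum)
  also have "\<dots> = (\<Sum>x\<in>Z - {r}. ?D ^ s * w x n)"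
    using sum.remove[OF finZ rZ, of "\<lambda>x. opE (G ^ s) (w x) n"] self other by simp
  also have "\<dots> = ?D ^ s * ((\<Sum>x\<in>Z. w x n) - w r n)"
    using sum.remove[OF finZ rZ, of "\<lambda>x. w x n"] by (simp add: sum_distrib_left)
  finally show ?thesis by (simp only: G_def Un w_def)
qed

text \<open>Expand the \<open>n\<close>-fold shift as \<open>((X - r) + r) ^ n\<close>. If
  \<open>u n\<close> is \<open>r ^ n\<close> times a polynomial in \<open>n\<close> of degree below
  \<open>s\<close>, the terms with \<open>j \<ge> s\<close> vanish, which gives the polynomial in
  the binomial basis.\<close>

lemma newton_shift:
  "u n = (\<Sum>j\<le>n. of_nat (n choose j) * r ^ (n - j) * opE ([:- r, 1:] ^ j) u 0)"
proof -
  have "monom 1 n = ([:- r, 1:] + [:r:]) ^ n"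
    by (simp add: monom_altdef)
  also have "\<dots> = (\<Sum>j\<le>n. of_nat (n choose j) * [:- r, 1:] ^ j * [:r:] ^ (n - j))"
    by (rule binomial_ring)
  also have "\<dots> = (\<Sum>j\<le>n. Polynomial.smult (of_nat (n choose j) * r ^ (n - j)) ([:- r, 1:] ^ j))"
  proof (rule sum.cong[OF refl])
    fix j
    have "[:r:] ^ (n - j) = [:r ^ (n - j):]" by (simp add: poly_const_pow)
    then show "of_nat (n choose j) * [:- r, 1:] ^ j * [:r:] ^ (n - j)
      = Polynomial.smult (of_nat (n choose j) * r ^ (n - j)) ([:- r, 1:] ^ j)"
      by (simp add: of_nat_poly mult_ac)
  qed
  finally have "u n = opE (\<Sum>j\<le>n. Polynomial.smult (of_nat (n choose j) * r ^ (n - j)) ([:- r, 1:] ^ j)) u 0"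
    using opE_monom_1[of n u 0] by simp
  then show ?thesis by (simp only: opE_sum opE_smult)
qed

lemma one_le_mult_real: "1 \<le> a \<Longrightarrow> 1 \<le> b \<Longrightarrow> 1 \<le> a * (b::real)"
  using mult_mono[of 1 a 1 b] by simp

text \<open>Horner's scheme run from the top coefficient downwards. No division occurs, so heights
  of the cofactor stay under control.\<close>

lemma synthetic_division_coeff:
  fixes r :: complex
  assumes "p = [:- r, 1:] * h" "degree p \<le> k"
  shows "coeff h i = (\<Sum>j\<le>k. r ^ j * coeff p (i + 1 + j))"
proof -
  have c: "coeff p (Suc m) = coeff h m - r * coeff h (Suc m)" for m
    unfolding assms(1) by (simp add: mult_pCons_left)
  have "(\<Sum>j\<le>m. r ^ j * coeff p (i + 1 + j)) = coeff h i - r ^ Suc m * coeff h (i + Suc m)" for m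
    by (induction m) (simp_all add: c algebra_simps)
  moreover have "coeff h (i + Suc k) = 0"
  proof (cases "h = 0")
    case False
    then have "degree p = Suc (degree h)" unfolding assms(1) by (subst degree_mult_eq) auto
    then show ?thesis using assms(2) by (intro coeff_eq_0) simp
  qed simp
  ultimately show ?thesis by simp
qed

lemma hgt_synthetic_division:
  assumes "p = [:- r, 1:] ^ m * h" "degree p \<le> k" "\<And>i. hgt d v F (coeff p i)" "hgt d v B r" "1 \<le> B" "0 \<le> F"
  shows "hgt d v (((real k + 1) * B ^ k) ^ m * F) (coeff h i)"
  using assms(1-3,6)
proof (induction m arbitrary: p F i)
  case (Suc m)
  define g where "g = [:- r, 1:] ^ m * h"
  have pg: "p = [:- r, 1:] * g" using Suc.prems(1) by (simp only: g_def power_Suc mult.assoc)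
  have dg: "degree g \<le> k"
  proof (cases "g = 0")
    case False
    then have "degree p = Suc (degree g)" unfolding pg by (subst degree_mult_eq) auto
    then show ?thesis using Suc.prems(2) by simp
  qed simp
  have "hgt d v (((real k + 1) * B ^ k) * F) (coeff g j)" for j
  proof (rule hgt_mono)
    show "hgt d v (\<Sum>i\<le>k. B ^ i * F) (coeff g j)"
      unfolding synthetic_division_coeff[OF pg Suc.prems(2)]
      by (intro hgt_sum hgt_mult hgt_power assms(4) Suc.prems(3)) simp
    have "(\<Sum>i\<le>k. B ^ i * F) \<le> (\<Sum>i\<le>k. B ^ k * F)"
      by (intro sum_mono mult_right_mono power_increasing) (use assms(5) Suc.prems(4) in auto)
    then show "(\<Sum>i\<le>k. B ^ i * F) \<le> ((real k + 1) * B ^ k) * F" by (simp add: algebra_simps)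
  qed
  from Suc.IH[OF g_def dg this] show ?case using Suc.prems(4) assms(5) by (simp add: mult_ac)
qed simp

text \<open>Height bounds, with \<open>X\<close> bounding the order, the coefficients and the initial values:
  \<open>bQ\<close> for the cofactor \<open>Q\<close> of \<open>(X - r) ^ s\<close> in the characteristic polynomial, \<open>bD\<close> for \<open>poly Q r\<close>,
  \<open>bE\<close> and \<open>bF\<close> for the Newton coefficients of the polynomial attached to \<open>r\<close>, \<open>bG\<close> for its growth.\<close>

definition bQ :: "nat \<Rightarrow> nat" where "bQ X = X * (X ^ (2 * X + 2)) ^ X"
definition bD :: "nat \<Rightarrow> nat" where "bD X = bQ X * X ^ (2 * X + 2)"
definition bE :: "nat \<Rightarrow> nat" where "bE X = 2 * (X ^ (2 * X + 3) * bD X) ^ X"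
definition bF :: "nat \<Rightarrow> nat" where "bF X = X ^ (5 * X + 1) * bE X"
definition bG :: "nat \<Rightarrow> nat" where "bG X = bF X ^ X * X * bF X"

section \<open>Heights of the polynomial attached to a characteristic root\<close>

locale rec_seq =
  fixes cs :: "int list" and U :: "nat \<Rightarrow> int" and a :: "complex \<Rightarrow> complex poly" and X :: nat
  assumes rec: "linear_recurrence cs U" and expansion: "root_expansion cs U a"
    and X2: "2 \<le> X" and len: "length cs \<le> X"
    and cs_le: "\<And>i. i < length cs \<Longrightarrow> \<bar>cs ! i\<bar> \<le> int X"
    and U_le: "\<And>i. i < length cs \<Longrightarrow> \<bar>U i\<bar> \<le> int X"
begin

abbreviation "f \<equiv> characteristic_poly cs"
abbreviation "k \<equiv> length cs"
abbreviation "x \<equiv> real X"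

lemma k_pos: "0 < k"
  using rec unfolding linear_recurrence_def by simp

lemma x2: "2 \<le> x" "1 \<le> x"
  using X2 by auto

lemma xk: "real k \<le> x"
  using len by simp

lemma coeff_f: "coeff f j = (if j = k then 1 else if j < k then - of_int (cs ! (k - 1 - j)) else 0)"
proof -
  have "(\<Sum>i<k. coeff (monom (of_int (cs ! i) :: complex) (k - 1 - i)) j)
      = (\<Sum>i<k. if i = k - 1 - j \<and> j < k then of_int (cs ! (k - 1 - j)) else 0)"
    by (rule sum.cong) auto
  also have "\<dots> = (if j < k then of_int (cs ! (k - 1 - j)) else 0)"
    by (cases "j < k") auto
  finally show ?thesis unfolding characteristic_poly_def by (simp add: coeff_sum)
qed

lemma degree_f: "degree f = k"
  by (rule antisym) (auto intro!: degree_le le_degree simp: coeff_f)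

lemma f_nz: "f \<noteq> 0"
  using coeff_f[of k] by auto

lemma root_eq:
  assumes "poly f r = 0"
  shows "r ^ k = (\<Sum>j<k. of_int (cs ! (k - 1 - j)) * r ^ j)"
proof -
  have "0 = (\<Sum>j\<le>k. coeff f j * r ^ j)" using assms by (simp add: poly_altdef degree_f)
  also have "\<dots> = (\<Sum>j<k. coeff f j * r ^ j) + r ^ k"
    by (simp add: coeff_f flip: lessThan_Suc_atMost)
  also have "(\<Sum>j<k. coeff f j * r ^ j) = - (\<Sum>j<k. of_int (cs ! (k - 1 - j)) * r ^ j)"
    unfolding sum_negf[symmetric] by (rule sum.cong) (auto simp: coeff_f)
  finally show ?thesis by simp
qed

lemma root_nz: "poly f r = 0 \<Longrightarrow> r \<noteq> 0"
proof
  assume "poly f r = 0" "r = 0"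
  then have "coeff f 0 = 0" by (simp add: poly_0_coeff_0)
  then have "cs ! (k - 1) = 0" using k_pos by (simp add: coeff_f)
  then have "last cs = 0" using k_pos by (simp add: last_conv_nth)
  then show False using rec unfolding linear_recurrence_def by simp
qed

lemma hgt_root:
  assumes "poly f r = 0"
  shows "hgt k (\<lambda>i. r ^ i) (x\<^sup>2) r"
proof (rule hgt_companion[OF k_pos root_eq[OF assms]])
  show "1 \<le> x\<^sup>2" using x2 by simp
  have "(\<Sum>i<k. \<bar>real_of_int (cs ! (k - 1 - i))\<bar>) \<le> (\<Sum>i<k. x)"
  proof (rule sum_mono)
    fix i assume "i \<in> {..<k}"
    then have "\<bar>cs ! (k - 1 - i)\<bar> \<le> int X" by (intro cs_le) auto
    then show "\<bar>real_of_int (cs ! (k - 1 - i))\<bar> \<le> x" by linarith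
  qed
  also have "\<dots> \<le> x * x" using xk by (simp add: mult_right_mono)
  finally show "(\<Sum>i<k. \<bar>real_of_int (cs ! (k - 1 - i))\<bar>) \<le> x\<^sup>2" by (simp add: power2_eq_square)
qed

text \<open>One step of the recurrence costs at most a factor
  \<open>k * X \<le> X^2\<close>.\<close>

lemma U_bound: "\<bar>real_of_int (U n)\<bar> \<le> x ^ (2 * n + 1)"
proof (induction n rule: less_induct)
  case (less n)
  show ?case
  proof (cases "n < k")
    case True
    have "real_of_int \<bar>U n\<bar> \<le> real_of_int (int X)" using U_le[OF True] by (simp only: of_int_le_iff)
    then have "\<bar>real_of_int (U n)\<bar> \<le> x ^ 1" by simp
    also have "\<dots> \<le> x ^ (2 * n + 1)" by (rule power_increasing) (use x2 in auto)
    finally show ?thesis .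
  next
    case False
    define m where "m = n - k"
    have n: "n = m + k" using False by (simp add: m_def)
    have "U n = (\<Sum>i<k. cs ! i * U (m + (k - 1 - i)))"
      using rec unfolding linear_recurrence_def n by blast
    then have "\<bar>real_of_int (U n)\<bar> \<le> (\<Sum>i<k. \<bar>real_of_int (cs ! i * U (m + (k - 1 - i)))\<bar>)" by simp
    also have "\<dots> \<le> (\<Sum>i<k. x * x ^ (2 * (n - 1) + 1))"
    proof (rule sum_mono)
      fix i assume "i \<in> {..<k}"
      then have i: "i < k" by simp
      have "\<bar>real_of_int (cs ! i)\<bar> \<le> x" using cs_le[OF i] by linarith
      moreover have "\<bar>real_of_int (U (m + (k - 1 - i)))\<bar> \<le> x ^ (2 * (m + (k - 1 - i)) + 1)"
        by (rule less) (use i n in auto)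
      moreover have "x ^ (2 * (m + (k - 1 - i)) + 1) \<le> x ^ (2 * (n - 1) + 1)"
        by (rule power_increasing) (use i n x2 in auto)
      ultimately show "\<bar>real_of_int (cs ! i * U (m + (k - 1 - i)))\<bar> \<le> x * x ^ (2 * (n - 1) + 1)"
        unfolding of_int_mult abs_mult by (intro mult_mono) auto
    qed
    also have "\<dots> = real k * (x * x ^ (2 * (n - 1) + 1))" by simp
    also have "\<dots> \<le> x * (x * x ^ (2 * (n - 1) + 1))" by (intro mult_right_mono xk) (use x2 in auto)
    also have "\<dots> = x ^ (2 + (2 * (n - 1) + 1))" by simp
    also have "2 + (2 * (n - 1) + 1) = 2 * n + 1" using n k_pos by linarith
    finally show ?thesis .
  qed
qed

text \<open>The coefficients of \<open>a r\<close> need not be integral. The denominator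
  \<open>\<Delta> = (D * r) ^ s\<close>, with \<open>D\<close> the value at \<open>r\<close> of the
  cofactor \<open>Q\<close>, clears them: \<open>D ^ s\<close> comes from
  \<open>isolate_root\<close>, and \<open>r ^ s\<close> compensates the powers
  \<open>r ^ (- j)\<close> that appear when \<open>newton_shift\<close> is divided by
  \<open>r ^ n\<close>.\<close>

lemma hgt_isolated:
  assumes r: "poly f r = 0"
  shows "\<exists>s \<Delta> e. 1 \<le> s \<and> s \<le> k \<and> \<Delta> \<noteq> 0 \<and> hgt k (\<lambda>i. r ^ i) (real (bF X)) \<Delta> \<and>
    (\<forall>j<s. hgt k (\<lambda>i. r ^ i) (real (bF X)) (e j)) \<and>
    (\<forall>n. \<Delta> * poly (a r) (of_nat n) = (\<Sum>j<s. of_nat (n choose j) * e j))"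
proof -
  let ?h = "hgt k (\<lambda>i. r ^ i)"
  define s where "s = Polynomial.order r f"
  obtain Q where Q: "f = [:- r, 1:] ^ s * Q" "\<not> [:- r, 1:] dvd Q"
    using order_decomp[OF f_nz, of r] unfolding s_def by blast
  have Qr: "poly Q r \<noteq> 0" using Q(2) by (simp add: poly_eq_0_iff_dvd)
  have s: "1 \<le> s" "s \<le> k"
  proof -
    show "1 \<le> s" using r f_nz order_root[of f r] by (simp add: s_def Suc_le_eq)
    show "s \<le> k" using order_degree[OF f_nz, of r] by (simp add: s_def degree_f)
  qed
  have sX: "s \<le> X" using s len by simp
  have r0: "r \<noteq> 0" by (rule root_nz[OF r])
  have xp: "x ^ i \<le> x ^ j" if "i \<le> j" for i j by (rule power_increasing[OF that x2(2)])
  have x1p: "1 \<le> x ^ j" for j using x2 by simp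
  have hr: "?h (x\<^sup>2) r" by (rule hgt_root[OF r])
  have X1: "x + 1 \<le> x\<^sup>2"
    using mult_right_mono[OF x2(1), of x] x2 unfolding power2_eq_square by linarith
  have C: "(real k + 1) * (x\<^sup>2) ^ k \<le> x ^ (2 * X + 2)"
  proof -
    have "(real k + 1) * (x\<^sup>2) ^ k \<le> x\<^sup>2 * (x\<^sup>2) ^ X"
      using X1 xk x2 len by (intro mult_mono power_increasing) (auto intro: order_trans)
    then show ?thesis by (simp only: power_mult power_add mult.commute[of "(x\<^sup>2) ^ X"])
  qed
  have degQ: "degree Q \<le> k"
  proof -
    have "degree f = degree ([:- r, 1:] ^ s) + degree Q"
      by (subst Q(1), rule degree_mult_eq) (use f_nz Q(1) in auto)
    then show ?thesis using degree_f by simp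
  qed
  have coeffQ: "?h (real (bQ X)) (coeff Q i)" for i
  proof (rule hgt_mono)
    show "?h (((real k + 1) * (x\<^sup>2) ^ k) ^ s * x) (coeff Q i)"
    proof (rule hgt_synthetic_division[OF Q(1) _ _ hr])
      show "?h x (coeff f j)" for j
      proof -
        consider "j = k" | "j < k" | "k < j" by linarith
        then show ?thesis
        proof cases
          case 2
          then have "\<bar>cs ! (k - 1 - j)\<bar> \<le> int X" by (intro cs_le) auto
          then have "?h x (of_int (- (cs ! (k - 1 - j))))" by (intro hgt_of_int) linarith
          then show ?thesis using 2 by (simp add: coeff_f)
        qed (use x2 in \<open>auto simp: coeff_f intro: hgt_1 hgt_0\<close>)
      qed
    qed (use degree_f x2 in auto)
    have "((real k + 1) * (x\<^sup>2) ^ k) ^ s \<le> (x ^ (2 * X + 2)) ^ s" by (intro power_mono C) auto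
    also have "\<dots> \<le> (x ^ (2 * X + 2)) ^ X" by (rule power_increasing[OF sX x1p])
    finally show "((real k + 1) * (x\<^sup>2) ^ k) ^ s * x \<le> real (bQ X)"
      using x2 by (simp add: bQ_def mult.commute mult_left_mono)
  qed
  define D where "D = poly Q r"
  have bQ1: "1 \<le> real (bQ X)"
    unfolding bQ_def of_nat_mult of_nat_power by (intro one_le_mult_real x2 one_le_power[OF x1p])
  have bD1: "real (bQ X) \<le> real (bD X)" "1 \<le> real (bD X)"
  proof -
    have "real (bQ X) * 1 \<le> real (bQ X) * x ^ (2 * X + 2)" by (intro mult_left_mono x1p) simp
    then show "real (bQ X) \<le> real (bD X)" by (simp add: bD_def)
    then show "1 \<le> real (bD X)" using bQ1 by linarith
  qed
  have hD: "?h (real (bD X)) D"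
  proof -
    have "D = (\<Sum>i\<le>k. coeff Q i * r ^ i)"
      unfolding D_def poly_altdef by (rule sum.mono_neutral_left) (use degQ in \<open>auto simp: coeff_eq_0\<close>)
    then have 1: "?h (\<Sum>i\<le>k. real (bQ X) * (x\<^sup>2) ^ i) D"
      using hgt_sum[of "{..k}" k "\<lambda>i. r ^ i" "\<lambda>i. real (bQ X) * (x\<^sup>2) ^ i" "\<lambda>i. coeff Q i * r ^ i"]
        hgt_mult[OF coeffQ hgt_power[OF hr]] by simp
    have "(\<Sum>i\<le>k. real (bQ X) * (x\<^sup>2) ^ i) \<le> (\<Sum>i\<le>k. real (bQ X) * (x\<^sup>2) ^ k)"
      by (intro sum_mono mult_left_mono power_increasing) (use x2 in auto)
    also have "\<dots> = real (bQ X) * ((real k + 1) * (x\<^sup>2) ^ k)" by (simp add: algebra_simps)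
    also have "\<dots> \<le> real (bQ X) * x ^ (2 * X + 2)" by (intro mult_left_mono C) auto
    finally show ?thesis using hgt_mono[OF 1] by (simp add: bD_def)
  qed
  define G where "G = [:D:] - Q"
  have degG: "degree G \<le> k" unfolding G_def by (rule degree_diff_le) (use degQ in auto)
  have coeffG: "?h (2 * real (bD X)) (coeff G i)" for i
  proof -
    have "?h (real (bD X) + real (bQ X)) (coeff [:D:] i - coeff Q i)"
      by (rule hgt_diff[OF _ coeffQ]) (use hD in \<open>auto simp: coeff_pCons intro: hgt_0 split: nat.splits\<close>)
    from hgt_mono[OF this, of "2 * real (bD X)"] show ?thesis using bD1 by (simp add: G_def)
  qed
  define A where "A = x ^ (2 * X + 3) * real (bD X)"
  have A1: "1 \<le> A" unfolding A_def by (intro one_le_mult_real x1p bD1)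
  define u where "u n = (of_int (U n) :: complex)" for n
  have hu: "?h (x ^ (2 * n + 1)) (u n)" for n
    unfolding u_def by (rule hgt_of_int) (rule U_bound)
  have hG: "?h (A ^ j * x ^ (2 * n + 1)) (opE (G ^ j) u n)" for j n
  proof (induction j arbitrary: n)
    case 0
    then show ?case using hu by simp
  next
    case (Suc j)
    have "opE (G ^ Suc j) u n = (\<Sum>i\<le>k. coeff G i * opE (G ^ j) u (n + i))"
      unfolding power_Suc opE_mult by (rule opE_eq_sum[OF degG])
    then have 1: "?h (\<Sum>i\<le>k. 2 * real (bD X) * (A ^ j * x ^ (2 * (n + i) + 1))) (opE (G ^ Suc j) u n)"
      by (simp only:) (intro hgt_sum hgt_mult coeffG Suc.IH finite_atMost)
    have "(\<Sum>i\<le>k. 2 * real (bD X) * (A ^ j * x ^ (2 * (n + i) + 1)))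
        \<le> (\<Sum>i\<le>k. 2 * real (bD X) * (A ^ j * x ^ (2 * X + (2 * n + 1))))"
      by (intro sum_mono mult_left_mono xp) (use len A1 in auto)
    also have "\<dots> = (2 * (real k + 1)) * (real (bD X) * (A ^ j * x ^ (2 * X + (2 * n + 1))))"
      by (simp add: algebra_simps)
    also have "\<dots> \<le> x ^ 3 * (real (bD X) * (A ^ j * x ^ (2 * X + (2 * n + 1))))"
    proof (rule mult_right_mono)
      have "2 * (real k + 1) \<le> x * x\<^sup>2" by (intro mult_mono) (use x2 xk X1 in auto)
      then show "2 * (real k + 1) \<le> x ^ 3" by (simp add: eval_nat_numeral)
    qed (use A1 x2 in auto)
    also have "\<dots> = A ^ Suc j * x ^ (2 * n + 1)" by (simp add: A_def power_add mult_ac)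
    finally show ?case by (rule hgt_mono[OF 1])
  qed
  have AX: "A ^ s \<le> A ^ X" by (rule power_increasing[OF sX A1])
  have bE: "real (bE X) = 2 * A ^ X" by (simp add: bE_def A_def)
  have bDA: "real (bD X) \<le> A"
    unfolding A_def using mult_right_mono[OF x1p[of "2 * X + 3"], of "real (bD X)"] by simp
  \<comment> \<open>\<open>w\<close> is \<open>D ^ s\<close> times the contribution of
    \<open>r\<close>. By \<open>w_eq\<close> it is a combination of integers \<open>U n\<close> with
    coefficients built from those of \<open>Q\<close> and \<open>D\<close>, which is why its height
    is known before anything is known about \<open>a r\<close>.\<close>
  define w where "w n = D ^ s * (poly (a r) (of_nat n) * r ^ n)" for n
  have w_eq: "w n = D ^ s * u n - opE (G ^ s) u n" for n
    using isolate_root[OF expansion Q(1) Qr f_nz, of n] s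
    unfolding w_def G_def D_def u_def by (simp add: algebra_simps)
  have hw: "?h (real (bE X) * x ^ (2 * n + 1)) (w n)" for n
    unfolding w_eq
  proof (rule hgt_mono[OF hgt_diff[OF hgt_mult[OF hgt_power[OF hD] hu] hG]])
    have "real (bD X) ^ s \<le> A ^ X"
      using power_mono[OF bDA, of s] AX bD1 by linarith
    then have "real (bD X) ^ s * x ^ (2 * n + 1) + A ^ s * x ^ (2 * n + 1) \<le> A ^ X * x ^ (2 * n + 1) + A ^ X * x ^ (2 * n + 1)"
      by (intro add_mono mult_right_mono AX) (use x2 in auto)
    also have "A ^ X * x ^ (2 * n + 1) + A ^ X * x ^ (2 * n + 1) = real (bE X) * x ^ (2 * n + 1)"
      unfolding bE by simp
    finally show "real (bD X) ^ s * x ^ (2 * n + 1) + A ^ s * x ^ (2 * n + 1) \<le> real (bE X) * x ^ (2 * n + 1)" .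
  qed
  have hW: "?h (x ^ (3 * j) * (real (bE X) * x ^ (2 * n + 1))) (opE ([:- r, 1:] ^ j) w n)" for j n
  proof (induction j arbitrary: n)
    case 0
    then show ?case using hw by simp
  next
    case (Suc j)
    have "opE ([:- r, 1:] ^ Suc j) w n = opE ([:- r, 1:] ^ j) w (n + 1) - r * opE ([:- r, 1:] ^ j) w n"
      unfolding power_Suc opE_mult by simp
    then have 1: "?h (x ^ (3 * j) * (real (bE X) * x ^ (2 * (n + 1) + 1)) + x\<^sup>2 * (x ^ (3 * j) * (real (bE X) * x ^ (2 * n + 1))))
        (opE ([:- r, 1:] ^ Suc j) w n)"
      using hgt_diff[OF Suc.IH[of "n + 1"] hgt_mult[OF hr Suc.IH[of n]]] by simp
    have "x ^ (3 * j) * (real (bE X) * x ^ (2 * (n + 1) + 1)) + x\<^sup>2 * (x ^ (3 * j) * (real (bE X) * x ^ (2 * n + 1)))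
        = 2 * (x\<^sup>2 * (x ^ (3 * j) * (real (bE X) * x ^ (2 * n + 1))))"
      by (simp add: power_add power2_eq_square mult_ac)
    also have "\<dots> \<le> x * (x\<^sup>2 * (x ^ (3 * j) * (real (bE X) * x ^ (2 * n + 1))))"
      by (rule mult_right_mono) (use x2 in auto)
    also have "\<dots> = x ^ (3 * Suc j) * (real (bE X) * x ^ (2 * n + 1))"
      by (simp add: power_add eval_nat_numeral mult_ac)
    finally show ?case by (rule hgt_mono[OF 1])
  qed
  define e where "e j = r ^ (s - j) * opE ([:- r, 1:] ^ j) w 0" for j
  define \<Delta> where "\<Delta> = (D * r) ^ s"
  show ?thesis
  proof (intro exI[of _ s] exI[of _ \<Delta>] exI[of _ e] conjI allI impI)
    show "1 \<le> s" "s \<le> k" by (rule s)+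
    show "\<Delta> \<noteq> 0" using Qr r0 by (simp add: \<Delta>_def D_def)
    show "?h (real (bF X)) \<Delta>"
      unfolding \<Delta>_def
    proof (rule hgt_mono[OF hgt_power[OF hgt_mult[OF hD hr]]])
      have "real (bD X) * x\<^sup>2 \<le> A" unfolding A_def
        using mult_right_mono[OF xp[of 2 "2 * X + 3"], of "real (bD X)"] by (simp add: mult.commute)
      then have "(real (bD X) * x\<^sup>2) ^ s \<le> A ^ s" by (intro power_mono) auto
      also have "\<dots> \<le> A ^ X" by (rule AX)
      also have "\<dots> \<le> x ^ (5 * X + 1) * (2 * A ^ X)"
        using mult_mono[of 1 "x ^ (5 * X + 1)" "A ^ X" "2 * A ^ X"] x1p[of "5 * X + 1"] A1 by simp
      finally show "(real (bD X) * x\<^sup>2) ^ s \<le> real (bF X)" by (simp add: bF_def bE)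
    qed
    show "?h (real (bF X)) (e j)" if "j < s" for j
      unfolding e_def
    proof (rule hgt_mono[OF hgt_mult[OF hgt_power[OF hr] hW]])
      have 1: "(x\<^sup>2) ^ (s - j) = x ^ (2 * (s - j))" by (simp only: power_mult)
      have 2: "x ^ (2 * (s - j) + 3 * j + 1) = x ^ (2 * (s - j)) * x ^ (3 * j) * x" by (simp only: power_add power_one_right)
      have 3: "x ^ (2 * 0 + 1) = x" by simp
      have "(x\<^sup>2) ^ (s - j) * (x ^ (3 * j) * (real (bE X) * x ^ (2 * 0 + 1))) = x ^ (2 * (s - j) + 3 * j + 1) * real (bE X)"
        unfolding 1 2 3 by (simp only: mult_ac)
      also have "\<dots> \<le> x ^ (5 * X + 1) * real (bE X)"
        by (intro mult_right_mono xp) (use sX that in auto)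
      finally show "(x\<^sup>2) ^ (s - j) * (x ^ (3 * j) * (real (bE X) * x ^ (2 * 0 + 1))) \<le> real (bF X)"
        by (simp add: bF_def)
    qed
    show "\<Delta> * poly (a r) (of_nat n) = (\<Sum>j<s. of_nat (n choose j) * e j)" for n
    proof -
      have deg: "degree (a r) < s"
        using expansion r s(1) unfolding root_expansion_def s_def by fastforce
      have W0: "opE ([:- r, 1:] ^ j) w 0 = 0" if "s \<le> j" for j
      proof -
        have "opE ([:- r, 1:] ^ s) w m = 0" for m
        proof -
          have "opE ([:- r, 1:] ^ s) w m = D ^ s * opE ([:- r, 1:] ^ s) (\<lambda>n. poly (a r) (of_nat n) * r ^ n) m"
            unfolding opE_def sum_distrib_left by (rule sum.cong[OF refl]) (simp only: w_def mult.left_commute)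
          also have "\<dots> = 0" unfolding opE_annihilates[OF deg] by (rule mult_zero_right)
          finally show ?thesis .
        qed
        then show ?thesis by (rule opE_dvd_zero[OF le_imp_power_dvd[OF that]])
      qed
      have "r ^ s * w n = (\<Sum>j\<le>n. r ^ s * (of_nat (n choose j) * r ^ (n - j) * opE ([:- r, 1:] ^ j) w 0))"
        unfolding sum_distrib_left[symmetric] by (rule arg_cong[OF newton_shift])
      also have "\<dots> = (\<Sum>j\<in>{..n} \<inter> {..<s}. r ^ s * (of_nat (n choose j) * r ^ (n - j) * opE ([:- r, 1:] ^ j) w 0))"
        by (rule sum.mono_neutral_right) (auto simp: W0)
      also have "\<dots> = (\<Sum>j\<in>{..n} \<inter> {..<s}. of_nat (n choose j) * e j * r ^ n)"
      proof (rule sum.cong[OF refl])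
        fix j assume "j \<in> {..n} \<inter> {..<s}"
        then have "r ^ s * r ^ (n - j) = r ^ (s - j) * r ^ n" by (simp flip: power_add)
        then have "of_nat (n choose j) * (r ^ s * r ^ (n - j)) * opE ([:- r, 1:] ^ j) w 0
          = of_nat (n choose j) * (r ^ (s - j) * r ^ n) * opE ([:- r, 1:] ^ j) w 0" by (simp only:)
        then show "r ^ s * (of_nat (n choose j) * r ^ (n - j) * opE ([:- r, 1:] ^ j) w 0) = of_nat (n choose j) * e j * r ^ n"
          unfolding e_def by (simp only: mult_ac)
      qed
      also have "\<dots> = (\<Sum>j<s. of_nat (n choose j) * e j * r ^ n)"
        by (rule sum.mono_neutral_left) (auto simp: binomial_eq_0)
      also have "\<dots> = (\<Sum>j<s. of_nat (n choose j) * e j) * r ^ n" by (simp add: sum_distrib_right)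
      finally have "(\<Delta> * poly (a r) (of_nat n)) * r ^ n = (\<Sum>j<s. of_nat (n choose j) * e j) * r ^ n"
        by (simp add: w_def \<Delta>_def power_mult_distrib mult_ac)
      then show ?thesis using r0 by simp
    qed
  qed
qed

end

text \<open>One integer \<open>Z\<close> controls the heights, the index \<open>j0\<close>, the
  distance of \<open>\<bar>\<rho>\<bar>\<close> from 1 and the relative gap to the other roots, so
  that all later constants depend on \<open>Z\<close> alone. \<open>j0\<close> is the degree in
  \<open>n\<close> of the factor of \<open>\<rho> ^ n\<close>, with \<open>e j0\<close> its top
  coefficient in the binomial basis.\<close>

definition dominant_data ::
  "nat \<Rightarrow> nat \<Rightarrow> (nat \<Rightarrow> complex) \<Rightarrow> (nat \<Rightarrow> int) \<Rightarrow> real \<Rightarrow> complex \<Rightarrow> (nat \<Rightarrow> complex) \<Rightarrow> nat \<Rightarrow> bool" where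
  "dominant_data Z d v U \<rho> \<Delta> e j0 \<longleftrightarrow>
     1 + 1 / real Z \<le> \<bar>\<rho>\<bar> \<and> hgt d v (real Z) (of_real \<rho>) \<and>
     hgt d v (real Z) \<Delta> \<and> \<Delta> \<noteq> 0 \<and>
     (\<forall>j\<le>j0. hgt d v (real Z) (e j)) \<and> e j0 \<noteq> 0 \<and> j0 < Z \<and>
     (\<forall>n. norm (\<Delta> * of_int (U n) - (\<Sum>j\<le>j0. of_nat (n choose j) * e j) * of_real \<rho> ^ n)
        \<le> real Z * (real n + 1) ^ Z * (\<bar>\<rho>\<bar> * (1 - 1 / real Z)) ^ n)"

lemma choose_le_Suc_power: "j \<le> X \<Longrightarrow> real (n choose j) \<le> (real n + 1) ^ X"
proof -
  assume j: "j \<le> X"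
  have "real (n choose j) \<le> real n ^ j / fact j" by (rule choose_le_power_over_fact)
  also have "\<dots> \<le> real n ^ j / 1" by (intro divide_left_mono) (simp_all add: fact_ge_1)
  also have "\<dots> \<le> (real n + 1) ^ j" by (simp add: power_mono)
  also have "\<dots> \<le> (real n + 1) ^ X" by (rule power_increasing) (use j in auto)
  finally show ?thesis .
qed

text \<open>Used to show that a dominant root of modulus below 1 would force
  \<open>\<bar>U n\<bar> < 1\<close> for some large \<open>n\<close>.\<close>

lemma poly_times_geometric_lt_1:
  fixes C \<rho> :: real
  assumes "0 \<le> \<rho>" "\<rho> < 1"
  shows "\<exists>n\<ge>N. C * (real n + 1) ^ k * \<rho> ^ n < 1"
proof (cases "\<rho> = 0")
  case True
  then show ?thesis by (intro exI[of _ "Suc N"]) simp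
next
  case False
  define c where "c = - ln \<rho>"
  have c: "0 < c" using assms False by (simp add: c_def)
  have \<rho>: "\<rho> ^ n = exp (- (c * real n))" for n
    using assms False by (simp add: c_def exp_of_nat2_mult)
  have "filterlim (\<lambda>n. c * (real n + 1)) at_top sequentially"
  proof (rule filterlim_tendsto_pos_mult_at_top[OF tendsto_const c])
    show "filterlim (\<lambda>n. real n + 1) at_top sequentially"
      by (rule filterlim_at_top_mono[OF filterlim_real_sequentially]) auto
  qed
  then have "(\<lambda>n. (c * (real n + 1)) ^ k / exp (c * (real n + 1))) \<longlonglongrightarrow> 0"
    by (rule filterlim_compose[OF tendsto_power_div_exp_0])
  then have "(\<lambda>n. (C * exp c / c ^ k) * ((c * (real n + 1)) ^ k / exp (c * (real n + 1)))) \<longlonglongrightarrow> (C * exp c / c ^ k) * 0"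
    by (intro tendsto_mult tendsto_const)
  moreover have "(C * exp c / c ^ k) * ((c * (real n + 1)) ^ k / exp (c * (real n + 1))) = C * (real n + 1) ^ k * \<rho> ^ n" for n
  proof -
    have "c - c * (real n + 1) = - (c * real n)" by (simp add: algebra_simps)
    then have "exp c / exp (c * (real n + 1)) = exp (- (c * real n))" by (simp only: exp_diff[symmetric])
    moreover have "(C * exp c / c ^ k) * ((c * (real n + 1)) ^ k / exp (c * (real n + 1)))
        = C * (real n + 1) ^ k * (exp c / exp (c * (real n + 1)))"
      using c unfolding power_mult_distrib by simp
    ultimately show ?thesis by (simp only: \<rho>)
  qed
  ultimately have "(\<lambda>n. C * (real n + 1) ^ k * \<rho> ^ n) \<longlonglongrightarrow> 0" by simp
  then have "eventually (\<lambda>n. C * (real n + 1) ^ k * \<rho> ^ n < 1) sequentially"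
    by (rule order_tendstoD) simp
  then obtain m where "\<And>n. m \<le> n \<Longrightarrow> C * (real n + 1) ^ k * \<rho> ^ n < 1"
    unfolding eventually_sequentially by blast
  then show ?thesis by (intro exI[of _ "max N m"]) auto
qed

lemma infinite_range_of_nat_complex: "infinite (range (of_nat :: nat \<Rightarrow> complex))"
  by (rule range_inj_infinite) (simp add: inj_def)

lemma opE_cnj: "opE (map_poly cnj p) (\<lambda>n. cnj (u n)) n = cnj (opE p u n)"
proof -
  have "degree (map_poly cnj p) = degree p" by (rule degree_map_poly) auto
  then show ?thesis by (simp add: opE_def coeff_map_poly)
qed

text \<open>\<open>bW\<close> is the inverse relative gap between the dominant root and another root
  of smaller modulus, as Liouville's inequality yields it in dimension at most \<open>X ^ 3\<close>.
  \<open>bZ\<close> adds up all bounds, so that it dominates each of them.\<close>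

definition bW :: "nat \<Rightarrow> nat" where "bW X = 2 * X ^ 4 * (2 * X ^ 4) ^ (X ^ 3)"
definition bH :: "nat \<Rightarrow> nat" where "bH X = bF X * X * bG X"
definition bZ :: "nat \<Rightarrow> nat" where "bZ X = bF X + bH X + bW X + (X\<^sup>2 + 1) ^ X + X\<^sup>2 + 1000"

section \<open>Dominant roots: growth, reality and separation from the other roots\<close>

context rec_seq
begin

lemma bF_pos: "1 \<le> real (bF X)"
proof -
  have "0 < X" using X2 by simp
  then have "0 < bF X"
    unfolding bF_def bE_def bD_def bQ_def by (intro mult_pos_pos zero_less_power zero_less_numeral)
  then have "1 \<le> bF X" by (simp only: Suc_le_eq One_nat_def)
  from of_nat_mono[OF this, where 'a = real] show ?thesis by (simp only: of_nat_1)
qed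

text \<open>\<open>\<Delta> * poly (a r) n\<close> is bounded through its binomial form, and
  Liouville's inequality keeps \<open>\<Delta>\<close> away from 0.\<close>

lemma coeff_growth:
  assumes r: "poly f r = 0"
  shows "norm (poly (a r) (of_nat n)) \<le> real (bG X) * (real n + 1) ^ X"
proof -
  let ?h = "hgt k (\<lambda>i. r ^ i)"
  obtain s \<Delta> e where DD: "1 \<le> s \<and> s \<le> k \<and> \<Delta> \<noteq> 0 \<and> ?h (real (bF X)) \<Delta> \<and>
    (\<forall>j<s. ?h (real (bF X)) (e j)) \<and>
    (\<forall>n. \<Delta> * poly (a r) (of_nat n) = (\<Sum>j<s. of_nat (n choose j) * e j))"
    using hgt_isolated[OF r] by (elim exE)
  then have D: "1 \<le> s" "s \<le> k" "\<Delta> \<noteq> 0" "?h (real (bF X)) \<Delta>"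
    "\<And>j. j < s \<Longrightarrow> ?h (real (bF X)) (e j)"
    "\<And>n. \<Delta> * poly (a r) (of_nat n) = (\<Sum>j<s. of_nat (n choose j) * e j)"
    by auto
  have "norm (\<Delta> * poly (a r) (of_nat n)) \<le> (\<Sum>j<s. (real n + 1) ^ X * real (bF X))"
    unfolding D(6)
  proof (rule sum_norm_le)
    fix j assume "j \<in> {..<s}"
    then have j: "j < s" by simp
    have "norm (e j) \<le> real (bF X)" by (rule hgt_norm_le[OF D(5)[OF j] k_pos]) simp
    moreover have "real (n choose j) \<le> (real n + 1) ^ X"
      by (rule choose_le_Suc_power) (use j D(2) len in simp)
    ultimately show "norm (of_nat (n choose j) * e j) \<le> (real n + 1) ^ X * real (bF X)"
      unfolding norm_mult norm_of_nat by (intro mult_mono) auto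
  qed
  also have "\<dots> = real s * ((real n + 1) ^ X * real (bF X))" by simp
  also have "\<dots> \<le> x * ((real n + 1) ^ X * real (bF X))"
    by (intro mult_right_mono) (use D(2) len in auto)
  finally have 1: "norm \<Delta> * norm (poly (a r) (of_nat n)) \<le> x * ((real n + 1) ^ X * real (bF X))"
    by (simp only: norm_mult)
  have "1 \<le> norm \<Delta> * real (bF X) ^ (k - 1)"
    by (rule hgt_liouville[OF D(4) k_pos _ bF_pos D(3)]) simp
  also have "\<dots> \<le> norm \<Delta> * real (bF X) ^ X"
    by (intro mult_left_mono power_increasing bF_pos) (use len in auto)
  finally have "1 * norm (poly (a r) (of_nat n)) \<le> (norm \<Delta> * real (bF X) ^ X) * norm (poly (a r) (of_nat n))"
    by (intro mult_right_mono) auto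
  also have "\<dots> = real (bF X) ^ X * (norm \<Delta> * norm (poly (a r) (of_nat n)))" by simp
  also have "\<dots> \<le> real (bF X) ^ X * (x * ((real n + 1) ^ X * real (bF X)))"
    by (intro mult_left_mono 1) auto
  finally show ?thesis by (simp add: bG_def mult_ac)
qed

text \<open>\<open>isolate_root\<close> expresses the values of \<open>a r\<close> through
  \<open>U\<close> alone. Conjugating the formula gives the one for \<open>cnj r\<close>, because
  \<open>U\<close> and the characteristic polynomial are real.\<close>

lemma cnj_root:
  assumes r: "poly f r = 0" and a: "a r \<noteq> 0"
  shows "poly f (cnj r) = 0" "a (cnj r) \<noteq> 0"
proof -
  interpret cj: map_poly_comm_ring_hom cnj by unfold_locales auto
  have fc: "map_poly cnj f = f" by (rule poly_eqI) (simp add: coeff_map_poly coeff_f)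
  show "poly f (cnj r) = 0" using poly_cnj[of f r] r fc by simp
  define s where "s = Polynomial.order r f"
  obtain Q where Q: "f = [:- r, 1:] ^ s * Q" "\<not> [:- r, 1:] dvd Q"
    using order_decomp[OF f_nz, of r] unfolding s_def by blast
  have Qr: "poly Q r \<noteq> 0" using Q(2) by (simp add: poly_eq_0_iff_dvd)
  have s: "0 < s" using r f_nz order_root[of f r] by (simp add: s_def)
  define Qc where "Qc = map_poly cnj Q"
  have lin: "map_poly cnj [:- r, 1:] = [:- cnj r, 1:]" by (simp add: map_poly_pCons)
  have fQc: "f = [:- cnj r, 1:] ^ s * Qc"
    using arg_cong[OF Q(1), of "map_poly cnj"] unfolding fc cj.hom_mult cj.hom_power lin Qc_def .
  have Qcr: "poly Qc (cnj r) = cnj (poly Q r)" by (simp add: Qc_def)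
  define u where "u n = (of_int (U n) :: complex)" for n
  have "opE (([:poly Qc (cnj r):] - Qc) ^ s) u n = poly Qc (cnj r) ^ s * (u n - poly (a (cnj r)) (of_nat n) * cnj r ^ n)" for n
    unfolding u_def by (rule isolate_root[OF expansion fQc _ f_nz s]) (simp add: Qcr Qr)
  moreover have "opE (([:poly Q r:] - Q) ^ s) u n = poly Q r ^ s * (u n - poly (a r) (of_nat n) * r ^ n)" for n
    unfolding u_def by (rule isolate_root[OF expansion Q(1) Qr f_nz s])
  moreover have "opE (([:poly Qc (cnj r):] - Qc) ^ s) u n = cnj (opE (([:poly Q r:] - Q) ^ s) u n)" for n
  proof -
    have "map_poly cnj (([:poly Q r:] - Q) ^ s) = ([:poly Qc (cnj r):] - Qc) ^ s"
    proof -
      have "map_poly cnj [:poly Q r:] = [:cnj (poly Q r):]"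
        by (rule poly_eqI) (simp add: coeff_map_poly coeff_pCons split: nat.splits)
      then show ?thesis unfolding cj.hom_power cj.hom_minus Qc_def[symmetric] Qcr by (simp only:)
    qed
    moreover have "(\<lambda>n. cnj (u n)) = u" by (rule ext) (simp add: u_def)
    ultimately show ?thesis using opE_cnj[of "([:poly Q r:] - Q) ^ s" u n] by (simp only:)
  qed
  ultimately have "cnj (poly Q r) ^ s * (u n - poly (a (cnj r)) (of_nat n) * cnj r ^ n)
      = cnj (poly Q r) ^ s * (u n - cnj (poly (a r) (of_nat n)) * cnj r ^ n)" for n
    by (metis (no_types, lifting) Qcr complex_cnj_diff complex_cnj_mult complex_cnj_power complex_cnj_of_int u_def)
  then have eq: "poly (a (cnj r)) (of_nat n) = cnj (poly (a r) (of_nat n))" for n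
    using Qr root_nz[OF r] by simp
  show "a (cnj r) \<noteq> 0"
  proof
    assume "a (cnj r) = 0"
    then have z: "poly (a r) (of_nat n) = 0" for n using eq[of n] by simp
    have "finite {y. poly (a r) y = 0}" by (rule poly_roots_finite[OF a])
    moreover have "range (of_nat :: nat \<Rightarrow> complex) \<subseteq> {y. poly (a r) y = 0}" using z by auto
    ultimately have "finite (range (of_nat :: nat \<Rightarrow> complex))" by (rule rev_finite_subset)
    then show False using infinite_range_of_nat_complex by blast
  qed
qed

lemma card_roots: "finite {r. poly f r = 0}" "real (card {r. poly f r = 0}) \<le> x"
proof -
  show "finite {r. poly f r = 0}" by (rule poly_roots_finite[OF f_nz])
  have "card {r. poly f r = 0} \<le> k" using card_poly_roots_bound[OF f_nz] degree_f by simp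
  then show "real (card {r. poly f r = 0}) \<le> x" using len by simp
qed

text \<open>A nonreal dominant root would have the same modulus as its conjugate, which also is a
  root of the sequence.\<close>

lemma dominant_real:
  assumes dom: "dominant_root cs U \<alpha>"
    and a': "root_expansion cs U a" "poly f \<alpha> = 0" "a \<alpha> \<noteq> 0"
      "\<And>r. poly f r = 0 \<Longrightarrow> a r \<noteq> 0 \<Longrightarrow> r \<noteq> \<alpha> \<Longrightarrow> norm r < norm \<alpha>"
  shows "\<alpha> = of_real (Re \<alpha>)"
proof -
  have "cnj \<alpha> = \<alpha>"
    using a'(4)[OF cnj_root[OF a'(2,3)]] by (metis complex_mod_cnj less_irrefl)
  then show ?thesis by (metis Reals_cnj_iff of_real_Re)
qed

text \<open>The difference of the squared moduli equals \<open>\<alpha>^2 - r * cnj r\<close> and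
  lies in the ring generated by three roots, so Liouville's inequality applies to it. The common
  eigenvector is a triple tensor product.\<close>

lemma dominant_gap:
  assumes \<alpha>: "poly f \<alpha> = 0" "\<alpha> = of_real \<rho>" and r: "poly f r = 0" "norm r < norm \<alpha>"
  shows "norm r \<le> \<bar>\<rho>\<bar> * (1 - 1 / real (bW X))"
proof -
  define v where "v = (\<lambda>i. \<alpha> ^ (i div (k * k)) * (r ^ ((i mod (k * k)) div k) * cnj r ^ ((i mod (k * k)) mod k)))"
  define z where "z = \<alpha>\<^sup>2 - r * cnj r"
  let ?d = "k * (k * k)"
  have rc: "poly f (cnj r) = 0"
  proof -
    have "map_poly cnj f = f" by (rule poly_eqI) (simp add: coeff_map_poly coeff_f)
    then show ?thesis using poly_cnj[of f r] r by simp
  qed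
  have h1: "hgt ?d v (x\<^sup>2) \<alpha>"
    unfolding v_def using hgt_tensor1[OF hgt_root[OF \<alpha>(1)], of "k * k" "\<lambda>j. r ^ (j div k) * cnj r ^ (j mod k)"] by simp
  have h2: "hgt ?d v (x\<^sup>2) r" "hgt ?d v (x\<^sup>2) (cnj r)"
    unfolding v_def
    using hgt_tensor2[OF hgt_tensor1[OF hgt_root[OF r(1)], of k "\<lambda>j. cnj r ^ j"], of k "\<lambda>i. \<alpha> ^ i"]
      hgt_tensor2[OF hgt_tensor2[OF hgt_root[OF rc], of k "\<lambda>j. r ^ j"], of k "\<lambda>i. \<alpha> ^ i"] by simp_all
  have hz: "hgt ?d v (2 * x ^ 4) z"
  proof (rule hgt_mono)
    show "hgt ?d v ((x\<^sup>2)\<^sup>2 + x\<^sup>2 * x\<^sup>2) z"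
      unfolding z_def by (intro hgt_diff hgt_power hgt_mult h1 h2)
  qed (simp add: eval_nat_numeral)
  have z: "z = of_real (\<rho>\<^sup>2 - (norm r)\<^sup>2)"
    by (simp add: z_def \<alpha>(2) complex_norm_square[symmetric])
  have rr: "norm r < \<bar>\<rho>\<bar>" using r(2) \<alpha>(2) by simp
  have pos: "0 < \<rho>\<^sup>2 - (norm r)\<^sup>2"
    using power_strict_mono[OF rr, of 2] by simp
  have nz: "norm z = \<rho>\<^sup>2 - (norm r)\<^sup>2" using pos unfolding z norm_of_real by simp
  have z0: "z \<noteq> 0" using pos nz by auto
  have d0: "0 < ?d" using k_pos by simp
  have w1: "1 \<le> 2 * x ^ 4" using one_le_power[OF x2(2), of 4] by simp
  have "1 \<le> norm z * (2 * x ^ 4) ^ (?d - 1)"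
    by (rule hgt_liouville[OF hz d0 _ w1 z0]) (simp add: v_def)
  also have "\<dots> \<le> norm z * (2 * x ^ 4) ^ (X ^ 3)"
  proof (intro mult_left_mono power_increasing w1)
    have "?d \<le> X * (X * X)" by (intro mult_mono len) auto
    then show "?d - 1 \<le> X ^ 3" by (simp add: eval_nat_numeral)
  qed auto
  finally have W: "1 \<le> (\<rho>\<^sup>2 - (norm r)\<^sup>2) * (2 * x ^ 4) ^ (X ^ 3)" unfolding nz .
  define W' where "W' = (2 * x ^ 4) ^ (X ^ 3)"
  have W'0: "0 < W'" unfolding W'_def by (rule zero_less_power) (use w1 in linarith)
  have \<rho>x: "\<bar>\<rho>\<bar> \<le> x\<^sup>2" using hgt_norm_le[OF hgt_root[OF \<alpha>(1)] k_pos] \<alpha>(2) by simp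
  have \<rho>0: "0 < \<bar>\<rho>\<bar>" using rr norm_ge_zero[of r] by linarith
  have "\<rho>\<^sup>2 - (norm r)\<^sup>2 = (\<bar>\<rho>\<bar> - norm r) * (\<bar>\<rho>\<bar> + norm r)"
    by (simp add: algebra_simps power2_eq_square)
  also have "\<dots> \<le> (\<bar>\<rho>\<bar> - norm r) * (2 * \<bar>\<rho>\<bar>)" using rr by (intro mult_left_mono) auto
  finally have "(\<rho>\<^sup>2 - (norm r)\<^sup>2) * W' \<le> (\<bar>\<rho>\<bar> - norm r) * (2 * \<bar>\<rho>\<bar>) * W'"
    using W'0 by (intro mult_right_mono) auto
  then have 1: "1 \<le> (\<bar>\<rho>\<bar> - norm r) * (2 * \<bar>\<rho>\<bar> * W')"
    using W unfolding W'_def[symmetric] by (simp only: mult.assoc)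
  have "\<bar>\<rho>\<bar> * 1 \<le> \<bar>\<rho>\<bar> * ((\<bar>\<rho>\<bar> - norm r) * (2 * \<bar>\<rho>\<bar> * W'))" by (rule mult_left_mono[OF 1]) simp
  also have "\<dots> = (\<bar>\<rho>\<bar> - norm r) * (2 * (\<bar>\<rho>\<bar> * \<bar>\<rho>\<bar>) * W')" by (simp only: mult_ac)
  also have "\<dots> \<le> (\<bar>\<rho>\<bar> - norm r) * (2 * (x\<^sup>2 * x\<^sup>2) * W')"
    using rr W'0 \<rho>x by (intro mult_left_mono mult_right_mono mult_mono) auto
  also have "2 * (x\<^sup>2 * x\<^sup>2) * W' = real (bW X)" by (simp add: bW_def W'_def eval_nat_numeral)
  finally have "\<bar>\<rho>\<bar> \<le> (\<bar>\<rho>\<bar> - norm r) * real (bW X)" by simp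
  moreover have "0 < bW X" unfolding bW_def by (intro mult_pos_pos zero_less_power zero_less_numeral) (use X2 in auto)
  ultimately show ?thesis by (simp add: field_simps)
qed

lemma rest_bound:
  assumes \<alpha>: "poly f \<alpha> = 0" and g: "0 \<le> g" "\<And>r. poly f r = 0 \<Longrightarrow> a r \<noteq> 0 \<Longrightarrow> r \<noteq> \<alpha> \<Longrightarrow> norm r \<le> g"
  shows "norm (of_int (U n) - poly (a \<alpha>) (of_nat n) * \<alpha> ^ n) \<le> x * (real (bG X) * (real n + 1) ^ X * g ^ n)"
proof -
  let ?Z = "{r. poly f r = 0}"
  have "of_int (U n) = (\<Sum>r\<in>?Z. poly (a r) (of_nat n) * r ^ n)"
    using expansion unfolding root_expansion_def by blast
  then have "of_int (U n) - poly (a \<alpha>) (of_nat n) * \<alpha> ^ n = (\<Sum>r\<in>?Z - {\<alpha>}. poly (a r) (of_nat n) * r ^ n)"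
    using sum.remove[OF card_roots(1), of \<alpha> "\<lambda>r. poly (a r) (of_nat n) * r ^ n"] \<alpha> by simp
  also have "norm \<dots> \<le> (\<Sum>r\<in>?Z - {\<alpha>}. real (bG X) * (real n + 1) ^ X * g ^ n)"
  proof (rule sum_norm_le)
    fix r assume r: "r \<in> ?Z - {\<alpha>}"
    show "norm (poly (a r) (of_nat n) * r ^ n) \<le> real (bG X) * (real n + 1) ^ X * g ^ n"
    proof (cases "a r = 0")
      case True
      then show ?thesis using g(1) by simp
    next
      case False
      then show ?thesis unfolding norm_mult norm_power
        using r g coeff_growth[of r n] by (intro mult_mono power_mono) auto
    qed
  qed
  also have "\<dots> = real (card (?Z - {\<alpha>})) * (real (bG X) * (real n + 1) ^ X * g ^ n)" by simp
  also have "\<dots> \<le> x * (real (bG X) * (real n + 1) ^ X * g ^ n)"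
  proof (rule mult_right_mono)
    have "card (?Z - {\<alpha>}) \<le> card ?Z" by (rule card_mono[OF card_roots(1)]) auto
    then show "real (card (?Z - {\<alpha>})) \<le> x" using card_roots(2) by linarith
  qed (use g(1) in auto)
  finally show ?thesis .
qed

text \<open>Modulus below 1 would make some nonzero integer \<open>U n\<close> smaller than 1. Above
  1, Liouville's inequality for \<open>\<bar>\<rho>\<bar> - 1\<close> gives the distance.\<close>

lemma dominant_modulus_gt_1:
  assumes \<alpha>: "poly f \<alpha> = 0" "\<alpha> = of_real \<rho>" and rho: "\<bar>\<rho>\<bar> \<noteq> 1"
    and dom: "\<And>r. poly f r = 0 \<Longrightarrow> a r \<noteq> 0 \<Longrightarrow> r \<noteq> \<alpha> \<Longrightarrow> norm r < norm \<alpha>"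
    and nz: "\<And>n. N \<le> n \<Longrightarrow> U n \<noteq> 0"
  shows "1 + 1 / (x\<^sup>2 + 1) ^ X \<le> \<bar>\<rho>\<bar>"
proof -
  have na: "norm \<alpha> = \<bar>\<rho>\<bar>" using \<alpha>(2) by simp
  have "\<not> \<bar>\<rho>\<bar> < 1"
  proof
    assume lt: "\<bar>\<rho>\<bar> < 1"
    obtain n where n: "N \<le> n" "((x + 1) * real (bG X)) * (real n + 1) ^ X * \<bar>\<rho>\<bar> ^ n < 1"
      using poly_times_geometric_lt_1[OF _ lt] by force
    have "norm (of_int (U n) :: complex) \<le> norm (of_int (U n) - poly (a \<alpha>) (of_nat n) * \<alpha> ^ n) + norm (poly (a \<alpha>) (of_nat n) * \<alpha> ^ n)"
      by (metis diff_add_cancel norm_triangle_ineq)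
    also have "\<dots> \<le> x * (real (bG X) * (real n + 1) ^ X * \<bar>\<rho>\<bar> ^ n) + real (bG X) * (real n + 1) ^ X * \<bar>\<rho>\<bar> ^ n"
    proof (rule add_mono)
      show "norm (of_int (U n) - poly (a \<alpha>) (of_nat n) * \<alpha> ^ n) \<le> x * (real (bG X) * (real n + 1) ^ X * \<bar>\<rho>\<bar> ^ n)"
        by (rule rest_bound[OF \<alpha>(1)]) (use dom na in \<open>auto intro: less_imp_le\<close>)
      show "norm (poly (a \<alpha>) (of_nat n) * \<alpha> ^ n) \<le> real (bG X) * (real n + 1) ^ X * \<bar>\<rho>\<bar> ^ n"
        unfolding norm_mult norm_power na by (intro mult_right_mono coeff_growth \<alpha>(1)) auto
    qed
    also have "\<dots> = ((x + 1) * real (bG X)) * (real n + 1) ^ X * \<bar>\<rho>\<bar> ^ n" by (simp add: algebra_simps)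
    also have "\<dots> < 1" by (rule n(2))
    finally have "\<bar>real_of_int (U n)\<bar> < 1" by simp
    then show False using nz[OF n(1)] by linarith
  qed
  then have gt: "1 < \<bar>\<rho>\<bar>" using rho by linarith
  define z where "z = of_real \<bar>\<rho>\<bar> - (1 :: complex)"
  let ?h = "hgt k (\<lambda>i. \<alpha> ^ i)"
  have "?h (x\<^sup>2) (of_real \<bar>\<rho>\<bar>)"
    using hgt_root[OF \<alpha>(1)] hgt_uminus[OF hgt_root[OF \<alpha>(1)]] \<alpha>(2) by (cases "0 \<le> \<rho>") auto
  then have hz: "?h (x\<^sup>2 + 1) z" unfolding z_def by (intro hgt_diff hgt_1) auto
  have nz: "norm z = \<bar>\<rho>\<bar> - 1"
  proof -
    have "z = of_real (\<bar>\<rho>\<bar> - 1)" by (simp add: z_def)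
    then show ?thesis using gt by (simp only: norm_of_real)
  qed
  have "1 \<le> norm z * (x\<^sup>2 + 1) ^ (k - 1)"
    by (rule hgt_liouville[OF hz k_pos]) (use nz gt in auto)
  also have "\<dots> \<le> norm z * (x\<^sup>2 + 1) ^ X"
    by (intro mult_left_mono power_increasing) (use len in auto)
  finally have "1 \<le> (\<bar>\<rho>\<bar> - 1) * (x\<^sup>2 + 1) ^ X" unfolding nz .
  then have "1 / (x\<^sup>2 + 1) ^ X \<le> \<bar>\<rho>\<bar> - 1"
    by (subst pos_divide_le_eq) (auto intro!: zero_less_power add_nonneg_pos)
  then show ?thesis by linarith
qed

lemma dominant_data:
  assumes \<alpha>: "poly f \<alpha> = 0" "\<alpha> = of_real \<rho>" "a \<alpha> \<noteq> 0" and rho: "\<bar>\<rho>\<bar> \<noteq> 1"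
    and dom: "\<And>r. poly f r = 0 \<Longrightarrow> a r \<noteq> 0 \<Longrightarrow> r \<noteq> \<alpha> \<Longrightarrow> norm r < norm \<alpha>"
    and nz: "\<And>n. N \<le> n \<Longrightarrow> U n \<noteq> 0"
    and Z: "bZ X \<le> Z"
  shows "\<exists>\<Delta> e j0. dominant_data Z k (\<lambda>i. \<alpha> ^ i) U \<rho> \<Delta> e j0"
proof -
  let ?h = "hgt k (\<lambda>i. \<alpha> ^ i)"
  obtain s \<Delta> e where DD: "1 \<le> s \<and> s \<le> k \<and> \<Delta> \<noteq> 0 \<and> ?h (real (bF X)) \<Delta> \<and>
    (\<forall>j<s. ?h (real (bF X)) (e j)) \<and>
    (\<forall>n. \<Delta> * poly (a \<alpha>) (of_nat n) = (\<Sum>j<s. of_nat (n choose j) * e j))"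
    using hgt_isolated[OF \<alpha>(1)] by (elim exE)
  then have D: "1 \<le> s" "s \<le> k" "\<Delta> \<noteq> 0" "?h (real (bF X)) \<Delta>"
    "\<And>j. j < s \<Longrightarrow> ?h (real (bF X)) (e j)"
    "\<And>n. \<Delta> * poly (a \<alpha>) (of_nat n) = (\<Sum>j<s. of_nat (n choose j) * e j)"
    by auto
  have Zs: "bF X \<le> Z" "bH X \<le> Z" "bW X \<le> Z" "(X\<^sup>2 + 1) ^ X \<le> Z" "X\<^sup>2 \<le> Z" "1000 \<le> Z"
    using Z unfolding bZ_def by linarith+
  have XX: "X \<le> X\<^sup>2" using X2 by (simp add: power2_eq_square)
  define J where "J = {j. j < s \<and> e j \<noteq> 0}"
  have J: "finite J" by (simp add: J_def)
  have "J \<noteq> {}"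
  proof
    assume "J = {}"
    then have "poly (a \<alpha>) (of_nat n) = 0" for n using D(6)[of n] D(3) by (simp add: J_def)
    then have "range (of_nat :: nat \<Rightarrow> complex) \<subseteq> {y. poly (a \<alpha>) y = 0}" by auto
    then have "finite (range (of_nat :: nat \<Rightarrow> complex))"
      using poly_roots_finite[OF \<alpha>(3)] finite_subset by blast
    then show False using infinite_range_of_nat_complex by blast
  qed
  define j0 where "j0 = Max J"
  have j0: "j0 < s" "e j0 \<noteq> 0" using Max_in[OF J \<open>J \<noteq> {}\<close>] by (auto simp: j0_def J_def)
  have top: "e j = 0" if "j < s" "j0 < j" for j
  proof (rule ccontr)
    assume "e j \<noteq> 0"
    then have "j \<in> J" using that by (simp add: J_def)
    then have "j \<le> j0" unfolding j0_def by (rule Max_ge[OF J])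
    then show False using that by simp
  qed
  have sum: "(\<Sum>j<s. of_nat (n choose j) * e j) = (\<Sum>j\<le>j0. of_nat (n choose j) * e j)" for n
    by (rule sum.mono_neutral_right) (use j0 top in auto)
  have Zr: "0 < real Z" using Zs by simp
  show ?thesis
    unfolding dominant_data_def
  proof (intro exI[of _ \<Delta>] exI[of _ e] exI[of _ j0] conjI allI impI)
    have "1 / real Z \<le> 1 / (x\<^sup>2 + 1) ^ X"
    proof (rule divide_left_mono)
      show "(x\<^sup>2 + 1) ^ X \<le> real Z" using of_nat_mono[OF Zs(4), where 'a = real] by (simp add: add.commute)
    qed (use Zr in \<open>auto intro!: mult_pos_pos zero_less_power add_nonneg_pos\<close>)
    moreover have "1 + 1 / (x\<^sup>2 + 1) ^ X \<le> \<bar>\<rho>\<bar>"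
      by (rule dominant_modulus_gt_1[OF \<alpha>(1,2) rho dom nz])
    ultimately show "1 + 1 / real Z \<le> \<bar>\<rho>\<bar>" by linarith
    show "?h (real Z) (of_real \<rho>)"
      using hgt_mono[OF hgt_root[OF \<alpha>(1)], of "real Z"] of_nat_mono[OF Zs(5), where 'a = real] \<alpha>(2) by simp
    show "?h (real Z) \<Delta>" by (rule hgt_mono[OF D(4)]) (use Zs in simp)
    show "\<Delta> \<noteq> 0" by (rule D)
    show "?h (real Z) (e j)" if "j \<le> j0" for j by (rule hgt_mono[OF D(5)]) (use Zs that j0 in simp_all)
    show "e j0 \<noteq> 0" by (rule j0)
    show "j0 < Z" using j0 D(2) len XX Zs by linarith
    fix n
    define g where "g = \<bar>\<rho>\<bar> * (1 - 1 / real (bW X))"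
    have bW0: "1 \<le> real (bW X)"
    proof -
      have "0 < bW X" unfolding bW_def by (intro mult_pos_pos zero_less_power zero_less_numeral) (use X2 in auto)
      then show ?thesis by simp
    qed
    have g0: "0 \<le> g" unfolding g_def using bW0 by simp
    have gZ: "g \<le> \<bar>\<rho>\<bar> * (1 - 1 / real Z)"
      unfolding g_def using Zs(3) bW0 by (intro mult_left_mono diff_left_mono divide_left_mono) auto
    have "\<Delta> * of_int (U n) - (\<Sum>j\<le>j0. of_nat (n choose j) * e j) * of_real \<rho> ^ n
       = \<Delta> * (of_int (U n) - poly (a \<alpha>) (of_nat n) * \<alpha> ^ n)"
      unfolding sum[symmetric] D(6)[symmetric] \<alpha>(2) by (simp add: algebra_simps)
    also have "norm \<dots> \<le> real (bF X) * (x * (real (bG X) * (real n + 1) ^ X * g ^ n))"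
      unfolding norm_mult
    proof (rule mult_mono)
      show "norm \<Delta> \<le> real (bF X)" by (rule hgt_norm_le[OF D(4) k_pos]) simp
      show "norm (of_int (U n) - poly (a \<alpha>) (of_nat n) * \<alpha> ^ n) \<le> x * (real (bG X) * (real n + 1) ^ X * g ^ n)"
        by (rule rest_bound[OF \<alpha>(1) g0]) (use dominant_gap[OF \<alpha>(1,2)] dom in \<open>auto simp: g_def\<close>)
    qed auto
    also have "\<dots> = real (bH X) * (real n + 1) ^ X * g ^ n" by (simp add: bH_def)
    also have "\<dots> \<le> real Z * (real n + 1) ^ Z * (\<bar>\<rho>\<bar> * (1 - 1 / real Z)) ^ n"
      by (intro mult_mono power_mono power_increasing gZ g0) (use Zs XX g0 in auto)
    finally show "norm (\<Delta> * of_int (U n) - (\<Sum>j\<le>j0. of_nat (n choose j) * e j) * of_real \<rho> ^ n)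
        \<le> real Z * (real n + 1) ^ Z * (\<bar>\<rho>\<bar> * (1 - 1 / real Z)) ^ n" .
  qed
qed

end

section \<open>Differences of terms of dominant sequences\<close>

text \<open>The first summand makes \<open>A_approx\<close> available at \<open>n\<close> and still
  at \<open>n / 2\<close>. The second is \<open>(40 * Z^2 * p)^2\<close>: then
  \<open>sqrt n \<ge> 40 * Z^2 * p\<close>, and \<open>ln (n + 1) \<le> 4 * sqrt n\<close> absorbs
  the polynomial factors.\<close>

definition n_large :: "nat \<Rightarrow> nat \<Rightarrow> nat" where
  "n_large Z p = 64 * Z ^ (Z + 4) + 1600 * Z ^ 4 * p\<^sup>2"

locale dom_seq =
  fixes Z d :: nat and v :: "nat \<Rightarrow> complex" and i0 :: nat and U :: "nat \<Rightarrow> int"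
    and \<rho> :: real and \<Delta> :: complex and e :: "nat \<Rightarrow> complex" and j0 :: nat
  assumes data: "dominant_data Z d v U \<rho> \<Delta> e j0"
    and v: "i0 < d" "v i0 \<noteq> 0" and Z: "1000 \<le> Z" "d \<le> Z"
begin

abbreviation "z \<equiv> real Z"
abbreviation "lam \<equiv> \<bar>\<rho>\<bar>"

definition A :: "nat \<Rightarrow> complex" where "A n = (\<Sum>j\<le>j0. of_nat (n choose j) * e j)"

lemma z: "1000 \<le> z" using Z by simp

lemma z_pow: "1 \<le> z ^ m" using z by simp

lemma hgts: "hgt d v z (of_real \<rho>)" "hgt d v z \<Delta>" "\<And>j. j \<le> j0 \<Longrightarrow> hgt d v z (e j)"
  and nonzero: "\<Delta> \<noteq> 0" "e j0 \<noteq> 0" and j0: "j0 < Z" and lam_ge: "1 + 1 / z \<le> lam"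
  and remainder: "norm (\<Delta> * of_int (U n) - A n * of_real \<rho> ^ n) \<le> z * (real n + 1) ^ Z * (lam * (1 - 1 / z)) ^ n"
  using data unfolding dominant_data_def A_def by auto

lemma lam_le: "lam \<le> z"
  using hgt_norm_le[OF hgts(1) v] by simp

lemma lam_pos: "1 \<le> lam" "0 < lam"
proof -
  have "0 < 1 / z" using z by simp
  then show "1 \<le> lam" "0 < lam" using lam_ge by linarith+
qed

lemma exp_le_lam: "exp (1 / (2 * z)) \<le> lam"
proof -
  have "exp (1 / (2 * z)) \<le> 1 + 2 * (1 / (2 * z))"
    using exp_bound_lemma[of "1 / (2 * z)"] z by simp
  then show ?thesis using lam_ge z by simp
qed

lemma liouville_z:
  assumes "hgt d v z w" "w \<noteq> 0"
  shows "1 \<le> norm w * z ^ Z"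
proof -
  have "1 \<le> norm w * z ^ (d - 1)" by (rule hgt_liouville[OF assms(1) v]) (use z assms in auto)
  also have "\<dots> \<le> norm w * z ^ Z" by (intro mult_left_mono power_increasing) (use Z z in auto)
  finally show ?thesis .
qed

lemma hgt_A: "hgt d v (z\<^sup>2 * (real n + 1) ^ Z) (A n)"
proof (rule hgt_mono)
  show "hgt d v (\<Sum>j\<le>j0. (real n + 1) ^ Z * z) (A n)"
    unfolding A_def
  proof (rule hgt_sum)
    fix j assume "j \<in> {..j0}"
    then have j: "j \<le> j0" by simp
    have "hgt d v ((real n + 1) ^ Z) (of_int (int (n choose j)))"
      by (rule hgt_of_int) (use choose_le_Suc_power[of j Z n] j j0 in simp)
    then have "hgt d v ((real n + 1) ^ Z) (of_nat (n choose j))" by simp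
    then show "hgt d v ((real n + 1) ^ Z * z) (of_nat (n choose j) * e j)"
      by (intro hgt_mult hgts j)
  qed simp
  have "(\<Sum>j\<le>j0. (real n + 1) ^ Z * z) = real (j0 + 1) * ((real n + 1) ^ Z * z)" by simp
  also have "\<dots> \<le> z * ((real n + 1) ^ Z * z)" by (intro mult_right_mono) (use j0 in auto)
  finally show "(\<Sum>j\<le>j0. (real n + 1) ^ Z * z) \<le> z\<^sup>2 * (real n + 1) ^ Z"
    by (simp add: power2_eq_square mult_ac)
qed

lemma norm_A_le: "norm (A n) \<le> z\<^sup>2 * (real n + 1) ^ Z"
  by (rule hgt_norm_le[OF hgt_A v])

definition b :: "nat \<Rightarrow> real" where "b n = real (n choose j0) * norm (e j0)"

lemma b_mono: "n1 \<le> n \<Longrightarrow> b n1 \<le> b n"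
  unfolding b_def using binomial_right_mono[of n1 n j0] by (intro mult_right_mono) auto

text \<open>A binomial below the top index is smaller by a factor of order \<open>n\<close>, since
  \<open>(n - j) * (n choose j) = (j + 1) * (n choose (j + 1))\<close> and binomials increase up to
  the middle.\<close>

lemma choose_lower:
  assumes "j < j0" "2 * Z \<le> n"
  shows "real (n choose j) * (real n / 2) \<le> z * real (n choose j0)"
proof -
  have "real n / 2 \<le> real (n - j)" using assms j0 by simp
  then have "real (n choose j) * (real n / 2) \<le> real (n choose j) * real (n - j)"
    by (rule mult_left_mono) simp
  also have "\<dots> = real ((n - j) * (n choose j))" by simp
  also have "(n - j) * (n choose j) = Suc j * (n choose Suc j)"
    using binomial_absorb_comp[of n j] Suc_times_binomial_eq[of "n - 1" j] assms
    by (metis Suc_diff_1 Suc_times_binomial binomial_absorption j0 less_nat_zero_code linorder_neqE_nat mult_is_0 not_less_zero order_less_le_trans zero_less_Suc zero_less_mult_iff)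
  also have "real (Suc j * (n choose Suc j)) \<le> z * real (n choose j0)"
  proof -
    have "n choose Suc j \<le> n choose j0" by (rule binomial_mono) (use assms j0 in auto)
    then have "real (n choose Suc j) \<le> real (n choose j0)" by simp
    moreover have "real (Suc j) \<le> z" using assms j0 by simp
    ultimately show ?thesis unfolding of_nat_mult by (intro mult_mono) auto
  qed
  finally show ?thesis .
qed

text \<open>The top binomial outweighs the others by a factor of order \<open>n\<close>, and
  Liouville's inequality keeps its coefficient \<open>e j0\<close> away from 0.\<close>

lemma A_approx:
  assumes n: "32 * Z ^ (Z + 4) \<le> n"
  shows "\<bar>norm (A n) - b n\<bar> \<le> b n * (1 / (16 * z))"
proof -
  have nz: "32 * z ^ (Z + 4) \<le> real n" using of_nat_mono[OF n, where 'a = real] by simp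
  have "2 * Z \<le> 32 * Z ^ (Z + 4)"
    using self_le_power[of Z "Z + 4"] Z by simp
  then have n2: "2 * Z \<le> n" using n by linarith
  have n0: "0 < real n" using n2 Z by simp
  have "A n - of_nat (n choose j0) * e j0 = (\<Sum>j<j0. of_nat (n choose j) * e j)"
    unfolding A_def by (simp flip: lessThan_Suc_atMost)
  then have "norm (A n - of_nat (n choose j0) * e j0) \<le> (\<Sum>j<j0. real (n choose j) * z)"
    by (simp only:) (rule sum_norm_le, auto simp: norm_mult intro!: mult_left_mono hgt_norm_le[OF hgts(3) v])
  then have "norm (A n - of_nat (n choose j0) * e j0) * (real n / 2) \<le> (\<Sum>j<j0. real (n choose j) * z) * (real n / 2)"
    by (rule mult_right_mono) simp
  also have "\<dots> = (\<Sum>j<j0. real (n choose j) * (real n / 2)) * z"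
    unfolding sum_distrib_right by (rule sum.cong[OF refl]) (simp only: mult_ac)
  also have "\<dots> \<le> (\<Sum>j<j0. z * real (n choose j0)) * z"
    by (intro mult_right_mono sum_mono choose_lower n2) auto
  also have "\<dots> = real j0 * (z * z * real (n choose j0))" by simp
  also have "\<dots> \<le> z * (z * z * real (n choose j0))" by (intro mult_right_mono) (use j0 in auto)
  also have "\<dots> = z ^ 3 * real (n choose j0) * 1" by (simp add: eval_nat_numeral)
  also have "\<dots> \<le> z ^ 3 * real (n choose j0) * (norm (e j0) * z ^ Z)"
    by (intro mult_left_mono liouville_z hgts nonzero) auto
  also have "\<dots> = b n * z ^ (Z + 3)" by (simp add: b_def power_add mult_ac)
  finally have "norm (A n - of_nat (n choose j0) * e j0) * (real n / 2) \<le> b n * z ^ (Z + 3)" .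
  moreover have "z ^ (Z + 3) \<le> (1 / (16 * z)) * (real n / 2)"
    using nz z by (simp add: field_simps power_add eval_nat_numeral)
  then have "b n * z ^ (Z + 3) \<le> b n * ((1 / (16 * z)) * (real n / 2))"
    by (rule mult_left_mono) (simp add: b_def)
  ultimately have "norm (A n - of_nat (n choose j0) * e j0) * (real n / 2) \<le> b n * ((1 / (16 * z)) * (real n / 2))"
    by linarith
  then have "norm (A n - of_nat (n choose j0) * e j0) * (real n / 2) \<le> (b n * (1 / (16 * z))) * (real n / 2)"
    by (simp only: mult.assoc)
  then have 1: "norm (A n - of_nat (n choose j0) * e j0) \<le> b n * (1 / (16 * z))"
    using n0 by (subst (asm) mult_le_cancel_right_pos) auto
  have "\<bar>norm (A n) - norm (of_nat (n choose j0) * e j0)\<bar> \<le> norm (A n - of_nat (n choose j0) * e j0)"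
    by (rule norm_triangle_ineq3)
  also note 1
  finally show ?thesis by (simp add: b_def norm_mult)
qed

lemma t_small: "0 < 1 / (16 * z)" "1 / (16 * z) \<le> 1 / 2"
  using z by (auto simp: field_simps)

lemma A_ge:
  assumes "32 * Z ^ (Z + 4) \<le> n"
  shows "1 \<le> norm (A n) * (2 * z ^ Z)"
proof -
  have "Z \<le> Z ^ (Z + 4)" by (rule self_le_power) (use Z in auto)
  then have "j0 \<le> n" using assms j0 by linarith
  then have "1 \<le> n choose j0" by (simp add: Suc_le_eq)
  then have "1 * norm (e j0) \<le> b n" unfolding b_def by (intro mult_right_mono) auto
  moreover have "b n - b n * (1 / 2) \<le> norm (A n)"
  proof -
    have "b n * (1 / (16 * z)) \<le> b n * (1 / 2)" by (intro mult_left_mono t_small) (simp add: b_def)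
    then show ?thesis using A_approx[OF assms] by linarith
  qed
  ultimately have "norm (e j0) \<le> 2 * norm (A n)" by linarith
  then have "norm (e j0) * z ^ Z \<le> 2 * norm (A n) * z ^ Z" by (rule mult_right_mono) simp
  then show ?thesis using liouville_z[OF hgts(3)[OF order_refl] nonzero(2)] by simp
qed

text \<open>\<open>b\<close> increases, so \<open>A\<close> nearly does in modulus. The slack
  \<open>1 / (4 * z)\<close> is chosen below the growth \<open>1 / z\<close> of \<open>lam\<close>;
  this prevents cancellation in \<open>representation_aux\<close>.\<close>

lemma A_ratio:
  assumes "32 * Z ^ (Z + 4) \<le> n1" "n1 \<le> n"
  shows "norm (A n1) \<le> (1 + 1 / (4 * z)) * norm (A n)"
proof -
  define t where "t = 1 / (16 * z)"
  have t: "0 < t" "t \<le> 1 / 2" using t_small by (auto simp: t_def)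
  have "norm (A n1) \<le> b n1 + b n1 * t" using A_approx[OF assms(1)] by (simp add: t_def)
  also have "\<dots> = b n1 * (1 + t)" by (simp add: algebra_simps)
  also have "\<dots> \<le> b n * (1 + t)" by (intro mult_right_mono b_mono assms) (use t in auto)
  also have "\<dots> \<le> b n * ((1 + 4 * t) * (1 - t))"
  proof (intro mult_left_mono)
    have "t * t \<le> t * (1 / 2)" using t by (intro mult_left_mono) auto
    then show "1 + t \<le> (1 + 4 * t) * (1 - t)" by (simp add: algebra_simps)
  qed (simp add: b_def)
  also have "\<dots> = (1 + 4 * t) * (b n - b n * t)" by (simp add: algebra_simps)
  also have "\<dots> \<le> (1 + 4 * t) * norm (A n)"
  proof (rule mult_left_mono)
    show "b n - b n * t \<le> norm (A n)"
      using A_approx[of n] assms by (simp add: t_def abs_le_iff)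
  qed (use t in auto)
  finally show ?thesis by (simp add: t_def)
qed

text \<open>Uniform in \<open>m \<le> n\<close> although \<open>lam * (1 - 1 / z)\<close> may lie on
  either side of 1: if it is below 1, the base \<open>lam * exp (- (1 / (2 * z)))\<close> is still
  at least 1 by \<open>exp_le_lam\<close>.\<close>

lemma remainder_le:
  assumes "m \<le> n"
  shows "norm (\<Delta> * of_int (U m) - A m * of_real \<rho> ^ m) \<le> z * (real n + 1) ^ Z * (lam ^ n * exp (- (real n / (2 * z))))"
proof -
  have z0: "0 \<le> 1 - 1 / z" using z by simp
  have g0: "0 \<le> lam * (1 - 1 / z)" using z0 by simp
  have E: "(lam * exp (- (1 / (2 * z)))) ^ n = lam ^ n * exp (- (real n / (2 * z)))" for n
    by (simp add: power_mult_distrib flip: exp_of_nat_mult)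
  have "(lam * (1 - 1 / z)) ^ m \<le> (lam * exp (- (1 / (2 * z)))) ^ n"
  proof (cases "1 \<le> lam * (1 - 1 / z)")
    case True
    have "(lam * (1 - 1 / z)) ^ m \<le> (lam * (1 - 1 / z)) ^ n" by (rule power_increasing[OF assms True])
    also have "\<dots> \<le> (lam * exp (- (1 / (2 * z)))) ^ n"
    proof (intro power_mono mult_left_mono g0)
      have "1 - 1 / z \<le> exp (- (1 / z))" using exp_ge_add_one_self[of "- (1 / z)"] by simp
      also have "\<dots> \<le> exp (- (1 / (2 * z)))" using z by (simp add: field_simps)
      finally show "1 - 1 / z \<le> exp (- (1 / (2 * z)))" .
    qed auto
    finally show ?thesis .
  next
    case False
    then have "(lam * (1 - 1 / z)) ^ m \<le> 1" by (intro power_le_one g0) auto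
    also have "1 \<le> (lam * exp (- (1 / (2 * z)))) ^ n"
    proof (rule one_le_power)
      have "exp (1 / (2 * z)) * exp (- (1 / (2 * z))) \<le> lam * exp (- (1 / (2 * z)))"
        by (intro mult_right_mono exp_le_lam) simp
      then show "1 \<le> lam * exp (- (1 / (2 * z)))" by (simp flip: exp_add)
    qed
    finally show ?thesis .
  qed
  then have 1: "(lam * (1 - 1 / z)) ^ m \<le> lam ^ n * exp (- (real n / (2 * z)))" by (simp only: E)
  have "norm (\<Delta> * of_int (U m) - A m * of_real \<rho> ^ m) \<le> z * (real m + 1) ^ Z * (lam * (1 - 1 / z)) ^ m"
    by (rule remainder)
  also have "\<dots> \<le> z * (real n + 1) ^ Z * (lam ^ n * exp (- (real n / (2 * z))))"
    by (intro mult_mono power_mono 1) (use assms g0 in auto)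
  finally show ?thesis .
qed

lemma difference_upper:
  assumes "n1 < n"
  shows "\<bar>real_of_int (U n - U n1)\<bar> \<le> exp (4 * z\<^sup>2 + 2 * z * real n)"
proof -
  let ?P = "(real n + 1) ^ Z * lam ^ n"
  have P0: "0 \<le> ?P" by simp
  have each: "norm (\<Delta> * of_int (U m)) \<le> 2 * z\<^sup>2 * ?P" if "m \<le> n" for m
  proof -
    have "norm (\<Delta> * of_int (U m)) \<le> norm (\<Delta> * of_int (U m) - A m * of_real \<rho> ^ m) + norm (A m * of_real \<rho> ^ m)"
      by (metis diff_add_cancel norm_triangle_ineq)
    also have "\<dots> \<le> z * (real n + 1) ^ Z * (lam ^ n * 1) + z\<^sup>2 * (real n + 1) ^ Z * lam ^ n"
    proof (rule add_mono)
      show "norm (\<Delta> * of_int (U m) - A m * of_real \<rho> ^ m) \<le> z * (real n + 1) ^ Z * (lam ^ n * 1)"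
        by (rule order_trans[OF remainder_le[OF that]]) (intro mult_left_mono, auto)
      have "norm (A m) \<le> z\<^sup>2 * (real n + 1) ^ Z"
        by (rule order_trans[OF norm_A_le]) (intro mult_left_mono power_mono, use that in auto)
      moreover have "lam ^ m \<le> lam ^ n" by (rule power_increasing[OF that lam_pos(1)])
      ultimately show "norm (A m * of_real \<rho> ^ m) \<le> z\<^sup>2 * (real n + 1) ^ Z * lam ^ n"
        unfolding norm_mult norm_power norm_of_real by (intro mult_mono) auto
    qed
    also have "\<dots> = (z + z\<^sup>2) * ?P" by (simp add: algebra_simps)
    also have "\<dots> \<le> (2 * z\<^sup>2) * ?P"
    proof (intro mult_right_mono P0)
      show "z + z\<^sup>2 \<le> 2 * z\<^sup>2" using z mult_right_mono[of 1 z z] by (simp add: power2_eq_square)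
    qed
    finally show ?thesis .
  qed
  have "norm (\<Delta> * of_int (U n - U n1)) = norm (\<Delta> * of_int (U n) - \<Delta> * of_int (U n1))" by (simp add: algebra_simps)
  also have "\<dots> \<le> norm (\<Delta> * of_int (U n)) + norm (\<Delta> * of_int (U n1))" by (rule norm_triangle_ineq4)
  also have "\<dots> \<le> 2 * z\<^sup>2 * ?P + 2 * z\<^sup>2 * ?P" by (intro add_mono each) (use assms in auto)
  finally have D0: "norm (\<Delta> * of_int (U n - U n1)) \<le> 2 * z\<^sup>2 * ?P + 2 * z\<^sup>2 * ?P" .
  have D: "norm \<Delta> * \<bar>real_of_int (U n - U n1)\<bar> \<le> 4 * z\<^sup>2 * ?P"
    using D0 unfolding norm_mult norm_of_int by linarith
  have ez: "z \<le> exp z" using exp_ge_add_one_self[of z] by linarith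
  have "1 * \<bar>real_of_int (U n - U n1)\<bar> \<le> (norm \<Delta> * z ^ Z) * \<bar>real_of_int (U n - U n1)\<bar>"
    by (intro mult_right_mono liouville_z hgts nonzero) auto
  also have "\<dots> = z ^ Z * (norm \<Delta> * \<bar>real_of_int (U n - U n1)\<bar>)" by simp
  also have "\<dots> \<le> z ^ Z * (4 * z\<^sup>2 * ?P)" by (intro mult_left_mono D) auto
  also have "z ^ Z * (4 * z\<^sup>2 * ?P) \<le> exp z ^ Z * (exp z * exp z ^ 2 * (exp (real n) ^ Z * exp z ^ n))"
  proof (intro mult_mono power_mono)
    show "4 \<le> exp z" using ez z by linarith
    show "real n + 1 \<le> exp (real n)" using exp_ge_add_one_self[of "real n"] by linarith
    show "lam \<le> exp z" using lam_le ez by linarith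
  qed (use ez in auto)
  also have "\<dots> = exp (z * z + (z + 2 * z + (z * real n + real n * z)))"
    by (simp only: exp_add exp_of_nat_mult[symmetric] of_nat_numeral)
  also have "\<dots> \<le> exp (4 * z\<^sup>2 + 2 * z * real n)"
  proof -
    have "3 * z \<le> 3 * (z * z)" using mult_right_mono[of 1 z z] z by simp
    then show ?thesis by (simp add: power2_eq_square algebra_simps)
  qed
  finally show ?thesis by simp
qed

lemma large:
  assumes n: "n_large Z p \<le> n" and p: "1 \<le> p"
  shows "16 * z ^ (Z + 3) * (real n + 1) ^ Z \<le> exp (real n / (4 * z * real p))" "64 * Z ^ (Z + 4) \<le> n"
proof -
  show "64 * Z ^ (Z + 4) \<le> n" using n by (simp add: n_large_def)
  have p1: "1 \<le> real p" using p by simp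
  have "1600 * Z ^ 4 * p\<^sup>2 \<le> n" using n by (simp add: n_large_def)
  from of_nat_mono[OF this, where 'a = real] have "(40 * z\<^sup>2 * real p)\<^sup>2 \<le> real n"
    by (simp add: power_mult_distrib flip: power_mult)
  then have s: "40 * z\<^sup>2 * real p \<le> sqrt (real n)" by (rule real_le_rsqrt)
  have zz: "1000 * z \<le> z\<^sup>2" using mult_right_mono[of 1000 z z] z by (simp add: power2_eq_square)
  have "z\<^sup>2 * 1 \<le> z\<^sup>2 * real p" by (rule mult_left_mono[OF p1]) simp
  then have s1: "40 * z\<^sup>2 \<le> sqrt (real n)" using s by linarith
  have s2: "1 \<le> sqrt (real n)" using s1 zz z by linarith
  have n1: "1 \<le> real n" using s2 by simp
  have lnn: "ln (real n + 1) \<le> 4 * sqrt (real n)"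
  proof -
    have "ln (real n + 1) \<le> 2 * sqrt (real n + 1)" by (rule ln_le_two_sqrt) simp
    also have "\<dots> \<le> 2 * sqrt (4 * real n)" using n1 by (intro mult_left_mono real_sqrt_le_mono) auto
    also have "\<dots> = 4 * sqrt (real n)" by (simp add: real_sqrt_mult)
    finally show ?thesis .
  qed
  have "16 * z ^ (Z + 3) * (real n + 1) ^ Z = exp (ln (16 * z ^ (Z + 3) * (real n + 1) ^ Z))"
    using z by simp
  also have "ln (16 * z ^ (Z + 3) * (real n + 1) ^ Z) = ln 16 + real (Z + 3) * ln z + z * ln (real n + 1)"
    using z by (simp add: ln_mult ln_realpow)
  also have "\<dots> \<le> 16 + (z + 3) * z + z * (4 * sqrt (real n))"
    using ln_le_minus_one[of 16] ln_le_minus_one[of z] z lnn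
    by (intro add_mono mult_mono) auto
  also have "\<dots> \<le> 10 * z * sqrt (real n)"
  proof -
    have "z * (40 * z\<^sup>2) \<le> z * sqrt (real n)" by (rule mult_left_mono[OF s1]) simp
    moreover have "1000 * z\<^sup>2 \<le> z * z\<^sup>2" by (rule mult_right_mono) (use z in auto)
    moreover have "(z + 3) * z = z\<^sup>2 + 3 * z" by (simp add: power2_eq_square algebra_simps)
    ultimately show ?thesis using zz z by linarith
  qed
  also have "\<dots> = (40 * z\<^sup>2 * real p) * sqrt (real n) / (4 * z * real p)"
    using z p1 by (simp add: power2_eq_square)
  also have "\<dots> \<le> sqrt (real n) * sqrt (real n) / (4 * z * real p)"
    by (intro divide_right_mono mult_right_mono s) (use z p1 in auto)
  also have "\<dots> = real n / (4 * z * real p)" by simp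
  finally show "16 * z ^ (Z + 3) * (real n + 1) ^ Z \<le> exp (real n / (4 * z * real p))" by simp
qed

text \<open>Two ways to obtain a main term. If \<open>n - n1\<close> is at least
  \<open>n / p'\<close>, the term of \<open>n1\<close> is negligible and \<open>u = A n\<close>. If
  it is at most \<open>n / p\<close>, both terms are kept in
  \<open>u = A n * \<rho> ^ (n - n1) - A n1\<close>. The error depends on \<open>p'\<close> and the
  height on \<open>p\<close>, so \<open>p\<close> much larger than \<open>p'\<close> makes the
  height small relative to the precision.\<close>

lemma representation_aux:
  assumes n: "n1 < n" "n_large Z p \<le> n" and p: "2 \<le> p'" "p' \<le> p"
    and x: "n \<le> p' * (n - n1) \<or> p * (n - n1) \<le> n"
  shows "\<exists>u m. n \<le> 2 * m \<and> m \<le> n \<and> hgt d v (exp (2 * z * real n / real p)) u \<and>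
    lam ^ n \<le> 8 * z ^ (Z + 1) * norm (u * of_real \<rho> ^ m) \<and>
    norm (\<Delta> * of_int (U n - U n1) - u * of_real \<rho> ^ m) \<le> exp (- (real n / (4 * z * real p'))) * norm (u * of_real \<rho> ^ m)"
proof -
  define x where "x = n - n1"
  define G where "G = exp (real n / (4 * z * real p))"
  define P where "P = (real n + 1) ^ Z"
  have p1: "1 \<le> p" "2 \<le> real p'" "2 \<le> real p" "real p' \<le> real p" using p by auto
  have G: "16 * z ^ (Z + 3) * P \<le> G" "64 * Z ^ (Z + 4) \<le> n"
    using large[OF n(2) p1(1)] by (auto simp: G_def P_def)
  have P1: "1 \<le> P" by (simp add: P_def)
  have P0: "0 \<le> P" using P1 by linarith
  have nn: "n = n1 + x" using n by (simp add: x_def)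
  have lx: "lam ^ n = lam ^ n1 * lam ^ x" by (simp add: nn power_add)
  have z3: "z ^ m \<le> z ^ (Z + 3)" if "m \<le> Z + 3" for m by (rule power_increasing[OF that]) (use z in auto)
  have Gsmall: "c * z ^ m * P \<le> G" if "m \<le> Z + 3" "0 \<le> c" "c \<le> 16" for m c
  proof -
    have "c * z ^ m * P \<le> 16 * z ^ (Z + 3) * P" by (intro mult_right_mono mult_mono z3 that P0) auto
    then show ?thesis using G(1) by linarith
  qed
  have E: "norm (\<Delta> * of_int (U n - U n1) - (A n * of_real \<rho> ^ n - A n1 * of_real \<rho> ^ n1)) \<le> 2 * z * P * (lam ^ n * exp (- (real n / (2 * z))))"
  proof -
    have "\<Delta> * of_int (U n - U n1) - (A n * of_real \<rho> ^ n - A n1 * of_real \<rho> ^ n1)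
       = (\<Delta> * of_int (U n) - A n * of_real \<rho> ^ n) - (\<Delta> * of_int (U n1) - A n1 * of_real \<rho> ^ n1)"
      by (simp add: algebra_simps)
    also have "norm \<dots> \<le> norm (\<Delta> * of_int (U n) - A n * of_real \<rho> ^ n) + norm (\<Delta> * of_int (U n1) - A n1 * of_real \<rho> ^ n1)"
      by (rule norm_triangle_ineq4)
    also have "\<dots> \<le> z * P * (lam ^ n * exp (- (real n / (2 * z)))) + z * P * (lam ^ n * exp (- (real n / (2 * z))))"
      unfolding P_def by (intro add_mono remainder_le) (use n in auto)
    finally show ?thesis by (simp add: mult_ac)
  qed
  have zP: "z\<^sup>2 * P \<le> G" using Gsmall[of 2 1] by simp
  have exp_half: "exp (- (real n / (2 * z))) \<le> exp (- (real n / (2 * z * real p')))"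
  proof -
    have "real n * 1 \<le> real n * real p'" by (rule mult_left_mono) (use p1 in auto)
    then show ?thesis using z p1 by (simp add: field_simps)
  qed
  have G_exp: "G * exp (- (real n / (2 * z * real p'))) \<le> exp (- (real n / (4 * z * real p')))"
  proof -
    have "real n / (4 * z * real p) \<le> real n / (4 * z * real p')"
      using z p1 by (intro divide_left_mono mult_left_mono) auto
    moreover have "real n / (2 * z * real p') = 2 * (real n / (4 * z * real p'))" using z p1 by (simp add: field_simps)
    ultimately show ?thesis by (simp add: G_def flip: exp_add)
  qed
  show ?thesis
  proof (cases "n \<le> p' * x")
    case True
    have nx: "real n \<le> real p' * real x" using of_nat_mono[OF True, where 'a = real] by simp
    have A1: "1 \<le> norm (A n) * (2 * z ^ Z)" by (rule A_ge) (use G(2) in simp)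
    show ?thesis
    proof (intro exI[of _ "A n"] exI[of _ n] conjI)
      show "hgt d v (exp (2 * z * real n / real p)) (A n)"
      proof (rule hgt_mono[OF hgt_A])
        have "z\<^sup>2 * (real n + 1) ^ Z \<le> G" using zP by (simp add: P_def)
        also have "\<dots> \<le> exp (2 * z * real n / real p)"
        proof -
          have "1 \<le> 8 * (z * z)" using z mult_mono[of 1 z 1 z] by simp
          then have "real n * 1 \<le> real n * (8 * (z * z))" by (rule mult_left_mono) simp
          then show ?thesis unfolding G_def using z p1 by (simp add: field_simps)
        qed
        finally show "z\<^sup>2 * (real n + 1) ^ Z \<le> exp (2 * z * real n / real p)" .
      qed
      have "lam ^ n * 1 \<le> lam ^ n * (norm (A n) * (2 * z ^ Z))" by (rule mult_left_mono[OF A1]) simp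
      also have "\<dots> \<le> lam ^ n * (norm (A n) * (8 * z ^ (Z + 1)))"
        by (intro mult_left_mono mult_mono power_increasing) (use z in auto)
      finally show "lam ^ n \<le> 8 * z ^ (Z + 1) * norm (A n * of_real \<rho> ^ n)"
        by (simp add: norm_mult norm_power mult_ac)
      have "norm (\<Delta> * of_int (U n - U n1) - A n * of_real \<rho> ^ n)
        \<le> norm (\<Delta> * of_int (U n - U n1) - (A n * of_real \<rho> ^ n - A n1 * of_real \<rho> ^ n1)) + norm (A n1 * of_real \<rho> ^ n1)"
        using norm_triangle_ineq4[of "\<Delta> * of_int (U n - U n1) - (A n * of_real \<rho> ^ n - A n1 * of_real \<rho> ^ n1)" "A n1 * of_real \<rho> ^ n1"]
        by (simp add: algebra_simps)
      also have "\<dots> \<le> 2 * z * P * (lam ^ n * exp (- (real n / (2 * z * real p')))) + z\<^sup>2 * P * (lam ^ n * exp (- (real n / (2 * z * real p'))))"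
      proof (rule add_mono)
        show "norm (\<Delta> * of_int (U n - U n1) - (A n * of_real \<rho> ^ n - A n1 * of_real \<rho> ^ n1)) \<le> 2 * z * P * (lam ^ n * exp (- (real n / (2 * z * real p'))))"
          by (rule order_trans[OF E]) (intro mult_left_mono exp_half, use P0 in auto)
        have "lam ^ n1 \<le> lam ^ n * exp (- (real n / (2 * z * real p')))"
        proof -
          have "exp (real n / (2 * z * real p')) \<le> exp (real x / (2 * z))"
            using nx z p1 by (simp add: field_simps)
          also have "\<dots> = exp (1 / (2 * z)) ^ x" by (simp flip: exp_of_nat_mult)
          also have "\<dots> \<le> lam ^ x" by (intro power_mono exp_le_lam) simp
          finally have "lam ^ n1 * exp (real n / (2 * z * real p')) \<le> lam ^ n"
            unfolding lx by (intro mult_left_mono) auto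
          then have "lam ^ n1 * exp (real n / (2 * z * real p')) * exp (- (real n / (2 * z * real p'))) \<le> lam ^ n * exp (- (real n / (2 * z * real p')))"
            by (rule mult_right_mono) simp
          then show ?thesis by (simp add: mult.assoc flip: exp_add)
        qed
        moreover have "norm (A n1) \<le> z\<^sup>2 * P"
          unfolding P_def by (rule order_trans[OF norm_A_le]) (intro mult_left_mono power_mono, use n in auto)
        ultimately show "norm (A n1 * of_real \<rho> ^ n1) \<le> z\<^sup>2 * P * (lam ^ n * exp (- (real n / (2 * z * real p'))))"
          unfolding norm_mult norm_power norm_of_real using P0 by (intro mult_mono) auto
      qed
      also have "\<dots> = (2 * z + z\<^sup>2) * P * (exp (- (real n / (2 * z * real p'))) * (lam ^ n * 1))" by (simp add: algebra_simps)
      also have "\<dots> \<le> (2 * z\<^sup>2) * P * (exp (- (real n / (2 * z * real p'))) * (lam ^ n * (norm (A n) * (2 * z ^ Z))))"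
      proof (intro mult_mono A1 order_refl)
        show "2 * z + z\<^sup>2 \<le> 2 * z\<^sup>2" using mult_right_mono[of 2 z z] z by (simp add: power2_eq_square)
      qed (use P0 in auto)
      also have "\<dots> = (4 * z ^ (Z + 2) * P) * exp (- (real n / (2 * z * real p'))) * norm (A n * of_real \<rho> ^ n)"
        by (simp add: norm_mult norm_power power_add power2_eq_square mult_ac)
      also have "\<dots> \<le> G * exp (- (real n / (2 * z * real p'))) * norm (A n * of_real \<rho> ^ n)"
        by (intro mult_right_mono Gsmall) auto
      also have "\<dots> \<le> exp (- (real n / (4 * z * real p'))) * norm (A n * of_real \<rho> ^ n)"
        by (intro mult_right_mono G_exp) auto
      finally show "norm (\<Delta> * of_int (U n - U n1) - A n * of_real \<rho> ^ n) \<le> exp (- (real n / (4 * z * real p'))) * norm (A n * of_real \<rho> ^ n)" .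
    qed auto
  next
    case False
    then have px: "p * x \<le> n" using x by (simp add: x_def)
    have pxr: "real p * real x \<le> real n" using of_nat_mono[OF px, where 'a = real] by simp
    have "2 * x \<le> p * x" using p by (intro mult_right_mono) auto
    then have n12: "n \<le> 2 * n1" using px nn by linarith
    have n1_large: "32 * Z ^ (Z + 4) \<le> n1" using n12 G(2) by linarith
    have x1: "1 \<le> x" using n by (simp add: x_def)
    define u where "u = A n * of_real \<rho> ^ x - A n1"
    have A1: "1 \<le> norm (A n) * (2 * z ^ Z)" by (rule A_ge) (use G(2) in simp)
    have ur: "u * of_real \<rho> ^ n1 = A n * of_real \<rho> ^ n - A n1 * of_real \<rho> ^ n1"
      by (simp add: u_def nn power_add algebra_simps)
    \<comment> \<open>No cancellation: the growth \<open>1 + 1 / z\<close> outweighs the ratio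
      \<open>1 + 1 / (4 * z)\<close> of \<open>A_ratio\<close> and leaves the share
      \<open>1 / (4 * z)\<close>.\<close>
    have u_ge: "norm (A n) * lam ^ x \<le> 4 * z * norm u"
    proof -
      have "1 + 1 / z \<le> lam ^ 1" using lam_ge by simp
      also have "\<dots> \<le> lam ^ x" by (rule power_increasing[OF x1 lam_pos(1)])
      finally have l: "1 + 1 / z \<le> lam ^ x" .
      have "1 + 1 / (4 * z) \<le> (1 + 1 / z) * (1 - 1 / (4 * z))"
        using z by (simp add: field_simps)
      also have "\<dots> \<le> lam ^ x * (1 - 1 / (4 * z))" by (rule mult_right_mono[OF l]) (use z in auto)
      finally have "norm (A n) * (1 + 1 / (4 * z)) \<le> norm (A n) * (lam ^ x * (1 - 1 / (4 * z)))"
        by (rule mult_left_mono) simp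
      then have 1: "norm (A n1) \<le> norm (A n) * lam ^ x - norm (A n) * lam ^ x * (1 / (4 * z))"
        using A_ratio[OF n1_large, of n] n by (simp add: algebra_simps)
      have "norm (A n) * lam ^ x - norm (A n1) \<le> norm u"
        unfolding u_def using norm_triangle_ineq2[of "A n * of_real \<rho> ^ x" "A n1"] by (simp add: norm_mult norm_power)
      then have "norm (A n) * lam ^ x * (1 / (4 * z)) \<le> norm u" using 1 by linarith
      then show ?thesis using z by (simp add: field_simps)
    qed
    have low: "lam ^ n \<le> 8 * z ^ (Z + 1) * norm (u * of_real \<rho> ^ n1)"
    proof -
      have "lam ^ n * 1 \<le> lam ^ n * (norm (A n) * (2 * z ^ Z))" by (rule mult_left_mono[OF A1]) simp
      also have "\<dots> = (2 * z ^ Z * lam ^ n1) * (norm (A n) * lam ^ x)" by (simp add: lx mult_ac)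
      also have "\<dots> \<le> (2 * z ^ Z * lam ^ n1) * (4 * z * norm u)" by (intro mult_left_mono u_ge) auto
      finally show ?thesis by (simp add: norm_mult norm_power power_add mult_ac)
    qed
    show ?thesis
    proof (intro exI[of _ u] exI[of _ n1] conjI low n12)
      show "n1 \<le> n" using n by simp
      show "hgt d v (exp (2 * z * real n / real p)) u"
        unfolding u_def
      proof (rule hgt_mono[OF hgt_diff[OF hgt_mult[OF hgt_A hgt_power[OF hgts(1)]] hgt_A]])
        have "(real n1 + 1) ^ Z \<le> P" unfolding P_def by (rule power_mono) (use n in auto)
        then have "z\<^sup>2 * (real n1 + 1) ^ Z * 1 \<le> z\<^sup>2 * P * z ^ x" using P0 z_pow by (intro mult_mono) auto
        then have "z\<^sup>2 * (real n + 1) ^ Z * z ^ x + z\<^sup>2 * (real n1 + 1) ^ Z \<le> 2 * z\<^sup>2 * P * z ^ x"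
          by (simp add: P_def mult_ac)
        also have "\<dots> \<le> G * exp z ^ x"
        proof (intro mult_mono power_mono Gsmall)
          show "z \<le> exp z" using exp_ge_add_one_self[of z] by linarith
        qed (auto simp: G_def)
        also have "\<dots> = exp (real n / (4 * z * real p) + real x * z)" by (simp add: G_def exp_add exp_of_nat_mult)
        also have "\<dots> \<le> exp (2 * z * real n / real p)"
        proof -
          have "real x * z \<le> real n / real p * z" using pxr p1 by (intro mult_right_mono) (auto simp: field_simps)
          moreover have "real n / (4 * z * real p) \<le> real n / real p * z"
          proof -
            have "1 \<le> 4 * (z * z)" using z mult_mono[of 1 z 1 z] by simp
            then have "real n * 1 \<le> real n * (4 * (z * z))" by (rule mult_left_mono) simp
            then show ?thesis using z p1 by (simp add: field_simps)
          qed
          moreover have "2 * z * real n / real p = real n / real p * z + real n / real p * z" by (simp add: field_simps)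
          ultimately have "real n / (4 * z * real p) + real x * z \<le> 2 * z * real n / real p" by linarith
          then show ?thesis by (simp only: exp_le_cancel_iff)
        qed
        finally show "z\<^sup>2 * (real n + 1) ^ Z * z ^ x + z\<^sup>2 * (real n1 + 1) ^ Z \<le> exp (2 * z * real n / real p)" .
      qed
      have "norm (\<Delta> * of_int (U n - U n1) - u * of_real \<rho> ^ n1) \<le> 2 * z * P * (lam ^ n * exp (- (real n / (2 * z))))"
        unfolding ur by (rule E)
      also have "\<dots> \<le> 2 * z * P * ((8 * z ^ (Z + 1) * norm (u * of_real \<rho> ^ n1)) * exp (- (real n / (2 * z * real p'))))"
        by (intro mult_left_mono mult_mono low exp_half) (use P0 in auto)
      also have "\<dots> = (16 * z ^ (Z + 2) * P) * exp (- (real n / (2 * z * real p'))) * norm (u * of_real \<rho> ^ n1)"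
        by (simp add: power_add power2_eq_square mult_ac)
      also have "\<dots> \<le> G * exp (- (real n / (2 * z * real p'))) * norm (u * of_real \<rho> ^ n1)"
        by (intro mult_right_mono Gsmall) auto
      also have "\<dots> \<le> exp (- (real n / (4 * z * real p'))) * norm (u * of_real \<rho> ^ n1)"
        by (intro mult_right_mono G_exp) auto
      finally show "norm (\<Delta> * of_int (U n - U n1) - u * of_real \<rho> ^ n1) \<le> exp (- (real n / (4 * z * real p'))) * norm (u * of_real \<rho> ^ n1)" .
    qed
  qed
qed

text \<open>For \<open>p' = p = 2\<close> one of the two alternatives of
  \<open>representation_aux\<close> always holds, so no choice of scales enters.\<close>

lemma difference_lower:
  assumes n: "n1 < n" "n_large Z 2 \<le> n"
  shows "exp (real n / (4 * z)) \<le> \<bar>real_of_int (U n - U n1)\<bar>"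
proof -
  have dis: "n \<le> 2 * (n - n1) \<or> 2 * (n - n1) \<le> n" by linarith
  obtain u m where um0: "n \<le> 2 * m \<and> m \<le> n \<and> hgt d v (exp (2 * z * real n / real 2)) u \<and>
    lam ^ n \<le> 8 * z ^ (Z + 1) * norm (u * of_real \<rho> ^ m) \<and>
    norm (\<Delta> * of_int (U n - U n1) - u * of_real \<rho> ^ m) \<le> exp (- (real n / (4 * z * real 2))) * norm (u * of_real \<rho> ^ m)"
    using representation_aux[OF n order_refl order_refl dis] by (elim exE)
  note um = um0[THEN conjunct2, THEN conjunct2, THEN conjunct2, THEN conjunct1] um0[THEN conjunct2, THEN conjunct2, THEN conjunct2, THEN conjunct2]
  have G: "16 * z ^ (Z + 3) * (real n + 1) ^ Z \<le> exp (real n / (4 * z * real 2))"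
    using large(1)[OF n(2)] by simp
  have P1: "1 \<le> (real n + 1) ^ Z" by simp
  have G16: "16 * z ^ (Z + 2) \<le> exp (real n / (8 * z))"
  proof -
    have "16 * z ^ (Z + 2) * 1 \<le> 16 * z ^ (Z + 3) * (real n + 1) ^ Z"
      by (intro mult_mono power_increasing P1) (use z in auto)
    then show ?thesis using G by simp
  qed
  have "2 \<le> 16 * z ^ (Z + 2)" using z_pow[of "Z + 2"] by linarith
  then have "2 \<le> exp (real n / (8 * z))" using G16 by linarith
  then have "exp (- (real n / (4 * z * real 2))) \<le> 1 / 2" by (simp add: exp_minus field_simps)
  then have "exp (- (real n / (4 * z * real 2))) * norm (u * of_real \<rho> ^ m) \<le> 1 / 2 * norm (u * of_real \<rho> ^ m)"
    by (rule mult_right_mono) simp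
  then have "norm (u * of_real \<rho> ^ m) \<le> 2 * norm (\<Delta> * of_int (U n - U n1))"
    using um(2) norm_triangle_ineq2[of "u * of_real \<rho> ^ m" "\<Delta> * of_int (U n - U n1)"]
    by (simp add: norm_minus_commute)
  then have "lam ^ n \<le> 8 * z ^ (Z + 1) * (2 * norm (\<Delta> * of_int (U n - U n1)))"
    using um(1) z_pow by (meson mult_left_mono order_trans zero_le_mult_iff zero_le_numeral zero_le_power of_nat_0_le_iff)
  also have "\<dots> = 16 * z ^ (Z + 1) * (norm \<Delta> * \<bar>real_of_int (U n - U n1)\<bar>)"
    unfolding norm_mult norm_of_int by simp
  also have "\<dots> \<le> 16 * z ^ (Z + 1) * (z * \<bar>real_of_int (U n - U n1)\<bar>)"
    by (intro mult_left_mono mult_right_mono hgt_norm_le[OF hgts(2) v]) auto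
  also have "\<dots> = 16 * z ^ (Z + 2) * \<bar>real_of_int (U n - U n1)\<bar>" by simp
  also have "\<dots> \<le> exp (real n / (8 * z)) * \<bar>real_of_int (U n - U n1)\<bar>"
    by (intro mult_right_mono G16) auto
  finally have 1: "lam ^ n \<le> exp (real n / (8 * z)) * \<bar>real_of_int (U n - U n1)\<bar>" .
  have "exp (real n / (8 * z)) * exp (real n / (4 * z)) \<le> exp (real n / (2 * z))"
  proof -
    have "real n / (8 * z) + real n / (4 * z) \<le> real n / (2 * z)" using z by (simp add: field_simps)
    then show ?thesis by (simp flip: exp_add)
  qed
  also have "\<dots> = exp (1 / (2 * z)) ^ n" by (simp flip: exp_of_nat_mult)
  also have "\<dots> \<le> lam ^ n" by (intro power_mono exp_le_lam) simp
  also note 1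
  finally show ?thesis by simp
qed

end

section \<open>Scales, and the bound for the indices\<close>

definition scale_Y :: "nat \<Rightarrow> nat \<Rightarrow> nat" where
  "scale_Y Z p = 1000 * Z ^ 3 * p"

text \<open>At scale \<open>p\<close> the error is \<open>exp (- n / (96 * Z ^ 3 * p))\<close>;
  \<open>scale_Y\<close> replaces 96 by 1000 to leave room for a factor 3. The next scale makes the
  heights at most \<open>N / Y ^ 1280\<close>, as \<open>effective_approximation\<close> demands for
  its exponent \<open>N\<close>, because \<open>2 * 24 / 300\<close> is well below
  \<open>1 / 2\<close>.\<close>

fun scale :: "nat \<Rightarrow> nat \<Rightarrow> nat" where
  "scale Z 0 = 2"
| "scale Z (Suc i) = 300 * Z ^ 3 * scale_Y Z (scale Z i) ^ 1280"

text \<open>Both indices cannot be beyond \<open>n_large\<close>; if just one is,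
  \<open>comparable\<close> bounds it by the first two summands.\<close>

definition final_bound :: "nat \<Rightarrow> nat" where
  "final_bound Z = 16 * Z ^ 3 + 8 * Z\<^sup>2 * n_large Z (scale Z 3) + n_large Z (scale Z 3)"

lemma scale_facts:
  assumes "1000 \<le> Z"
  shows "2 \<le> scale Z i" "scale Z i \<le> scale Z (Suc i)" "4 * Z * scale_Y Z (scale Z i) ^ 1280 \<le> scale Z (Suc i)"
    "scale_Y Z (scale Z i) \<le> scale Z (Suc i)"
proof -
  show 2: "2 \<le> scale Z i" for i
  proof (induction i)
    case (Suc i)
    have "1 \<le> scale_Y Z (scale Z i)" using Suc assms by (simp add: scale_Y_def Suc_le_eq)
    then have "1 \<le> scale_Y Z (scale Z i) ^ 1280" by (rule one_le_power)
    moreover have "2 \<le> 300 * Z ^ 3" using one_le_power[of Z 3] assms by linarith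
    ultimately have "2 * 1 \<le> 300 * Z ^ 3 * scale_Y Z (scale Z i) ^ 1280" by (intro mult_le_mono)
    then show ?case by simp
  qed simp
  have Z3: "Z \<le> Z ^ 3" by (rule self_le_power) (use assms in auto)
  have Y: "scale Z i \<le> scale_Y Z (scale Z i)"
  proof -
    have "1 * scale Z i \<le> 1000 * Z ^ 3 * scale Z i" by (rule mult_right_mono) (use Z3 assms in linarith, simp)
    then show ?thesis by (simp add: scale_Y_def)
  qed
  have Yp: "scale_Y Z (scale Z i) \<le> scale_Y Z (scale Z i) ^ 1280"
    by (rule self_le_power) (use Y 2[of i] in linarith, simp)
  show "4 * Z * scale_Y Z (scale Z i) ^ 1280 \<le> scale Z (Suc i)"
    unfolding scale.simps by (rule mult_right_mono) (use Z3 in linarith, simp)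
  have "1 * scale_Y Z (scale Z i) ^ 1280 \<le> scale Z (Suc i)"
    unfolding scale.simps by (rule mult_right_mono) (use Z3 assms in linarith, simp)
  then show "scale_Y Z (scale Z i) \<le> scale Z (Suc i)" using Yp by linarith
  then show "scale Z i \<le> scale Z (Suc i)" using Y by linarith
qed

lemma scale_mono: "1000 \<le> Z \<Longrightarrow> i \<le> j \<Longrightarrow> scale Z i \<le> scale Z j"
  by (rule lift_Suc_mono_le[of "scale Z"]) (rule scale_facts(2))

text \<open>Each of the two ratios lies in at most one of the three disjoint ranges between consecutive scales.\<close>

lemma good_scale:
  assumes Z: "1000 \<le> Z"
  shows "\<exists>i<3. (n \<le> scale Z i * x \<or> scale Z (Suc i) * x \<le> n) \<and> (m \<le> scale Z i * y \<or> scale Z (Suc i) * y \<le> m)"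
proof (rule ccontr)
  assume "\<not> ?thesis"
  then have bad: "(scale Z i * x < n \<and> n < scale Z (Suc i) * x) \<or> (scale Z i * y < m \<and> m < scale Z (Suc i) * y)" if "i < 3" for i
    using that by (meson not_le)
  have disj: False if "i < j" "n' < scale Z (Suc i) * w" "scale Z j * w < n'" for i j n' w
  proof -
    have "scale Z (Suc i) * w \<le> scale Z j * w" using that(1) by (intro mult_right_mono scale_mono Z) auto
    then show False using that by linarith
  qed
  have "\<not> (scale Z i * x < n \<and> n < scale Z (Suc i) * x \<and> scale Z j * x < n \<and> n < scale Z (Suc j) * x)" if "i < j" for i j
    using disj[OF that] by blast
  moreover have "\<not> (scale Z i * y < m \<and> m < scale Z (Suc i) * y \<and> scale Z j * y < m \<and> m < scale Z (Suc j) * y)" if "i < j" for i j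
    using disj[OF that] by blast
  ultimately show False using bad[of 0] bad[of 1] bad[of 2]
    by (metis less_numeral_extra(1) numeral_3_eq_3 one_less_numeral_iff lessI less_SucI semiring_norm(76) zero_less_numeral zero_less_Suc One_nat_def numeral_2_eq_2)
qed

text \<open>Both differences are exponential in their larger index, up to constants in the exponent;
  equality therefore links the indices linearly.\<close>

lemma comparable:
  assumes U: "dom_seq Z d v i0 U \<alpha> \<Delta> e j0" and V: "dom_seq Z d v i0 V \<beta> \<Delta>' e' j0'"
    and n: "n1 < n" and m: "m1 < m" and eq: "\<bar>U n - U n1\<bar> = \<bar>V m - V m1\<bar>" and nl: "n_large Z 2 \<le> n"
  shows "real n \<le> 16 * real Z ^ 3 + 8 * (real Z)\<^sup>2 * real m"
proof -
  interpret U: dom_seq Z d v i0 U \<alpha> \<Delta> e j0 by (rule U)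
  interpret V: dom_seq Z d v i0 V \<beta> \<Delta>' e' j0' by (rule V)
  have "exp (real n / (4 * real Z)) \<le> \<bar>real_of_int (U n - U n1)\<bar>" by (rule U.difference_lower[OF n nl])
  also have "\<dots> = \<bar>real_of_int (V m - V m1)\<bar>" using eq by (metis of_int_abs)
  also have "\<dots> \<le> exp (4 * (real Z)\<^sup>2 + 2 * real Z * real m)" by (rule V.difference_upper[OF m])
  finally have "real n / (4 * real Z) \<le> 4 * (real Z)\<^sup>2 + 2 * real Z * real m" by simp
  then have "real n \<le> (4 * (real Z)\<^sup>2 + 2 * real Z * real m) * (4 * real Z)"
    using U.z by (simp add: pos_divide_le_eq)
  then show ?thesis by (simp add: algebra_simps eval_nat_numeral)
qed

text \<open>Multiplied by \<open>\<Delta> * \<Delta>'\<close>, the common difference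
  \<open>W\<close> is approximated by both main terms \<open>T\<close> and \<open>S\<close>, so
  these are close to each other. The height of their coefficients stays within the limit of
  \<open>effective_approximation\<close> by the choice of scale.\<close>

theorem solutions_bounded_aux:
  assumes U: "dom_seq Z d v i0 U \<alpha> \<Delta> e j0" and V: "dom_seq Z d v i0 V \<beta> \<Delta>' e' j0'"
    and n: "n1 < n" and m: "m1 < m" and eq: "\<bar>U n - U n1\<bar> = \<bar>V m - V m1\<bar>"
    and indep: "\<And>x y :: nat. 1 \<le> x \<Longrightarrow> \<alpha> ^ x \<noteq> \<beta> ^ y"
    and nl: "n_large Z (scale Z 3) \<le> n" and ml: "n_large Z (scale Z 3) \<le> m"
  shows False
proof -
  interpret U: dom_seq Z d v i0 U \<alpha> \<Delta> e j0 by (rule U)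
  interpret V: dom_seq Z d v i0 V \<beta> \<Delta>' e' j0' by (rule V)
  have Z: "1000 \<le> Z" by (rule U.Z)
  define z where "z = real Z"
  have z: "1000 \<le> z" using Z by (simp add: z_def)
  obtain i where i: "i < 3" "n \<le> scale Z i * (n - n1) \<or> scale Z (Suc i) * (n - n1) \<le> n"
      "m \<le> scale Z i * (m - m1) \<or> scale Z (Suc i) * (m - m1) \<le> m"
    using good_scale[OF Z, of n "n - n1" m "m - m1"] by blast
  define p where "p = scale Z i"
  define P where "P = scale Z (Suc i)"
  define Y where "Y = scale_Y Z p"
  have P: "P = 300 * Z ^ 3 * Y ^ 1280" by (simp add: P_def Y_def p_def)
  have pP: "2 \<le> p" "p \<le> P" "4 * Z * Y ^ 1280 \<le> P" "Y \<le> P"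
    using scale_facts[OF Z, of i] by (auto simp: p_def P_def Y_def)
  have P3: "P \<le> scale Z 3" unfolding P_def using i(1) by (intro scale_mono Z) auto
  have large_mono: "n_large Z q \<le> n_large Z q'" if "q \<le> q'" for q q'
    unfolding n_large_def by (intro add_mono mult_mono power_mono that order_refl) auto
  have nP: "n_large Z P \<le> n" and mP: "n_large Z P \<le> m" using large_mono[OF P3] nl ml by linarith+
  have n2: "n_large Z 2 \<le> n" and m2: "n_large Z 2 \<le> m"
    using large_mono[of 2 P] pP nP mP by linarith+
  have i2: "n \<le> p * (n - n1) \<or> P * (n - n1) \<le> n" and i3: "m \<le> p * (m - m1) \<or> P * (m - m1) \<le> m"
    using i(2,3) unfolding p_def P_def by blast+
  obtain u N where uN0: "n \<le> 2 * N \<and> N \<le> n \<and> hgt d v (exp (2 * real Z * real n / real P)) u \<and>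
    \<bar>\<alpha>\<bar> ^ n \<le> 8 * real Z ^ (Z + 1) * norm (u * of_real \<alpha> ^ N) \<and>
    norm (\<Delta> * of_int (U n - U n1) - u * of_real \<alpha> ^ N) \<le> exp (- (real n / (4 * real Z * real p))) * norm (u * of_real \<alpha> ^ N)"
    using U.representation_aux[OF n nP pP(1,2) i2] by (elim exE)
  then have uN: "n \<le> 2 * N" "N \<le> n" "hgt d v (exp (2 * z * real n / real P)) u"
    "\<bar>\<alpha>\<bar> ^ n \<le> 8 * z ^ (Z + 1) * norm (u * of_real \<alpha> ^ N)"
    "norm (\<Delta> * of_int (U n - U n1) - u * of_real \<alpha> ^ N) \<le> exp (- (real n / (4 * z * real p))) * norm (u * of_real \<alpha> ^ N)"
    unfolding z_def by auto
  obtain w M where wM0: "m \<le> 2 * M \<and> M \<le> m \<and> hgt d v (exp (2 * real Z * real m / real P)) w \<and>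
    \<bar>\<beta>\<bar> ^ m \<le> 8 * real Z ^ (Z + 1) * norm (w * of_real \<beta> ^ M) \<and>
    norm (\<Delta>' * of_int (V m - V m1) - w * of_real \<beta> ^ M) \<le> exp (- (real m / (4 * real Z * real p))) * norm (w * of_real \<beta> ^ M)"
    using V.representation_aux[OF m mP pP(1,2) i3] by (elim exE)
  then have wM: "m \<le> 2 * M" "M \<le> m" "hgt d v (exp (2 * z * real m / real P)) w"
    "\<bar>\<beta>\<bar> ^ m \<le> 8 * z ^ (Z + 1) * norm (w * of_real \<beta> ^ M)"
    "norm (\<Delta>' * of_int (V m - V m1) - w * of_real \<beta> ^ M) \<le> exp (- (real m / (4 * z * real p))) * norm (w * of_real \<beta> ^ M)"
    unfolding z_def by auto
  have size: "Z \<le> n" "Z \<le> m" "1600 * Z ^ 4 * P\<^sup>2 \<le> n" "1600 * Z ^ 4 * P\<^sup>2 \<le> m"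
  proof -
    have "Z \<le> Z ^ (Z + 4)" by (rule self_le_power) (use Z in auto)
    then show "Z \<le> n" "Z \<le> m" "1600 * Z ^ 4 * P\<^sup>2 \<le> n" "1600 * Z ^ 4 * P\<^sup>2 \<le> m"
      using nP mP unfolding n_large_def by linarith+
  qed
  \<comment> \<open>\<open>24 = 16 + 8\<close>, the cubic term being absorbed by
    \<open>Z \<le> b\<close>.\<close>
  have comp: "real a \<le> 24 * z\<^sup>2 * real b" if "real a \<le> 16 * real Z ^ 3 + 8 * (real Z)\<^sup>2 * real b" "Z \<le> b" for a b :: nat
  proof -
    have "z * z\<^sup>2 \<le> real b * z\<^sup>2" using that(2) by (intro mult_right_mono) (auto simp: z_def)
    then have "z ^ 3 \<le> z\<^sup>2 * real b" by (simp add: eval_nat_numeral mult_ac)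
    then show ?thesis using that(1) unfolding z_def by linarith
  qed
  have eq': "\<bar>V m - V m1\<bar> = \<bar>U n - U n1\<bar>" using eq by simp
  have nm: "real n \<le> 24 * z\<^sup>2 * real m" by (rule comp[OF comparable[OF U V n m eq n2] size(2)])
  have mn: "real m \<le> 24 * z\<^sup>2 * real n" by (rule comp[OF comparable[OF V U m n eq' m2] size(1)])
  have p0: "2 \<le> real p" using pP by simp
  have Yr: "real Y = 1000 * z ^ 3 * real p" by (simp add: Y_def scale_Y_def z_def)
  have Y1000: "1000 \<le> Y" "Z \<le> Y" "d + 1 \<le> Y"
  proof -
    have z3: "z \<le> z ^ 3" by (rule self_le_power) (use z in auto)
    have "1000 * z * 1 \<le> 1000 * z ^ 3 * real p" using z3 p0 z by (intro mult_mono) auto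
    then have "1000 * z \<le> real Y" by (simp add: Yr)
    then have "1000 * Z \<le> Y" by (simp add: z_def)
    then show "1000 \<le> Y" "Z \<le> Y" "d + 1 \<le> Y" using Z U.Z by linarith+
  qed
  obtain \<sigma> :: int where \<sigma>: "\<sigma> = 1 \<or> \<sigma> = -1" "V m - V m1 = \<sigma> * (U n - U n1)"
  proof (cases "V m - V m1 = U n - U n1")
    case True
    then show ?thesis using that[of 1] by simp
  next
    case False
    then have "V m - V m1 = - (U n - U n1)" using eq by linarith
    then show ?thesis using that[of "-1"] by simp
  qed
  define u' where "u' = \<Delta>' * u"
  define w' where "w' = of_int \<sigma> * \<Delta> * w"
  define T where "T = u' * of_real \<alpha> ^ N"
  define S where "S = w' * of_real \<beta> ^ M"
  \<comment> \<open>\<open>96 = 4 * 24\<close>: the errors in \<open>n\<close> and in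
    \<open>m\<close> are both expressed through \<open>n\<close>, using \<open>nm\<close>.\<close>
  define \<epsilon> where "\<epsilon> = exp (- (real n / (96 * z ^ 3 * real p)))"
  define W where "W = \<Delta>' * \<Delta> * of_int (U n - U n1)"
  have e1: "exp (- (real n / (4 * z * real p))) \<le> \<epsilon>" "exp (- (real m / (4 * z * real p))) \<le> \<epsilon>"
  proof -
    have "1 \<le> 24 * z\<^sup>2" using z by (simp add: power2_eq_square) (use mult_mono[of 1 z 1 z] in simp)
    then have "real n * 1 \<le> real n * (24 * z\<^sup>2)" by (rule mult_left_mono) simp
    then have n': "real n / (24 * z\<^sup>2) \<le> real n" using z by (simp add: field_simps)
    have m': "real n / (24 * z\<^sup>2) \<le> real m" using nm z by (simp add: field_simps)
    have eqn: "real n / (96 * z ^ 3 * real p) = (real n / (24 * z\<^sup>2)) / (4 * z * real p)"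
      by (simp add: eval_nat_numeral)
    show "exp (- (real n / (4 * z * real p))) \<le> \<epsilon>" "exp (- (real m / (4 * z * real p))) \<le> \<epsilon>"
      unfolding \<epsilon>_def eqn using divide_right_mono[OF n', of "4 * z * real p"] divide_right_mono[OF m', of "4 * z * real p"] z p0 by auto
  qed
  have TW: "norm (W - T) \<le> \<epsilon> * norm T"
  proof -
    have "W - T = \<Delta>' * (\<Delta> * of_int (U n - U n1) - u * of_real \<alpha> ^ N)" by (simp add: W_def T_def u'_def algebra_simps)
    then have "norm (W - T) = norm \<Delta>' * norm (\<Delta> * of_int (U n - U n1) - u * of_real \<alpha> ^ N)" by (simp only: norm_mult)
    also have "\<dots> \<le> norm \<Delta>' * (\<epsilon> * norm (u * of_real \<alpha> ^ N))"
      by (rule mult_left_mono[OF order_trans[OF uN(5) mult_right_mono[OF e1(1)]]]) auto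
    also have "\<dots> = \<epsilon> * norm T" by (simp add: T_def u'_def norm_mult)
    finally show ?thesis .
  qed
  have SW: "norm (W - S) \<le> \<epsilon> * norm S"
  proof -
    have "of_int \<sigma> * of_int \<sigma> = (1 :: complex)" using \<sigma>(1) by auto
    then have "\<sigma>' * \<sigma>' * x = x" if "\<sigma>' = of_int \<sigma>" for x \<sigma>' :: complex using that by simp
    then have "W = of_int \<sigma> * \<Delta> * (\<Delta>' * of_int (V m - V m1))"
      unfolding W_def \<sigma>(2) of_int_mult by (simp only: mult_ac) (metis (no_types, opaque_lifting) mult.assoc mult.commute)
    then have "W - S = (of_int \<sigma> * \<Delta>) * (\<Delta>' * of_int (V m - V m1) - w * of_real \<beta> ^ M)" by (simp add: S_def w'_def algebra_simps)
    then have "norm (W - S) = norm (of_int \<sigma> * \<Delta>) * norm (\<Delta>' * of_int (V m - V m1) - w * of_real \<beta> ^ M)" by (simp only: norm_mult)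
    also have "\<dots> \<le> norm (of_int \<sigma> * \<Delta>) * (\<epsilon> * norm (w * of_real \<beta> ^ M))"
      by (rule mult_left_mono[OF order_trans[OF wM(5) mult_right_mono[OF e1(2)]]]) auto
    also have "\<dots> = \<epsilon> * norm S" by (simp add: S_def w'_def norm_mult)
    finally show ?thesis .
  qed
  have small: "3 * \<epsilon> \<le> exp (- (real N / real Y))" "\<epsilon> \<le> 1 / 4"
  proof -
    have "300 * z ^ 3 * real p \<le> real n"
    proof -
      have "300 * Z ^ 3 * p \<le> 1600 * Z ^ 4 * P\<^sup>2"
        by (intro mult_mono power_increasing) (use pP Z self_le_power[of P 2] in auto)
      then have "300 * Z ^ 3 * p \<le> n" using size(3) by linarith
      from of_nat_mono[OF this, where 'a = real] show ?thesis by (simp add: z_def)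
    qed
    then have q: "300 \<le> real n / (z ^ 3 * real p)" using z p0 by (simp add: field_simps)
    define q where "q = real n / (z ^ 3 * real p)"
    have \<epsilon>q: "\<epsilon> = exp (- (q / 96))" by (simp add: \<epsilon>_def q_def)
    have e3: "3 * exp (- 2) \<le> (1::real)"
    proof -
      have "(2::real) * 2 \<le> exp 1 * exp 1" by (intro mult_mono) (use exp_ge_add_one_self[of 1] in auto)
      then have "4 \<le> exp (2::real)" by (simp flip: exp_add)
      then show ?thesis by (simp add: exp_minus field_simps)
    qed
    have "\<epsilon> \<le> exp (- 2 + - (q / 1000))" unfolding \<epsilon>q using q unfolding q_def[symmetric] by simp
    then have "3 * \<epsilon> \<le> (3 * exp (- 2)) * exp (- (q / 1000))" unfolding exp_add by simp
    also have "\<dots> \<le> 1 * exp (- (q / 1000))" by (intro mult_right_mono e3) simp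
    also have "q / 1000 = real n / real Y" by (simp add: q_def Yr)
    also have "1 * exp (- (real n / real Y)) \<le> exp (- (real N / real Y))"
      using uN(2) by (simp add: divide_right_mono)
    finally show "3 * \<epsilon> \<le> exp (- (real N / real Y))" .
    have "\<epsilon> \<le> exp (- 2)" unfolding \<epsilon>q using q unfolding q_def[symmetric] by simp
    moreover have "(2::real) * 2 \<le> exp 1 * exp 1" by (intro mult_mono) (use exp_ge_add_one_self[of 1] in auto)
    then have "exp (- 2) \<le> (1 / 4 :: real)" by (simp add: exp_minus field_simps flip: exp_add)
    ultimately show "\<epsilon> \<le> 1 / 4" by linarith
  qed
  \<comment> \<open>Triangle inequality through \<open>W\<close>: \<open>\<epsilon>\<close> for
    \<open>T\<close>, and twice that for \<open>S\<close> because
    \<open>norm S \<le> 2 * norm T\<close>.\<close>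
  have ST: "norm (T - S) \<le> exp (- (real N / real Y)) * norm T"
  proof -
    have \<epsilon>S: "\<epsilon> * norm S \<le> 1 / 4 * norm S" and \<epsilon>T: "\<epsilon> * norm T \<le> 1 / 4 * norm T"
      by (rule mult_right_mono[OF small(2) norm_ge_zero])+
    have "norm S \<le> norm (W - S) + norm (W - T) + norm T"
      using norm_triangle_ineq4[of W "W - S"] norm_triangle_ineq[of "W - T" T] by simp
    then have "norm S \<le> 2 * norm T" using SW TW \<epsilon>S \<epsilon>T norm_ge_zero[of T] by linarith
    then have "\<epsilon> * norm S \<le> \<epsilon> * (2 * norm T)" by (rule mult_left_mono) (simp add: \<epsilon>_def)
    moreover have "norm (T - S) \<le> norm (W - S) + norm (W - T)"
      using norm_triangle_ineq4[of "W - S" "W - T"] by simp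
    ultimately have "norm (T - S) \<le> 3 * \<epsilon> * norm T" using SW TW by linarith
    also have "\<dots> \<le> exp (- (real N / real Y)) * norm T" by (intro mult_right_mono small) simp
    finally show ?thesis .
  qed
  have pow1: "0 < \<bar>\<alpha>\<bar> ^ n" "0 < \<bar>\<beta>\<bar> ^ m" using U.lam_pos V.lam_pos by simp_all
  have u0: "u \<noteq> 0"
  proof
    assume "u = 0"
    then have "\<bar>\<alpha>\<bar> ^ n \<le> 0" using uN(4) by simp
    then show False using pow1(1) by linarith
  qed
  have w0: "w \<noteq> 0"
  proof
    assume "w = 0"
    then have "\<bar>\<beta>\<bar> ^ m \<le> 0" using wM(4) by simp
    then show False using pow1(2) by linarith
  qed
  define K where "K = real Y ^ 1280"
  have K: "K = real (Y ^ 1280)" by (simp add: K_def)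
  have K1: "1 \<le> K" unfolding K_def by (rule one_le_power) (use Y1000 in simp)
  have PK: "real P = 300 * z ^ 3 * K" by (simp add: P K z_def)
  have n4: "4 * z * K \<le> real n"
  proof -
    have "P * 1 \<le> P * P" using pP by (intro mult_left_mono) auto
    moreover have "1 * P\<^sup>2 \<le> 1600 * Z ^ 4 * P\<^sup>2"
    proof (rule mult_right_mono)
      have "1 \<le> Z ^ 4" by (rule one_le_power) (use Z in simp)
      then show "1 \<le> 1600 * Z ^ 4" by linarith
    qed simp
    ultimately have "P \<le> n" using size(3) unfolding power2_eq_square by linarith
    then have "4 * Z * Y ^ 1280 \<le> n" using pP(3) by linarith
    from of_nat_mono[OF this, where 'a = real] show ?thesis by (simp add: z_def K)
  qed
  define rr ss where "rr = real n / K" and "ss = real N / K"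
  \<comment> \<open>In units of \<open>n / K\<close> the height of \<open>u\<close> or
    \<open>w\<close> contributes at most \<open>48 / 300\<close> and that of \<open>\<Delta>\<close>
    or \<open>\<Delta>'\<close> at most \<open>1 / 4\<close>, together below the
    \<open>1 / 2\<close> granted by \<open>n \<le> 2 * N\<close>.\<close>
  have budget: "z + 2 * z * (24 * z\<^sup>2 * real n) / real P \<le> real N / K"
  proof -
    define tt where "tt = 2 * z * (24 * z\<^sup>2 * real n) / real P"
    have "tt = (48 / 300) * rr"
      unfolding tt_def PK rr_def using z K1 by (simp add: field_simps eval_nat_numeral)
    moreover have "z \<le> (1 / 4) * rr" using n4 K1 by (simp add: rr_def field_simps)
    moreover have "rr \<le> 2 * ss"
    proof -
      have "real n \<le> 2 * real N" using of_nat_mono[OF uN(1), where 'a = real] by simp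
      then show ?thesis using K1 by (simp add: rr_def ss_def field_simps)
    qed
    moreover have "0 \<le> ss" using K1 by (simp add: ss_def)
    ultimately show ?thesis unfolding ss_def[symmetric] tt_def[symmetric] by linarith
  qed
  have hz: "exp z \<ge> z" using exp_ge_add_one_self[of z] by linarith
  have hu: "hgt d v (exp (real N / K)) u'"
    unfolding u'_def
  proof (rule hgt_mono[OF hgt_mult[OF hgt_mono[OF V.hgts(2)] uN(3)]])
    show "real Z \<le> exp z" using hz by (simp add: z_def)
    have "2 * z * real n / real P \<le> 2 * z * (24 * z\<^sup>2 * real n) / real P"
    proof (intro divide_right_mono mult_left_mono)
      have "1 \<le> 24 * z\<^sup>2" using one_le_power[of z 2] z by linarith
      then have "1 * real n \<le> 24 * z\<^sup>2 * real n" by (rule mult_right_mono) simp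
      then show "real n \<le> 24 * z\<^sup>2 * real n" by simp
    qed (use z in auto)
    then show "exp z * exp (2 * z * real n / real P) \<le> exp (real N / K)"
      using budget by (simp flip: exp_add)
  qed
  have hw: "hgt d v (exp (real N / K)) w'"
  proof -
    have h1: "hgt d v (exp z) \<Delta>" using hgt_mono[OF U.hgts(2)] hz by (simp add: z_def)
    then have "hgt d v (exp z) (of_int \<sigma> * \<Delta>)" using \<sigma>(1) hgt_uminus[OF h1] by auto
    moreover have "2 * z * real m / real P \<le> 2 * z * (24 * z\<^sup>2 * real n) / real P"
      by (intro divide_right_mono mult_left_mono mn) (use z in auto)
    then have "exp z * exp (2 * z * real m / real P) \<le> exp (real N / K)"
      using budget by (simp flip: exp_add)
    ultimately show ?thesis unfolding w'_def using hgt_mono[OF hgt_mult[OF _ wM(3)]] by blast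
  qed
  have "N < Y ^ 1280"
  proof (rule effective_approximation[where \<alpha> = \<alpha> and \<beta> = \<beta> and Y = Y and d = d and v = v and ?i0.0 = i0
        and n = N and m = M and u = u' and w = w'])
    show "1000 \<le> Y" "d + 1 \<le> Y" by (rule Y1000)+
    show "i0 < d" "v i0 \<noteq> 0" by (rule U.v)+
    show "\<alpha> ^ x \<noteq> \<beta> ^ y" if "1 \<le> x" for x y :: nat by (rule indep[OF that])
    have iY: "1 / real Y \<le> 1 / real Z" using Y1000(2) Z by (intro divide_left_mono) auto
    show "1 + 1 / real Y \<le> \<bar>\<alpha>\<bar>" using U.lam_ge iY by linarith
    show "1 + 1 / real Y \<le> \<bar>\<beta>\<bar>" using V.lam_ge iY by linarith
    show "hgt d v (real Y) (of_real \<alpha>)" by (rule hgt_mono[OF U.hgts(1)]) (use Y1000 in simp)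
    show "hgt d v (real Y) (of_real \<beta>)" by (rule hgt_mono[OF V.hgts(1)]) (use Y1000 in simp)
    show "hgt d v (exp (real N / real Y ^ 1280)) u'" using hu by (simp only: K_def)
    show "hgt d v (exp (real N / real Y ^ 1280)) w'" using hw by (simp only: K_def)
    show "u' \<noteq> 0" using u0 V.nonzero by (simp add: u'_def)
    show "w' \<noteq> 0" using w0 U.nonzero \<sigma>(1) by (auto simp: w'_def)
    show "norm (u' * of_real \<alpha> ^ N - w' * of_real \<beta> ^ M) \<le> exp (- (real N / real Y)) * norm (u' * of_real \<alpha> ^ N)"
      using ST by (simp add: T_def S_def)
  qed
  then have "real N < K" unfolding K by (simp only: of_nat_less_iff)
  moreover have "real n \<le> 2 * real N" using of_nat_mono[OF uN(1), where 'a = real] by simp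
  moreover have "4 * 1 * K \<le> 4 * z * K" by (intro mult_right_mono mult_left_mono) (use z K1 in auto)
  ultimately show False using n4 K1 by linarith
qed

theorem solutions_bounded:
  assumes U: "dom_seq Z d v i0 U \<alpha> \<Delta> e j0" and V: "dom_seq Z d v i0 V \<beta> \<Delta>' e' j0'"
    and n: "n1 < n" and m: "m1 < m" and eq: "\<bar>U n - U n1\<bar> = \<bar>V m - V m1\<bar>"
    and indep: "\<And>x y :: nat. 1 \<le> x \<Longrightarrow> \<alpha> ^ x \<noteq> \<beta> ^ y"
  shows "n \<le> final_bound Z \<and> m \<le> final_bound Z"
proof -
  interpret U: dom_seq Z d v i0 U \<alpha> \<Delta> e j0 by (rule U)
  let ?n0 = "n_large Z (scale Z 3)"
  have eq': "\<bar>V m - V m1\<bar> = \<bar>U n - U n1\<bar>" using eq by simp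
  have n2: "n_large Z 2 \<le> ?n0"
    unfolding n_large_def by (intro add_mono mult_mono power_mono order_refl scale_facts(1) U.Z) auto
  have bound: "a \<le> final_bound Z" if "real a \<le> 16 * real Z ^ 3 + 8 * (real Z)\<^sup>2 * real b" "b \<le> ?n0" for a b
  proof -
    have "real a \<le> real (16 * Z ^ 3 + 8 * Z\<^sup>2 * b)" using that(1) by simp
    then have "a \<le> 16 * Z ^ 3 + 8 * Z\<^sup>2 * b" by (simp only: of_nat_le_iff)
    moreover have "8 * Z\<^sup>2 * b \<le> 8 * Z\<^sup>2 * ?n0" using that(2) by (rule mult_left_mono) simp
    ultimately show ?thesis unfolding final_bound_def by linarith
  qed
  have le: "a \<le> final_bound Z" if "a \<le> ?n0" for a using that unfolding final_bound_def by linarith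
  consider "?n0 \<le> n" "?n0 \<le> m" | "n < ?n0" "m < ?n0" | "n < ?n0" "?n0 \<le> m" | "?n0 \<le> n" "m < ?n0" by linarith
  then show ?thesis
  proof cases
    case 1
    then show ?thesis using solutions_bounded_aux[OF U V n m eq indep] by blast
  next
    case 2
    then show ?thesis by (intro conjI le) auto
  next
    case 3
    have "m \<le> final_bound Z"
      by (rule bound[OF comparable[OF V U m n eq']]) (use 3 n2 in linarith)+
    then show ?thesis using 3 le[of n] by simp
  next
    case 4
    have "n \<le> final_bound Z"
      by (rule bound[OF comparable[OF U V n m eq]]) (use 4 n2 in linarith)+
    then show ?thesis using 4 le[of m] by simp
  qed
qed

section \<open>Recursive functions\<close>

text \<open>Computability of a total function of \<open>n\<close> arguments. The predicate hides the
  programs, which the closure rules below assemble.\<close>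

definition rf :: "nat \<Rightarrow> (nat list \<Rightarrow> nat) \<Rightarrow> bool" where
  "rf n f \<longleftrightarrow> (\<exists>p. \<forall>xs. length xs = n \<longrightarrow> computes p xs (f xs))"

lemma rf_cong: "rf n f \<Longrightarrow> (\<And>xs. length xs = n \<Longrightarrow> f xs = g xs) \<Longrightarrow> rf n g"
  unfolding rf_def by metis

lemma rf_nth: "i < n \<Longrightarrow> rf n (\<lambda>xs. xs ! i)"
  unfolding rf_def by (rule exI[of _ "Proj i"]) (auto intro: computes.proj)

lemma rf_comp:
  assumes g: "rf m g" and fs: "list_all (rf n) fs" and m: "length fs = m"
  shows "rf n (\<lambda>xs. g (map (\<lambda>f. f xs) fs))"
proof -
  obtain q where q: "\<And>ys. length ys = m \<Longrightarrow> computes q ys (g ys)" using g unfolding rf_def by blast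
  have "\<exists>ps. list_all2 (\<lambda>p f. \<forall>xs. length xs = n \<longrightarrow> computes p xs (f xs)) ps fs"
    using fs
  proof (induction fs)
    case (Cons f fs)
    then obtain p ps where "\<forall>xs. length xs = n \<longrightarrow> computes p xs (f xs)"
      "list_all2 (\<lambda>p f. \<forall>xs. length xs = n \<longrightarrow> computes p xs (f xs)) ps fs"
      unfolding rf_def by auto
    then show ?case by (intro exI[of _ "p # ps"]) simp
  qed auto
  then obtain ps where ps: "list_all2 (\<lambda>p f. \<forall>xs. length xs = n \<longrightarrow> computes p xs (f xs)) ps fs" ..
  show ?thesis unfolding rf_def
  proof (intro exI[of _ "Comp q ps"] allI impI)
    fix xs :: "nat list" assume xs: "length xs = n"
    show "computes (Comp q ps) xs (g (map (\<lambda>f. f xs) fs))"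
    proof (rule computes.comp)
      show "list_all2 (\<lambda>p y. computes p xs y) ps (map (\<lambda>f. f xs) fs)"
        using ps xs by (simp add: list_all2_conv_all_nth)
      show "computes q (map (\<lambda>f. f xs) fs) (g (map (\<lambda>f. f xs) fs))" by (rule q) (simp add: m)
    qed
  qed
qed

lemma rf_drop: "rf n f \<Longrightarrow> rf (m + n) (\<lambda>ys. f (drop m ys))"
proof -
  assume f: "rf n f"
  have "rf (m + n) (\<lambda>ys. f (map (\<lambda>h. h ys) (map (\<lambda>i ys. ys ! (m + i)) [0..<n])))"
    by (rule rf_comp[OF f]) (auto simp: list_all_iff intro: rf_nth)
  then show ?thesis
  proof (rule rf_cong)
    fix ys :: "nat list" assume "length ys = m + n"
    then have "map (\<lambda>h. h ys) (map (\<lambda>i ys. ys ! (m + i)) [0..<n]) = drop m ys"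
      by (intro nth_equalityI) auto
    then show "f (map (\<lambda>h. h ys) (map (\<lambda>i ys. ys ! (m + i)) [0..<n])) = f (drop m ys)" by simp
  qed
qed

lemma rf_drop2: "rf n f \<Longrightarrow> rf (Suc (Suc n)) (\<lambda>ys. f (drop 2 ys))"
  using rf_drop[of n f 2] by simp

lemma rf_Suc: "rf n f \<Longrightarrow> rf n (\<lambda>xs. Suc (f xs))"
proof -
  assume f: "rf n f"
  have "rf 1 (\<lambda>xs. Suc (xs ! 0))" unfolding rf_def
  proof (intro exI[of _ Succ] allI impI)
    fix xs :: "nat list" assume "length xs = 1"
    then obtain x where "xs = [x]" by (auto simp: length_Suc_conv)
    then show "computes Succ xs (Suc (xs ! 0))" by (simp add: computes.succ)
  qed
  from rf_comp[OF this, of n "[f]"] show ?thesis using f by simp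
qed

lemma rf_const: "rf n (\<lambda>xs. c)"
proof (induction c)
  case 0
  show ?case unfolding rf_def by (rule exI[of _ Zero]) (auto intro: computes.zero)
qed (rule rf_Suc)

text \<open>The step program of \<open>PrimRec\<close> receives counter, previous value and
  parameters in one list, hence the access by \<open>ys ! 0\<close>, \<open>ys ! 1\<close> and
  \<open>drop 2 ys\<close>.\<close>

lemma rf_rec:
  assumes b: "rf n b" and s: "rf (Suc (Suc n)) (\<lambda>ys. s (ys ! 0) (ys ! 1) (drop 2 ys))" and h: "rf n h"
  shows "rf n (\<lambda>xs. rec_nat (b xs) (\<lambda>i r. s i r xs) (h xs))"
proof -
  obtain p where p: "\<And>xs. length xs = n \<Longrightarrow> computes p xs (b xs)" using b unfolding rf_def by blast
  obtain q where q: "\<And>ys. length ys = Suc (Suc n) \<Longrightarrow> computes q ys (s (ys ! 0) (ys ! 1) (drop 2 ys))"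
    using s unfolding rf_def by blast
  have "rf (Suc n) (\<lambda>ys. rec_nat (b (drop 1 ys)) (\<lambda>i r. s i r (drop 1 ys)) (ys ! 0))"
    unfolding rf_def
  proof (intro exI[of _ "PrimRec p q"] allI impI)
    fix ys :: "nat list" assume "length ys = Suc n"
    then obtain k xs where ys: "ys = k # xs" "length xs = n" by (auto simp: length_Suc_conv)
    have "computes (PrimRec p q) (k # xs) (rec_nat (b xs) (\<lambda>i r. s i r xs) k)"
    proof (induction k)
      case 0
      then show ?case using p[OF ys(2)] by (simp add: computes.prim_0)
    next
      case (Suc k)
      have "computes q (k # rec_nat (b xs) (\<lambda>i r. s i r xs) k # xs) (s k (rec_nat (b xs) (\<lambda>i r. s i r xs) k) xs)"
        using q[of "k # rec_nat (b xs) (\<lambda>i r. s i r xs) k # xs"] ys(2) by simp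
      from computes.prim_Suc[OF Suc this] show ?case by simp
    qed
    then show "computes (PrimRec p q) ys (rec_nat (b (drop 1 ys)) (\<lambda>i r. s i r (drop 1 ys)) (ys ! 0))"
      by (simp add: ys)
  qed
  from rf_comp[OF this, of n "h # map (\<lambda>i xs. xs ! i) [0..<n]"]
  have "rf n (\<lambda>xs. rec_nat (b (map (\<lambda>f. f xs) (map (\<lambda>i xs. xs ! i) [0..<n])))
      (\<lambda>i r. s i r (map (\<lambda>f. f xs) (map (\<lambda>i xs. xs ! i) [0..<n]))) (h xs))"
    using h by (simp add: list_all_iff rf_nth)
  then show ?thesis
  proof (rule rf_cong)
    fix xs :: "nat list" assume "length xs = n"
    then have "map (\<lambda>f. f xs) (map (\<lambda>i xs. xs ! i) [0..<n]) = xs" by (intro nth_equalityI) auto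
    then show "rec_nat (b (map (\<lambda>f. f xs) (map (\<lambda>i xs. xs ! i) [0..<n])))
      (\<lambda>i r. s i r (map (\<lambda>f. f xs) (map (\<lambda>i xs. xs ! i) [0..<n]))) (h xs) = rec_nat (b xs) (\<lambda>i r. s i r xs) (h xs)"
      by (simp only:)
  qed
qed

lemma rf_nth_drop: "m + i < n \<Longrightarrow> rf n (\<lambda>ys. drop m ys ! i)"
  by (rule rf_cong[OF rf_nth[of "m + i"]]) auto

lemma rf_nth_drop_drop: "m + (m' + i) < n \<Longrightarrow> rf n (\<lambda>ys. drop m' (drop m ys) ! i)"
  by (rule rf_cong[OF rf_nth[of "m + (m' + i)"]]) (auto simp: add_ac)

lemma rf_add: assumes "rf n f" "rf n g" shows "rf n (\<lambda>xs. f xs + g xs)"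
proof -
  have "rf n (\<lambda>xs. rec_nat (f xs) (\<lambda>i r. Suc r) (g xs))"
    by (intro rf_rec assms rf_Suc rf_nth) simp
  moreover have "rec_nat a (\<lambda>i r. Suc r) b = a + b" for a b by (induction b) auto
  ultimately show ?thesis by simp
qed

lemma rf_pred: assumes "rf n f" shows "rf n (\<lambda>xs. f xs - 1)"
proof -
  have "rf n (\<lambda>xs. rec_nat 0 (\<lambda>i r. i) (f xs))"
    by (intro rf_rec assms rf_const rf_nth) simp
  moreover have "rec_nat 0 (\<lambda>i r. i) b = b - 1" for b :: nat by (cases b) auto
  ultimately show ?thesis by simp
qed

lemma rf_diff: assumes "rf n f" "rf n g" shows "rf n (\<lambda>xs. f xs - g xs)"
proof -
  have "rf n (\<lambda>xs. rec_nat (f xs) (\<lambda>i r. r - 1) (g xs))"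
    by (intro rf_rec assms rf_pred rf_nth) simp
  moreover have "rec_nat a (\<lambda>i r. r - 1) b = a - b" for a b :: nat by (induction b) auto
  ultimately show ?thesis by simp
qed

lemma rf_mult: assumes "rf n f" "rf n g" shows "rf n (\<lambda>xs. f xs * g xs)"
proof -
  have "rf n (\<lambda>xs. rec_nat 0 (\<lambda>i r. r + f xs) (g xs))"
    by (intro rf_rec assms rf_add rf_nth rf_const rf_drop2[OF assms(1)]) simp
  moreover have "rec_nat 0 (\<lambda>i r. r + a) b = a * b" for a b :: nat by (induction b) auto
  ultimately show ?thesis by simp
qed

lemma rf_power: assumes "rf n f" "rf n g" shows "rf n (\<lambda>xs. f xs ^ g xs)"
proof -
  have "rf n (\<lambda>xs. rec_nat 1 (\<lambda>i r. r * f xs) (g xs))"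
    by (intro rf_rec assms rf_mult rf_nth rf_const rf_drop2[OF assms(1)]) simp
  moreover have "rec_nat 1 (\<lambda>i r. r * a) b = a ^ b" for a b :: nat by (induction b) auto
  ultimately show ?thesis by simp
qed

lemma rf_sum:
  assumes s: "rf (Suc (Suc n)) (\<lambda>ys. s (ys ! 0) (drop 2 ys))" and h: "rf n h"
  shows "rf n (\<lambda>xs. \<Sum>i<h xs. s i xs)"
proof -
  have "rf n (\<lambda>xs. rec_nat 0 (\<lambda>i r. r + s i xs) (h xs))"
    by (intro rf_rec[where s = "\<lambda>i r xs. r + s i xs"] rf_add rf_nth rf_const h s) simp
  moreover have "rec_nat 0 (\<lambda>i r. r + f i) b = (\<Sum>i<b. f i)" for f :: "nat \<Rightarrow> nat" and b by (induction b) auto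
  ultimately show ?thesis by simp
qed

lemma rf_if_eq:
  assumes "rf n f" "rf n g" "rf n a" "rf n b"
  shows "rf n (\<lambda>xs. if f xs = g xs then a xs else b xs)"
proof -
  \<comment> \<open>In truncated arithmetic \<open>1 - ((f - g) + (g - f))\<close> is the indicator
    of equality.\<close>
  have "rf n (\<lambda>xs. a xs * (1 - ((f xs - g xs) + (g xs - f xs))) + b xs * (1 - (1 - ((f xs - g xs) + (g xs - f xs)))))"
    by (intro rf_add rf_mult rf_diff rf_const assms)
  then show ?thesis by (rule rf_cong) auto
qed

lemma rf_if_le:
  assumes "rf n f" "rf n g" "rf n a" "rf n b"
  shows "rf n (\<lambda>xs. if f xs \<le> g xs then a xs else b xs)"
proof -
  have "rf n (\<lambda>xs. if f xs - g xs = 0 then a xs else b xs)"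
    by (intro rf_if_eq rf_diff rf_const assms)
  then show ?thesis by simp
qed

lemma rf_triangle: assumes "rf n f" shows "rf n (\<lambda>xs. triangle (f xs))"
proof -
  have "rf n (\<lambda>xs. \<Sum>i<f xs. Suc i)" by (intro rf_sum rf_Suc rf_nth assms) simp
  moreover have "(\<Sum>i<b. Suc i) = triangle b" for b by (induction b) auto
  ultimately show ?thesis by simp
qed

lemma rf_prod_encode: "rf n f \<Longrightarrow> rf n g \<Longrightarrow> rf n (\<lambda>xs. prod_encode (f xs, g xs))"
  unfolding prod_encode_def by (simp add: rf_add rf_triangle)

section \<open>Decoding of pairs, lists and integers\<close>

definition pfst :: "nat \<Rightarrow> nat" where "pfst z = fst (prod_decode z)"
definition psnd :: "nat \<Rightarrow> nat" where "psnd z = snd (prod_decode z)"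

lemma pfst_psnd_encode [simp]: "pfst (prod_encode (a, b)) = a" "psnd (prod_encode (a, b)) = b"
  by (auto simp: pfst_def psnd_def)

text \<open>Decoding as a bounded search written as a sum: the components of a pair do not exceed
  its code, and exactly one pair contributes.\<close>

lemma prod_decode_sum:
  "(\<Sum>a<Suc z. \<Sum>b<Suc z. if prod_encode (a, b) = z then F a b else 0) = F (pfst z) (psnd z)" for F :: "nat \<Rightarrow> nat \<Rightarrow> nat"
proof -
  have z: "prod_encode (pfst z, psnd z) = z" by (simp add: pfst_def psnd_def)
  have le: "pfst z \<le> z" "psnd z \<le> z"
    using le_prod_encode_1[of "pfst z" "psnd z"] le_prod_encode_2[of "psnd z" "pfst z"] z by auto
  have iff: "prod_encode (a, b) = z \<longleftrightarrow> a = pfst z \<and> b = psnd z" for a b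
    using z by (metis pfst_psnd_encode)
  have "(\<Sum>b<Suc z. if prod_encode (a, b) = z then F a b else 0) = (if a = pfst z then F (pfst z) (psnd z) else 0)" for a
    using le(2) by (cases "a = pfst z") (simp_all add: iff)
  then show ?thesis using le(1) by simp
qed

lemma rf_pfst_aux: "rf 1 (\<lambda>xs. pfst (xs ! 0))" "rf 1 (\<lambda>xs. psnd (xs ! 0))"
proof -
  have "rf 1 (\<lambda>xs. \<Sum>a<Suc (xs ! 0). \<Sum>b<Suc (xs ! 0). if prod_encode (a, b) = xs ! 0 then a else 0)"
    by (intro rf_sum rf_Suc rf_if_eq rf_prod_encode rf_const rf_nth rf_nth_drop rf_nth_drop_drop) simp_all
  then show "rf 1 (\<lambda>xs. pfst (xs ! 0))" unfolding prod_decode_sum[of _ "\<lambda>a b. a"] .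
  have "rf 1 (\<lambda>xs. \<Sum>a<Suc (xs ! 0). \<Sum>b<Suc (xs ! 0). if prod_encode (a, b) = xs ! 0 then b else 0)"
    by (intro rf_sum rf_Suc rf_if_eq rf_prod_encode rf_const rf_nth rf_nth_drop rf_nth_drop_drop) simp_all
  then show "rf 1 (\<lambda>xs. psnd (xs ! 0))" unfolding prod_decode_sum[of _ "\<lambda>a b. b"] .
qed

lemma rf_comp1: "rf 1 (\<lambda>xs. F (xs ! 0)) \<Longrightarrow> rf n f \<Longrightarrow> rf n (\<lambda>xs. F (f xs))"
  using rf_comp[of 1 "\<lambda>xs. F (xs ! 0)" n "[f]"] by simp

lemma rf_pfst: "rf n f \<Longrightarrow> rf n (\<lambda>xs. pfst (f xs))"
  and rf_psnd: "rf n f \<Longrightarrow> rf n (\<lambda>xs. psnd (f xs))"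
  by (rule rf_comp1[OF rf_pfst_aux(1)], assumption) (rule rf_comp1[OF rf_pfst_aux(2)], assumption)

text \<open>These operations act on the codes of \<open>list_encode\<close>, where 0 is the empty
  list and a nonempty list is the successor of a coded pair.\<close>

definition lcons :: "nat \<Rightarrow> nat \<Rightarrow> nat" where "lcons x z = Suc (prod_encode (x, z))"
definition lhd :: "nat \<Rightarrow> nat" where "lhd z = pfst (z - 1)"
definition ltl :: "nat \<Rightarrow> nat" where "ltl z = psnd (z - 1)"
definition ldrop :: "nat \<Rightarrow> nat \<Rightarrow> nat" where "ldrop z i = rec_nat z (\<lambda>_ r. ltl r) i"
definition lnth :: "nat \<Rightarrow> nat \<Rightarrow> nat" where "lnth z i = lhd (ldrop z i)"
text \<open>Counts the nonempty tails; the code of a list bounds its length, so the range up to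
  \<open>z\<close> suffices.\<close>

definition llen :: "nat \<Rightarrow> nat" where "llen z = (\<Sum>i<z. if ldrop z i = 0 then 0 else 1)"

lemma rf_lcons: "rf n f \<Longrightarrow> rf n g \<Longrightarrow> rf n (\<lambda>xs. lcons (f xs) (g xs))"
  unfolding lcons_def by (intro rf_Suc rf_prod_encode)
lemma rf_lhd: "rf n f \<Longrightarrow> rf n (\<lambda>xs. lhd (f xs))"
  unfolding lhd_def by (intro rf_pfst rf_pred)
lemma rf_ltl: "rf n f \<Longrightarrow> rf n (\<lambda>xs. ltl (f xs))"
  unfolding ltl_def by (intro rf_psnd rf_pred)
lemma rf_ldrop: "rf n f \<Longrightarrow> rf n g \<Longrightarrow> rf n (\<lambda>xs. ldrop (f xs) (g xs))"
  unfolding ldrop_def by (intro rf_rec rf_ltl rf_nth) simp_all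
lemma rf_lnth: "rf n f \<Longrightarrow> rf n g \<Longrightarrow> rf n (\<lambda>xs. lnth (f xs) (g xs))"
  unfolding lnth_def by (intro rf_lhd rf_ldrop)
lemma rf_llen: "rf n f \<Longrightarrow> rf n (\<lambda>xs. llen (f xs))"
  unfolding llen_def by (intro rf_sum rf_if_eq rf_ldrop rf_drop2 rf_nth rf_const) simp_all

lemma lcons_encode [simp]: "lcons x (list_encode xs) = list_encode (x # xs)"
  by (simp add: lcons_def)

lemma lhd_encode [simp]: "lhd (list_encode (x # xs)) = x"
  by (simp add: lhd_def)

lemma ltl_encode: "ltl (list_encode xs) = list_encode (tl xs)"
proof -
  have "psnd 0 = 0" using pfst_psnd_encode(2)[of 0 0] by (simp add: prod_encode_def)
  then show ?thesis by (cases xs) (simp_all add: ltl_def)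
qed

lemma ldrop_encode: "ldrop (list_encode xs) i = list_encode (drop i xs)"
  by (induction i) (simp_all add: ldrop_def ltl_encode drop_Suc tl_drop)

lemma lnth_encode: "i < length xs \<Longrightarrow> lnth (list_encode xs) i = xs ! i"
  using lhd_encode[of "xs ! i" "drop (Suc i) xs"] unfolding lnth_def ldrop_encode by (simp only: Cons_nth_drop_Suc)

lemma length_le_list_encode: "length xs \<le> list_encode xs"
proof (induction xs)
  case (Cons x xs)
  then show ?case using le_prod_encode_2[of "list_encode xs" x] by simp
qed simp

lemma nth_le_list_encode: "i < length xs \<Longrightarrow> xs ! i \<le> list_encode xs"
proof (induction xs arbitrary: i)
  case (Cons x xs)
  show ?case
  proof (cases i)
    case 0
    then show ?thesis using le_prod_encode_1[of x "list_encode xs"] by simp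
  next
    case (Suc j)
    then have "xs ! j \<le> list_encode xs" using Cons by simp
    then show ?thesis using le_prod_encode_2[of "list_encode xs" x] Suc by simp
  qed
qed simp

lemma llen_encode: "llen (list_encode xs) = length xs"
proof -
  have z: "list_encode ys = 0 \<longleftrightarrow> ys = []" for ys by (cases ys) auto
  have "llen (list_encode xs) = (\<Sum>i<list_encode xs. if i < length xs then 1 else 0)"
    unfolding llen_def ldrop_encode z by (intro sum.cong) auto
  also have "\<dots> = card ({..<list_encode xs} \<inter> {i. i < length xs})"
    by (simp add: sum.If_cases)
  also have "{..<list_encode xs} \<inter> {i. i < length xs} = {..<length xs}"
    using length_le_list_encode[of xs] by auto
  finally show ?thesis by simp
qed

definition ihalf :: "nat \<Rightarrow> nat" where "ihalf e = (\<Sum>i<e. if 2 * Suc i \<le> e then 1 else 0)"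

lemma ihalf: "ihalf e = e div 2"
proof -
  have "ihalf e = card ({..<e} \<inter> {i. 2 * Suc i \<le> e})" by (simp add: ihalf_def sum.If_cases)
  also have "{..<e} \<inter> {i. 2 * Suc i \<le> e} = {..<e div 2}" by auto
  finally show ?thesis by simp
qed

definition ipos :: "nat \<Rightarrow> nat" where "ipos e = nat (int_decode e)"
definition ineg :: "nat \<Rightarrow> nat" where "ineg e = nat (- int_decode e)"

text \<open>\<open>int_encode\<close> uses even codes for nonnegative and odd codes for negative
  integers.\<close>

lemma ipos_eq: "ipos e = (if e - 2 * ihalf e = 0 then ihalf e else 0)"
  and ineg_eq: "ineg e = (if e - 2 * ihalf e = 0 then 0 else Suc (ihalf e))"
  by (auto simp: ipos_def ineg_def ihalf int_decode_def sum_decode_def elim!: evenE oddE)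

lemma rf_ihalf: "rf n f \<Longrightarrow> rf n (\<lambda>xs. ihalf (f xs))"
  unfolding ihalf_def by (intro rf_sum rf_if_le rf_mult rf_Suc rf_drop2 rf_nth rf_const) simp_all

lemma rf_ipos: "rf n f \<Longrightarrow> rf n (\<lambda>xs. ipos (f xs))"
  unfolding ipos_eq by (intro rf_if_eq rf_diff rf_mult rf_ihalf rf_const)

lemma rf_ineg: "rf n f \<Longrightarrow> rf n (\<lambda>xs. ineg (f xs))"
  unfolding ineg_eq by (intro rf_if_eq rf_diff rf_mult rf_ihalf rf_const rf_Suc)

definition rfi :: "nat \<Rightarrow> (nat list \<Rightarrow> int) \<Rightarrow> bool" where
  "rfi n F \<longleftrightarrow> rf n (\<lambda>xs. int_encode (F xs))"

text \<open>At most one of the truncated differences is nonzero; the code is then the even number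
  \<open>2 * (a - b)\<close> or the odd number \<open>2 * (b - a) - 1\<close>.\<close>

lemma rfi_intro: "rf n f \<Longrightarrow> rf n g \<Longrightarrow> rfi n (\<lambda>xs. int (f xs) - int (g xs))"
proof -
  assume fg: "rf n f" "rf n g"
  have "rf n (\<lambda>xs. 2 * (f xs - g xs) + (2 * (g xs - f xs) - 1))"
    by (intro rf_add rf_mult rf_diff rf_const fg)
  moreover have "2 * (a - b) + (2 * (b - a) - 1) = int_encode (int a - int b)" for a b
    by (auto simp: int_encode_def sum_encode_def nat_diff_distrib' of_nat_diff)
  ultimately show ?thesis unfolding rfi_def by simp
qed

lemma rfi_pos: "rfi n F \<Longrightarrow> rf n (\<lambda>xs. nat (F xs))" and rfi_neg: "rfi n F \<Longrightarrow> rf n (\<lambda>xs. nat (- F xs))"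
  unfolding rfi_def by (drule rf_ipos, simp add: ipos_def) (drule rf_ineg, simp add: ineg_def)

lemma rfi_decode: "rf n f \<Longrightarrow> rfi n (\<lambda>xs. int_decode (f xs))"
  by (simp add: rfi_def)

lemma rfi_diff: assumes "rfi n F" "rfi n G" shows "rfi n (\<lambda>xs. F xs - G xs)"
proof -
  have "rfi n (\<lambda>xs. int (nat (F xs) + nat (- G xs)) - int (nat (- F xs) + nat (G xs)))"
    by (intro rfi_intro rf_add rfi_pos rfi_neg assms)
  moreover have "int (nat a + nat (- b)) - int (nat (- a) + nat b) = a - b" for a b by linarith
  ultimately show ?thesis by simp
qed

lemma rfi_mult: assumes "rfi n F" "rfi n G" shows "rfi n (\<lambda>xs. F xs * G xs)"
proof -
  have "rfi n (\<lambda>xs. int (nat (F xs) * nat (G xs) + nat (- F xs) * nat (- G xs)) - int (nat (F xs) * nat (- G xs) + nat (- F xs) * nat (G xs)))"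
    by (intro rfi_intro rf_add rf_mult rfi_pos rfi_neg assms)
  moreover have "int (nat a * nat b + nat (- a) * nat (- b)) - int (nat a * nat (- b) + nat (- a) * nat b) = a * b" for a b
    by (cases "0 \<le> a"; cases "0 \<le> b") auto
  ultimately show ?thesis by simp
qed

lemma rfi_sum:
  assumes s: "rfi (Suc (Suc n)) (\<lambda>ys. s (ys ! 0) (drop 2 ys))" and h: "rf n h"
  shows "rfi n (\<lambda>xs. \<Sum>i<h xs. s i xs)"
proof -
  have "rfi n (\<lambda>xs. int (\<Sum>i<h xs. nat (s i xs)) - int (\<Sum>i<h xs. nat (- s i xs)))"
    by (intro rfi_intro rf_sum[where s = "\<lambda>i xs. nat (s i xs)"] rf_sum[where s = "\<lambda>i xs. nat (- s i xs)"]
      rfi_pos[OF s] rfi_neg[OF s] h)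
  moreover have "int (\<Sum>i<b. nat (F i)) - int (\<Sum>i<b. nat (- F i)) = (\<Sum>i<b. F i)" for F and b :: nat
  proof -
    have "int (\<Sum>i<b. nat (F i)) - int (\<Sum>i<b. nat (- F i)) = (\<Sum>i<b. int (nat (F i)) - int (nat (- F i)))"
      by (simp only: of_nat_sum sum_subtractf)
    also have "\<dots> = (\<Sum>i<b. F i)" by (rule sum.cong) auto
    finally show ?thesis .
  qed
  ultimately show ?thesis by simp
qed

text \<open>\<open>hist c u n\<close> codes the list of the terms \<open>U n, \<dots>, U 0\<close>, most recent first.\<close>

definition next_term :: "nat \<Rightarrow> nat \<Rightarrow> nat \<Rightarrow> nat \<Rightarrow> nat" where
  "next_term c u m r = (if llen c \<le> Suc m
     then int_encode (\<Sum>i<llen c. int_decode (lnth c i) * int_decode (lnth r i)) else lnth u (Suc m))"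

definition hist :: "nat \<Rightarrow> nat \<Rightarrow> nat \<Rightarrow> nat" where
  "hist c u n = rec_nat (lcons (lnth u 0) 0) (\<lambda>m r. lcons (next_term c u m r) r) n"

definition term_code :: "nat \<Rightarrow> nat \<Rightarrow> nat \<Rightarrow> nat" where
  "term_code c u n = lhd (hist c u n)"

lemma rf_next_term:
  assumes "rf n c" "rf n u" "rf n m" "rf n r"
  shows "rf n (\<lambda>xs. next_term (c xs) (u xs) (m xs) (r xs))"
proof -
  have "rfi n (\<lambda>xs. \<Sum>i<llen (c xs). int_decode (lnth (c xs) i) * int_decode (lnth (r xs) i))"
    by (intro rfi_sum rfi_mult rfi_decode rf_lnth rf_llen rf_drop2 assms rf_nth) simp_all
  then show ?thesis
    unfolding next_term_def rfi_def by (intro rf_if_le rf_llen rf_Suc rf_lnth assms)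
qed

lemma rf_term_code:
  assumes "rf n c" "rf n u" "rf n m"
  shows "rf n (\<lambda>xs. term_code (c xs) (u xs) (m xs))"
  unfolding term_code_def hist_def
  by (intro rf_lhd rf_rec rf_lcons rf_next_term rf_lnth rf_const rf_drop2 assms rf_nth) simp_all

lemma hist_encode:
  assumes "linear_recurrence cs U"
  shows "hist (encode_ints cs) (encode_ints (map U [0..<length cs])) n
    = list_encode (map (\<lambda>i. int_encode (U (n - i))) [0..<Suc n])"
proof (induction n)
  case 0
  have "0 < length cs" using assms unfolding linear_recurrence_def by simp
  then have "lnth (encode_ints (map U [0..<length cs])) 0 = int_encode (U 0)"
    unfolding encode_ints_def by (subst lnth_encode) auto
  then show ?case using lcons_encode[of _ "[]"] by (simp add: hist_def)
next
  case (Suc n)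
  let ?c = "encode_ints cs" and ?u = "encode_ints (map U [0..<length cs])"
  let ?r = "list_encode (map (\<lambda>i. int_encode (U (n - i))) [0..<Suc n])"
  have len: "llen ?c = length cs" by (simp add: encode_ints_def llen_encode)
  have "next_term ?c ?u n ?r = int_encode (U (Suc n))"
  proof (cases "length cs \<le> Suc n")
    case True
    define m where "m = Suc n - length cs"
    have n: "Suc n = m + length cs" using True by (simp add: m_def)
    have "U (Suc n) = (\<Sum>i<length cs. cs ! i * U (m + (length cs - 1 - i)))"
      using assms unfolding linear_recurrence_def n by blast
    also have "\<dots> = (\<Sum>i<length cs. int_decode (lnth ?c i) * int_decode (lnth ?r i))"
    proof (rule sum.cong[OF refl])
      fix i assume "i \<in> {..<length cs}"
      then have i: "i < length cs" by simp
      have "lnth ?c i = int_encode (cs ! i)" using i by (simp add: encode_ints_def lnth_encode)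
      moreover have "lnth ?r i = int_encode (U (n - i))"
        using i n by (subst lnth_encode) (auto simp del: upt_Suc)
      \<comment> \<open>As the history starts with the latest term, its position \<open>i\<close>
        holds exactly the factor of \<open>cs ! i\<close>.\<close>
      moreover have "m + (length cs - 1 - i) = n - i" using i n by linarith
      ultimately show "cs ! i * U (m + (length cs - 1 - i)) = int_decode (lnth ?c i) * int_decode (lnth ?r i)" by simp
    qed
    finally show ?thesis using True by (simp add: next_term_def len)
  next
    case False
    then show ?thesis unfolding next_term_def len by (simp add: encode_ints_def lnth_encode)
  qed
  moreover have "map (\<lambda>i. int_encode (U (Suc n - i))) [0..<Suc (Suc n)]
    = int_encode (U (Suc n)) # map (\<lambda>i. int_encode (U (n - i))) [0..<Suc n]"
  proof -
    have "[0..<Suc (Suc n)] = 0 # map Suc [0..<Suc n]" unfolding map_Suc_upt by (rule upt_conv_Cons[OF zero_less_Suc])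
    then show ?thesis by (simp del: upt_Suc add: comp_def)
  qed
  moreover have "hist ?c ?u (Suc n) = lcons (next_term ?c ?u n (hist ?c ?u n)) (hist ?c ?u n)"
    by (simp add: hist_def)
  ultimately show ?case unfolding Suc by (simp only: lcons_encode)
qed

lemma term_code_encode:
  "linear_recurrence cs U \<Longrightarrow>
    term_code (encode_ints cs) (encode_ints (map U [0..<length cs])) n = int_encode (U n)"
  unfolding term_code_def hist_encode upt_conv_Cons[OF zero_less_Suc] list.map lhd_encode by simp

section \<open>Enumeration of pairs of representations\<close>

definition value_code :: "nat \<Rightarrow> nat \<Rightarrow> nat \<Rightarrow> nat \<Rightarrow> nat \<Rightarrow> nat \<Rightarrow> nat" where
  "value_code c u d w n m = int_encode (int_decode (term_code c u n) - int_decode (term_code d w m))"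

lemma rf_value_code:
  assumes "rf n c" "rf n u" "rf n d" "rf n w" "rf n i" "rf n j"
  shows "rf n (\<lambda>xs. value_code (c xs) (u xs) (d xs) (w xs) (i xs) (j xs))"
proof -
  have "rfi n (\<lambda>xs. int_decode (term_code (c xs) (u xs) (i xs)) - int_decode (term_code (d xs) (w xs) (j xs)))"
    by (intro rfi_diff rfi_decode rf_term_code assms)
  then show ?thesis by (simp add: rfi_def value_code_def)
qed

text \<open>A number \<open>t\<close> codes the quadruple \<open>(n, m, n1, m1)\<close> of a pair of representations.\<close>

definition search_step :: "nat \<Rightarrow> nat \<Rightarrow> nat \<Rightarrow> nat \<Rightarrow> nat \<Rightarrow> nat \<Rightarrow> nat \<Rightarrow> nat \<Rightarrow> nat" where
  "search_step c u d w N M t r =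
    (let n = pfst t; m = pfst (psnd t); n1 = pfst (psnd (psnd t)); m1 = psnd (psnd (psnd t)) in
     if N \<le> n then if N \<le> n1 then if M \<le> m then if M \<le> m1 then
     if prod_encode (n, m) = prod_encode (n1, m1) then r else
     if value_code c u d w n m = value_code c u d w n1 m1 then lcons (value_code c u d w n m) r else r
     else r else r else r else r)"

definition search :: "nat \<Rightarrow> nat \<Rightarrow> nat \<Rightarrow> nat \<Rightarrow> nat \<Rightarrow> nat \<Rightarrow> nat \<Rightarrow> nat" where
  "search c u d w N M T = rec_nat 0 (\<lambda>t r. search_step c u d w N M t r) T"

lemma rf_search:
  assumes "rf n c" "rf n u" "rf n d" "rf n w" "rf n N" "rf n M" "rf n T"
  shows "rf n (\<lambda>xs. search (c xs) (u xs) (d xs) (w xs) (N xs) (M xs) (T xs))"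
  unfolding search_def search_step_def Let_def
  by (intro rf_rec rf_if_le rf_if_eq rf_prod_encode rf_value_code rf_lcons rf_pfst rf_psnd rf_const rf_drop2 assms rf_nth) simp_all

lemma search_encode:
  assumes U: "linear_recurrence cs U" and V: "linear_recurrence ds V"
  shows "\<exists>ys. search (encode_ints cs) (encode_ints (map U [0..<length cs]))
      (encode_ints ds) (encode_ints (map V [0..<length ds])) N M T = encode_ints ys \<and>
    set ys = {U n - V m | n m n1 m1. prod_encode (n, prod_encode (m, prod_encode (n1, m1))) < T \<and>
      (n, m) \<noteq> (n1, m1) \<and> N \<le> n \<and> N \<le> n1 \<and> M \<le> m \<and> M \<le> m1 \<and> U n - V m = U n1 - V m1}"
proof -
  let ?s = "search (encode_ints cs) (encode_ints (map U [0..<length cs]))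
      (encode_ints ds) (encode_ints (map V [0..<length ds])) N M"
  have val: "value_code (encode_ints cs) (encode_ints (map U [0..<length cs]))
      (encode_ints ds) (encode_ints (map V [0..<length ds])) n m = int_encode (U n - V m)" for n m
    by (simp add: value_code_def term_code_encode[OF U] term_code_encode[OF V])
  define P where "P n m n1 m1 \<longleftrightarrow> (n, m) \<noteq> (n1, m1) \<and> N \<le> n \<and> N \<le> n1 \<and> M \<le> m \<and> M \<le> m1 \<and> U n - V m = U n1 - V m1" for n m n1 m1
  define cd where "cd t = (pfst t, pfst (psnd t), pfst (psnd (psnd t)), psnd (psnd (psnd t)))" for t
  define Q where "Q t \<longleftrightarrow> (case cd t of (n, m, n1, m1) \<Rightarrow> P n m n1 m1)" for t
  define W where "W t = (case cd t of (n, m, n1, m1) \<Rightarrow> U n - V m)" for t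
  have step: "search_step (encode_ints cs) (encode_ints (map U [0..<length cs]))
      (encode_ints ds) (encode_ints (map V [0..<length ds])) N M t r = (if Q t then lcons (int_encode (W t)) r else r)" for t r
    unfolding search_step_def Let_def val Q_def W_def cd_def P_def
    by (auto simp: inj_eq[OF inj_int_encode] inj_eq[OF inj_prod_encode])
  have "\<exists>ys. ?s T = encode_ints ys \<and> set ys = {W t | t. t < T \<and> Q t}"
  proof (induction T)
    case 0
    show ?case by (rule exI[of _ "[]"]) (simp add: search_def encode_ints_def)
  next
    case (Suc T)
    then obtain ys where ys: "?s T = encode_ints ys" "set ys = {W t | t. t < T \<and> Q t}" by blast
    have s: "?s (Suc T) = (if Q T then lcons (int_encode (W T)) (?s T) else ?s T)"
      by (simp add: search_def step)
    show ?case
    proof (cases "Q T")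
      case True
      have "?s (Suc T) = encode_ints (W T # ys)"
        unfolding s ys(1) using True by (simp only: if_True encode_ints_def list.map lcons_encode)
      moreover have "set (W T # ys) = {W t | t. t < Suc T \<and> Q t}" using True ys(2) by (auto simp: less_Suc_eq)
      ultimately show ?thesis by blast
    next
      case False
      have "{W t | t. t < Suc T \<and> Q t} = {W t | t. t < T \<and> Q t}" using False by (auto simp: less_Suc_eq)
      then show ?thesis using False s ys by auto
    qed
  qed
  moreover have "{W t | t. t < T \<and> Q t} = {U n - V m | n m n1 m1. prod_encode (n, prod_encode (m, prod_encode (n1, m1))) < T \<and> P n m n1 m1}"
  proof (intro equalityI subsetI)
    fix c assume "c \<in> {W t | t. t < T \<and> Q t}"
    then obtain t where t: "c = W t" "t < T" "Q t" by blast
    have e: "prod_encode (pfst t, prod_encode (pfst (psnd t), prod_encode (pfst (psnd (psnd t)), psnd (psnd (psnd t))))) = t"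
      by (simp add: pfst_def psnd_def)
    show "c \<in> {U n - V m | n m n1 m1. prod_encode (n, prod_encode (m, prod_encode (n1, m1))) < T \<and> P n m n1 m1}"
    proof -
      have "c = U (pfst t) - V (pfst (psnd t)) \<and>
          prod_encode (pfst t, prod_encode (pfst (psnd t), prod_encode (pfst (psnd (psnd t)), psnd (psnd (psnd t))))) < T \<and>
          P (pfst t) (pfst (psnd t)) (pfst (psnd (psnd t))) (psnd (psnd (psnd t)))"
        unfolding e using t by (simp add: Q_def W_def cd_def)
      then show ?thesis by blast
    qed
  next
    fix c assume "c \<in> {U n - V m | n m n1 m1. prod_encode (n, prod_encode (m, prod_encode (n1, m1))) < T \<and> P n m n1 m1}"
    then obtain n m n1 m1 where nm: "c = U n - V m" "prod_encode (n, prod_encode (m, prod_encode (n1, m1))) < T" "P n m n1 m1" by blast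
    show "c \<in> {W t | t. t < T \<and> Q t}"
      by (rule CollectI, rule exI[of _ "prod_encode (n, prod_encode (m, prod_encode (n1, m1)))"])
        (use nm in \<open>simp add: Q_def W_def cd_def\<close>)
  qed
  ultimately show ?thesis unfolding P_def by simp
qed

section \<open>Computing the set\<close>

text \<open>\<open>scale\<close> is evaluated at the fixed index 3, so the induction on
  \<open>i\<close> takes place outside the programs.\<close>

lemma rf_final_bound:
  assumes f: "rf n f"
  shows "rf n (\<lambda>xs. final_bound (bZ (f xs)))"
proof -
  have Z: "rf n (\<lambda>xs. bZ (f xs))"
    unfolding bZ_def bH_def bW_def bG_def bF_def bE_def bD_def bQ_def
    by (intro rf_add rf_mult rf_power f rf_const)
  have "rf n (\<lambda>xs. scale (bZ (f xs)) i)" for i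
  proof (induction i)
    case 0
    show ?case unfolding scale.simps by (rule rf_const)
  next
    case (Suc i)
    show ?case unfolding scale.simps scale_Y_def by (intro rf_mult rf_power Z Suc rf_const)
  qed
  then show ?thesis
    unfolding final_bound_def n_large_def by (intro rf_add rf_mult rf_power Z rf_const)
qed

lemma prod_encode_mono: "a \<le> a' \<Longrightarrow> b \<le> b' \<Longrightarrow> prod_encode (a, b) \<le> prod_encode (a', b')"
  unfolding prod_encode_def triangle_def by (auto intro!: add_mono div_le_mono mult_le_mono)

lemma dominant_data_transfer:
  assumes "dominant_data Z d v U \<rho> \<Delta> e j0" "\<And>B z. hgt d v B z \<Longrightarrow> hgt d' v' B z"
  shows "dominant_data Z d' v' U \<rho> \<Delta> e j0"
  using assms unfolding dominant_data_def by blast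

lemma abs_le_int_encode: "\<bar>i\<bar> \<le> int (int_encode i)"
  by (auto simp: int_encode_def sum_encode_def)

text \<open>The input codes themselves bound the order, the coefficients and the initial values, so
  a bound in terms of the codes is computable from the input.\<close>

lemma encode_ints_bounds:
  shows "length xs \<le> encode_ints xs" "i < length xs \<Longrightarrow> \<bar>xs ! i\<bar> \<le> int (encode_ints xs)"
proof -
  show "length xs \<le> encode_ints xs"
    using length_le_list_encode[of "map int_encode xs"] by (simp add: encode_ints_def)
  assume i: "i < length xs"
  then have "int_encode (xs ! i) \<le> encode_ints xs"
    using nth_le_list_encode[of i "map int_encode xs"] by (simp add: encode_ints_def)
  then show "\<bar>xs ! i\<bar> \<le> int (encode_ints xs)" using abs_le_int_encode[of "xs ! i"] by linarith
qed

lemma dominant_root_data: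
  assumes U: "linear_recurrence cs U" and dom: "dominant_root cs U \<alpha>" and unit: "norm \<alpha> \<noteq> 1"
    and nz: "\<And>n. N \<le> n \<Longrightarrow> U n \<noteq> 0"
    and X: "2 \<le> X" "encode_ints cs \<le> X" "encode_ints (map U [0..<length cs]) \<le> X"
  shows "\<exists>\<rho> \<Delta> e j0. \<alpha> = of_real \<rho> \<and> dominant_data (bZ X) (length cs) (\<lambda>i. \<alpha> ^ i) U \<rho> \<Delta> e j0"
proof -
  obtain a where a: "root_expansion cs U a" "poly (characteristic_poly cs) \<alpha> = 0" "a \<alpha> \<noteq> 0"
    "\<And>r. poly (characteristic_poly cs) r = 0 \<Longrightarrow> a r \<noteq> 0 \<Longrightarrow> r \<noteq> \<alpha> \<Longrightarrow> norm r < norm \<alpha>"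
    using dom unfolding dominant_root_def by blast
  interpret rec_seq cs U a X
  proof
    show "linear_recurrence cs U" "root_expansion cs U a" "2 \<le> X" by (fact U a X)+
    show "length cs \<le> X" using encode_ints_bounds(1)[of cs] X by linarith
    show "\<bar>cs ! i\<bar> \<le> int X" if "i < length cs" for i
      using encode_ints_bounds(2)[OF that] X by linarith
    show "\<bar>U i\<bar> \<le> int X" if "i < length cs" for i
      using encode_ints_bounds(2)[of i "map U [0..<length cs]"] that X by simp
  qed
  have \<rho>: "\<alpha> = of_real (Re \<alpha>)" by (rule dominant_real[OF dom a])
  have "\<bar>Re \<alpha>\<bar> \<noteq> 1" using unit \<rho> by (metis norm_of_real)
  then have "\<exists>\<Delta> e j0. dominant_data (bZ X) (length cs) (\<lambda>i. \<alpha> ^ i) U (Re \<alpha>) \<Delta> e j0"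
    by (intro dominant_data[OF a(2) \<rho> a(3) _ a(4) nz]) auto
  then show ?thesis using \<rho> by blast
qed

lemma strictly_increasing_abs_inj:
  fixes V :: "nat \<Rightarrow> int"
  assumes "\<And>m. M \<le> m \<Longrightarrow> \<bar>V m\<bar> < \<bar>V (m + 1)\<bar>" "M \<le> m" "M \<le> m1" "V m = V m1"
  shows "m = m1"
proof -
  have lt: "\<bar>V i\<bar> < \<bar>V (i + Suc k)\<bar>" if "M \<le> i" for i k
  proof (induction k)
    case 0
    then show ?case using assms(1)[OF that] by simp
  next
    case (Suc k)
    then show ?case using assms(1)[of "i + Suc k"] that by simp
  qed
  show ?thesis
  proof (cases m m1 rule: linorder_cases)
    case less
    then show ?thesis using lt[OF assms(2), of "m1 - m - 1"] assms(4) by simp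
  next
    case greater
    then show ?thesis using lt[OF assms(3), of "m - m1 - 1"] assms(4) by simp
  qed simp
qed

text \<open>Distinct representations differ in both indices, since \<open>U\<close> and
  \<open>V\<close> are injective from \<open>N0\<close> and \<open>M0\<close> on. The two roots
  receive a common eigenvector by a tensor product.\<close>

lemma representations_bounded:
  assumes U: "linear_recurrence cs U" and V: "linear_recurrence ds V"
    and \<alpha>: "dominant_root cs U \<alpha>" and \<beta>: "dominant_root ds V \<beta>"
    and indep: "multiplicatively_independent \<alpha> \<beta>"
    and Ui: "\<And>n. N0 \<le> n \<Longrightarrow> \<bar>U (n + 1)\<bar> > \<bar>U n\<bar> \<and> \<bar>U n\<bar> > 0"
    and Vi: "\<And>m. M0 \<le> m \<Longrightarrow> \<bar>V (m + 1)\<bar> > \<bar>V m\<bar> \<and> \<bar>V m\<bar> > 0"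
    and X: "2 \<le> X" "encode_ints cs \<le> X" "encode_ints (map U [0..<length cs]) \<le> X"
      "encode_ints ds \<le> X" "encode_ints (map V [0..<length ds]) \<le> X"
    and r: "(n, m) \<noteq> (n1, m1)" "N0 \<le> n" "N0 \<le> n1" "M0 \<le> m" "M0 \<le> m1" "U n - V m = U n1 - V m1"
  shows "n \<le> final_bound (bZ X) \<and> m \<le> final_bound (bZ X) \<and> n1 \<le> final_bound (bZ X) \<and> m1 \<le> final_bound (bZ X)"
proof -
  let ?Z = "bZ X"
  have ind: "x = 0 \<and> y = 0" if "\<alpha> powi x * \<beta> powi y = 1" for x y :: int
    using indep that unfolding multiplicatively_independent_def by blast
  have nz: "\<alpha> \<noteq> 0" "\<beta> \<noteq> 0" using indep unfolding multiplicatively_independent_def by auto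
  have not_unit: "z * z = 1" if "z = of_real \<rho>" "norm z = 1" for z :: complex and \<rho>
  proof -
    have "\<bar>\<rho>\<bar> = 1" using that by simp
    then have "\<rho> * \<rho> = 1" by (metis abs_mult_self_eq mult_1)
    then show ?thesis using that(1) by (metis of_real_1 of_real_mult)
  qed
  have real_root: "\<exists>\<rho>. z = of_real \<rho>" if lr: "linear_recurrence es S" and dr: "dominant_root es S z"
    and b: "encode_ints es \<le> X" "encode_ints (map S [0..<length es]) \<le> X" for es S z
  proof -
    obtain a where a: "root_expansion es S a" "poly (characteristic_poly es) z = 0" "a z \<noteq> 0"
      "\<And>r. poly (characteristic_poly es) r = 0 \<Longrightarrow> a r \<noteq> 0 \<Longrightarrow> r \<noteq> z \<Longrightarrow> norm r < norm z"
      using dr unfolding dominant_root_def by blast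
    have "rec_seq es S a X"
    proof
      show "linear_recurrence es S" "root_expansion es S a" "2 \<le> X" by (fact lr a X)+
      show "length es \<le> X" using encode_ints_bounds(1)[of es] b by linarith
      show "\<bar>es ! i\<bar> \<le> int X" if "i < length es" for i
        using encode_ints_bounds(2)[OF that] b by linarith
      show "\<bar>S i\<bar> \<le> int X" if "i < length es" for i
        using encode_ints_bounds(2)[of i "map S [0..<length es]"] that b by simp
    qed
    from rec_seq.dominant_real[OF this dr a] show ?thesis by blast
  qed
  \<comment> \<open>The dominant root is real; on the unit circle its square would be 1, against
    independence.\<close>
  have u\<alpha>: "norm \<alpha> \<noteq> 1"
  proof
    assume "norm \<alpha> = 1"
    then have "\<alpha> * \<alpha> = 1" using real_root[OF U \<alpha> X(2,3)] not_unit by blast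
    then show False using ind[of 2 0] by (simp add: power2_eq_square)
  qed
  have u\<beta>: "norm \<beta> \<noteq> 1"
  proof
    assume "norm \<beta> = 1"
    then have "\<beta> * \<beta> = 1" using real_root[OF V \<beta> X(4,5)] not_unit by blast
    then show False using ind[of 0 2] by (simp add: power2_eq_square)
  qed
  have U0: "U n \<noteq> 0" if "N0 \<le> n" for n using Ui[OF that] by auto
  have V0: "V m \<noteq> 0" if "M0 \<le> m" for m using Vi[OF that] by auto
  obtain \<rho> \<Delta> e j0 where \<rho>: "\<alpha> = of_real \<rho>" "dominant_data ?Z (length cs) (\<lambda>i. \<alpha> ^ i) U \<rho> \<Delta> e j0"
    using dominant_root_data[OF U \<alpha> u\<alpha> U0 X(1-3)] by blast
  obtain \<tau> \<Delta>' e' j0' where \<tau>: "\<beta> = of_real \<tau>" "dominant_data ?Z (length ds) (\<lambda>i. \<beta> ^ i) V \<tau> \<Delta>' e' j0'"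
    using dominant_root_data[OF V \<beta> u\<beta> V0 X(1,4,5)] by blast
  define d where "d = length cs * length ds"
  define v where "v = (\<lambda>i. \<alpha> ^ (i div length ds) * \<beta> ^ (i mod length ds))"
  have len: "length cs \<le> X" "length ds \<le> X"
    using encode_ints_bounds(1)[of cs] encode_ints_bounds(1)[of ds] X by linarith+
  have pos: "0 < length cs" "0 < length ds" using U V unfolding linear_recurrence_def by auto
  have d: "0 < d" "d \<le> ?Z" "1000 \<le> ?Z"
  proof -
    show "0 < d" using pos by (simp add: d_def)
    have "d \<le> X * X" unfolding d_def by (intro mult_mono len) auto
    then show "d \<le> ?Z" "1000 \<le> ?Z" unfolding bZ_def power2_eq_square by linarith+
  qed
  have dU: "dominant_data ?Z d v U \<rho> \<Delta> e j0"
    by (rule dominant_data_transfer[OF \<rho>(2)]) (simp add: d_def v_def hgt_tensor1)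
  have dV: "dominant_data ?Z d v V \<tau> \<Delta>' e' j0'"
    by (rule dominant_data_transfer[OF \<tau>(2)]) (simp add: d_def v_def hgt_tensor2)
  have v0: "v 0 \<noteq> 0" by (simp add: v_def)
  have sU: "dom_seq ?Z d v 0 U \<rho> \<Delta> e j0" by unfold_locales (use dU d v0 in auto)
  have sV: "dom_seq ?Z d v 0 V \<tau> \<Delta>' e' j0'" by unfold_locales (use dV d v0 in auto)
  have ind': "\<rho> ^ x \<noteq> \<tau> ^ y" if "1 \<le> x" for x y :: nat
  proof
    assume "\<rho> ^ x = \<tau> ^ y"
    then have "\<alpha> ^ x = \<beta> ^ y" unfolding \<rho>(1) \<tau>(1) by (metis of_real_power)
    then have "\<alpha> powi int x * \<beta> powi (- int y) = 1" using nz by (simp add: power_int_minus)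
    then show False using ind that by fastforce
  qed
  have nn: "n \<noteq> n1" and mm: "m \<noteq> m1"
  proof -
    show "n \<noteq> n1"
    proof
      assume "n = n1"
      then have "V m = V m1" using r(6) by simp
      then have "m = m1" using strictly_increasing_abs_inj[of M0 V m m1] Vi r by blast
      then show False using \<open>n = n1\<close> r(1) by simp
    qed
    show "m \<noteq> m1"
    proof
      assume "m = m1"
      then have "U n = U n1" using r(6) by simp
      then have "n = n1" using strictly_increasing_abs_inj[of N0 U n n1] Ui r by blast
      then show False using \<open>m = m1\<close> r(1) by simp
    qed
  qed
  \<comment> \<open>Sorting the two indices of each sequence separately may change the sign of one
    difference, hence the absolute values in \<open>solutions_bounded\<close>.\<close>
  define a a' b b' where "a = max n n1" and "a' = min n n1" and "b = max m m1" and "b' = min m m1"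
  have ab: "a' < a" "b' < b" using nn mm by (auto simp: a_def a'_def b_def b'_def)
  have "\<bar>U a - U a'\<bar> = \<bar>U n - U n1\<bar>" by (auto simp: a_def a'_def max_def min_def)
  also have "\<dots> = \<bar>V m - V m1\<bar>" using r(6) by linarith
  also have "\<dots> = \<bar>V b - V b'\<bar>" by (auto simp: b_def b'_def max_def min_def)
  finally have "\<bar>U a - U a'\<bar> = \<bar>V b - V b'\<bar>" .
  from solutions_bounded[OF sU sV ab this ind'] show ?thesis by (auto simp: a_def b_def)
qed

theorem theorem2:
  "\<exists>p :: recf. \<forall>(cs :: int list) (ds :: int list) (U :: nat \<Rightarrow> int) (V :: nat \<Rightarrow> int)
      (\<alpha> :: complex) (\<beta> :: complex) (N\<^sub>0 :: nat) (M\<^sub>0 :: nat).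
     linear_recurrence cs U \<longrightarrow>
     linear_recurrence ds V \<longrightarrow>
     dominant_root cs U \<alpha> \<longrightarrow>
     dominant_root ds V \<beta> \<longrightarrow>
     multiplicatively_independent \<alpha> \<beta> \<longrightarrow>
     (\<forall>n\<ge>N\<^sub>0. \<bar>U (n + 1)\<bar> > \<bar>U n\<bar> \<and> \<bar>U n\<bar> > 0) \<longrightarrow>
     (\<forall>m\<ge>M\<^sub>0. \<bar>V (m + 1)\<bar> > \<bar>V m\<bar> \<and> \<bar>V m\<bar> > 0) \<longrightarrow>
     (\<exists>C :: int set. finite C \<and>
        (\<forall>c. two_representations U V N\<^sub>0 M\<^sub>0 c \<longleftrightarrow> c \<in> C) \<and>
        computes_int_set p (recurrence_data cs U @ recurrence_data ds V @ [N\<^sub>0, M\<^sub>0]) C)"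
proof -
  define B where "B xs = final_bound (bZ (xs ! 0 + xs ! 1 + xs ! 2 + xs ! 3 + 2))" for xs :: "nat list"
  \<comment> \<open>The pairing is monotone, so every quadruple with components up to
    \<open>B xs\<close> has a code below \<open>T xs\<close>.\<close>
  define T where "T xs = Suc (prod_encode (B xs, prod_encode (B xs, prod_encode (B xs, B xs))))" for xs
  have B: "rf 6 B" unfolding B_def by (intro rf_final_bound rf_add rf_nth rf_const) simp_all
  have "rf 6 (\<lambda>xs. search (xs ! 0) (xs ! 1) (xs ! 2) (xs ! 3) (xs ! 4) (xs ! 5) (T xs))"
    unfolding T_def by (intro rf_search rf_nth rf_Suc rf_prod_encode B) simp_all
  then obtain p where p: "\<And>xs. length xs = 6 \<Longrightarrow>
      computes p xs (search (xs ! 0) (xs ! 1) (xs ! 2) (xs ! 3) (xs ! 4) (xs ! 5) (T xs))"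
    unfolding rf_def by blast
  show ?thesis
  proof (intro exI[of _ p] allI impI)
    fix cs ds :: "int list" and U V :: "nat \<Rightarrow> int" and \<alpha> \<beta> :: complex and N\<^sub>0 M\<^sub>0 :: nat
    assume U: "linear_recurrence cs U" and V: "linear_recurrence ds V"
      and \<alpha>: "dominant_root cs U \<alpha>" and \<beta>: "dominant_root ds V \<beta>"
      and indep: "multiplicatively_independent \<alpha> \<beta>"
      and Ui: "\<forall>n\<ge>N\<^sub>0. \<bar>U (n + 1)\<bar> > \<bar>U n\<bar> \<and> \<bar>U n\<bar> > 0"
      and Vi: "\<forall>m\<ge>M\<^sub>0. \<bar>V (m + 1)\<bar> > \<bar>V m\<bar> \<and> \<bar>V m\<bar> > 0"
    let ?xs = "recurrence_data cs U @ recurrence_data ds V @ [N\<^sub>0, M\<^sub>0]"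
    have xs: "length ?xs = 6" "?xs ! 0 = encode_ints cs" "?xs ! 1 = encode_ints (map U [0..<length cs])"
      "?xs ! 2 = encode_ints ds" "?xs ! 3 = encode_ints (map V [0..<length ds])" "?xs ! 4 = N\<^sub>0" "?xs ! 5 = M\<^sub>0"
      by (simp_all add: recurrence_data_def)
    obtain ys where ys: "search (encode_ints cs) (encode_ints (map U [0..<length cs]))
        (encode_ints ds) (encode_ints (map V [0..<length ds])) N\<^sub>0 M\<^sub>0 (T ?xs) = encode_ints ys"
      "set ys = {U n - V m | n m n1 m1. prod_encode (n, prod_encode (m, prod_encode (n1, m1))) < T ?xs \<and>
        (n, m) \<noteq> (n1, m1) \<and> N\<^sub>0 \<le> n \<and> N\<^sub>0 \<le> n1 \<and> M\<^sub>0 \<le> m \<and> M\<^sub>0 \<le> m1 \<and> U n - V m = U n1 - V m1}"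
      using search_encode[OF U V, of N\<^sub>0 M\<^sub>0 "T ?xs"] by blast
    define X where "X = encode_ints cs + encode_ints (map U [0..<length cs]) + encode_ints ds + encode_ints (map V [0..<length ds]) + 2"
    have BX: "B ?xs = final_bound (bZ X)" unfolding B_def xs X_def ..
    show "\<exists>C :: int set. finite C \<and> (\<forall>c. two_representations U V N\<^sub>0 M\<^sub>0 c \<longleftrightarrow> c \<in> C) \<and> computes_int_set p ?xs C"
    proof (intro exI[of _ "set ys"] conjI allI)
      show "finite (set ys)" by simp
      show "computes_int_set p ?xs (set ys)"
        unfolding computes_int_set_def using p[OF xs(1)] unfolding xs ys(1) by blast
      fix c
      show "two_representations U V N\<^sub>0 M\<^sub>0 c \<longleftrightarrow> c \<in> set ys"
      proof
        assume "two_representations U V N\<^sub>0 M\<^sub>0 c"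
        then obtain n m n1 m1 where r: "(n, m) \<noteq> (n1, m1)" "N\<^sub>0 \<le> n" "N\<^sub>0 \<le> n1" "M\<^sub>0 \<le> m" "M\<^sub>0 \<le> m1"
          "U n - V m = c" "U n1 - V m1 = c"
          unfolding two_representations_def by blast
        have "n \<le> final_bound (bZ X) \<and> m \<le> final_bound (bZ X) \<and> n1 \<le> final_bound (bZ X) \<and> m1 \<le> final_bound (bZ X)"
        proof (rule representations_bounded[OF U V \<alpha> \<beta> indep])
          show "(n, m) \<noteq> (n1, m1)" "N\<^sub>0 \<le> n" "N\<^sub>0 \<le> n1" "M\<^sub>0 \<le> m" "M\<^sub>0 \<le> m1" by (fact r)+
          show "U n - V m = U n1 - V m1" using r by simp
        qed (use Ui Vi in \<open>auto simp: X_def\<close>)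
        then have "prod_encode (n, prod_encode (m, prod_encode (n1, m1))) < T ?xs"
          unfolding T_def BX less_Suc_eq_le by (intro prod_encode_mono) auto
        then show "c \<in> set ys"
          unfolding ys(2) by (intro CollectI exI[of _ n] exI[of _ m] exI[of _ n1] exI[of _ m1]) (use r in simp)
      next
        assume "c \<in> set ys"
        then obtain n m n1 m1 where r: "c = U n - V m" "(n, m) \<noteq> (n1, m1)" "N\<^sub>0 \<le> n" "N\<^sub>0 \<le> n1" "M\<^sub>0 \<le> m" "M\<^sub>0 \<le> m1"
          "U n - V m = U n1 - V m1"
          unfolding ys(2) by blast
        show "two_representations U V N\<^sub>0 M\<^sub>0 c"
          unfolding two_representations_def
          by (rule exI[of _ n], rule exI[of _ m], rule exI[of _ n1], rule exI[of _ m1]) (use r in simp)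
      qed
    qed
  qed
qed

end
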